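(* Let $\mathbf{k}$ be a field, let $a<b$ and $c<d$ be real numbers, and let $\mathbf{k}[a,b)$ and $\mathbf{k}[c,d)$ be the corresponding interval modules over $(\mathbb{R},\le)$. Then: \begin{itemize} \item $\mathbf{k}[a,b)\otimes_{\mathbf{gr}} \mathbf{k}[c,d)\cong\mathbf{k}[a+c,\min\{a+d,b+c\})$; \item $\underline{\mathrm{Hom}}(\mathbf{k}[a,b),\mathbf{k}[c,d))\cong\mathbf{k}[\max\{c-a,d-b\},d-a)$; \item $\mathbf{Tor}^{\mathbf{gr}}_1(\mathbf{k}[a,b),\mathbf{k}[c,d))\cong\mathbf{k}[\max\{a+d,b+c\},b+d)$; \item $\mathbf{Ext}_{\mathbf{gr}}^1(\mathbf{k}[a,b),\mathbf{k}[c,d))\cong\mathbf{k}[c-b,\min\{c-a,d-b\})$. \end{itemize}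
   Context: Here a persistence module is a functor $M:\mathbf{R}\to \mathbf{Vect}_{\mathbf{k}}$ from the poset $(\mathbb{R},\le)$ (viewed as a category) to $\mathbf{k}$-vector spaces; morphisms are natural transformations, and $\mathrm{Hom}(M,N)$ denotes the vector space of natural transformations. Equivalently, $M$ is an $\mathbb{R}$-graded module $\bigoplus_a M_a$ over the monoid ring $\mathbf{k}[U_0]$, $U_0=[0,\infty)$, where $x^s$ acts as $M_{a\le a+s}$. For an interval $I\subset\mathbb{R}$, the interval module $\mathbf{k}[I]$ has $\mathbf{k}[I]_x=\mathbf{k}$ for $x\in I$ and $0$ otherwise, with $\mathbf{k}[I]_{x\le y}$ the identity when $x,y\in I$ and zero otherwise; $\mathbf{k}[a,b)$ abbreviates $\mathbf{k}[[a,b)]$. The graded module tensor product is $(M\otimes_{\mathbf{gr}}N)_r=\operatorname{colim}_{s+t\le r}M_s\otimes_{\mathbf{k}}N_t$ (colimit over pairs $(s,t)$ with $s+t\le r$, with the product order), with the induced maps for $r\le r'$; it is the tensor product of graded $\mathbf{k}[U_0]$-modules. For $s\in\mathbb{R}$, $N(s)_x=N_{s+x}$ is the translation of $N$. The graded internal hom is $\underline{\mathrm{Hom}}(M,N)_s=\mathrm{Hom}(M,N(s))$, with map for $s\le t$ given by composing each component $M_x\to N_{x+s}$ with $N_{x+s\le x+t}$. $\mathbf{Tor}^{\mathbf{gr}}_i$ and $\mathbf{Ext}^i_{\mathbf{gr}}$ denote the $i$-th left derived functor of $\otimes_{\mathbf{gr}}$ and the $i$-th right derived functor of $\underline{\mathrm{Hom}}$,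 respectively, computed in the abelian category of persistence modules. *)

theory Defs
  imports Complex_Main "HOL-Algebra.Module" "HOL-Algebra.AbelCoset" "HOL-Library.Product_Order"
begin

text \<open>
  A vector space over the field \<open>K\<close> is a \<open>module K V\<close> of HOL-Algebra. The module records are
  extensions of ring records; the multiplicative fields are never used below.
\<close>

section \<open>Linear algebra\<close>

definition linear_maps ::
  "('k, 'm) ring_scheme \<Rightarrow> ('k, 'v, 'p) module_scheme \<Rightarrow> ('k, 'w, 'q) module_scheme \<Rightarrow> ('v \<Rightarrow> 'w) set" where
  "linear_maps K V W = {f \<in> carrier V \<rightarrow> carrier W.
     (\<forall>x\<in>carrier V. \<forall>y\<in>carrier V. f (x \<oplus>\<^bsub>V\<^esub> y) = f x \<oplus>\<^bsub>W\<^esub> f y) \<and>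
     (\<forall>c\<in>carrier K. \<forall>x\<in>carrier V. f (c \<odot>\<^bsub>V\<^esub> x) = c \<odot>\<^bsub>W\<^esub> f x)}"

definition lin_span :: "('k, 'm) ring_scheme \<Rightarrow> ('k, 'v) module \<Rightarrow> 'v set \<Rightarrow> 'v set" where
  "lin_span K V S = (\<lambda>H. submodule H K V) hull S"

text \<open>For \<open>f\<close> sending each coset in the source into a single coset of \<open>H\<close> in \<open>V\<close>: the induced map
  on cosets.\<close>

definition coset_map :: "('k, 'w) module \<Rightarrow> 'w set \<Rightarrow> ('v \<Rightarrow> 'w) \<Rightarrow> 'v set \<Rightarrow> 'w set" where
  "coset_map V H f X = the_elem ((\<lambda>x. H +>\<^bsub>V\<^esub> f x) ` X)"

definition quot_module :: "('k, 'v) module \<Rightarrow> 'v set \<Rightarrow> ('k, 'v set) module" where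
  "quot_module V H =
    \<lparr>carrier = a_rcosets\<^bsub>V\<^esub> H, mult = undefined, one = undefined,
     zero = H, add = (\<lambda>X Y. X <+>\<^bsub>V\<^esub> Y),
     smult = (\<lambda>c. coset_map V H (\<lambda>x. c \<odot>\<^bsub>V\<^esub> x))\<rparr>"

definition direct_sum :: "'i set \<Rightarrow> ('i \<Rightarrow> ('k, 'v) module) \<Rightarrow> ('k, 'i \<Rightarrow> 'v) module" where
  "direct_sum I V =
    \<lparr>carrier = {f \<in> (\<Pi>\<^sub>E i\<in>I. carrier (V i)). finite {i\<in>I. f i \<noteq> \<zero>\<^bsub>V i\<^esub>}},
     mult = undefined, one = undefined,
     zero = (\<lambda>i\<in>I. \<zero>\<^bsub>V i\<^esub>), add = (\<lambda>f g. \<lambda>i\<in>I. f i \<oplus>\<^bsub>V i\<^esub> g i),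
     smult = (\<lambda>c f. \<lambda>i\<in>I. c \<odot>\<^bsub>V i\<^esub> f i)\<rparr>"

definition direct_sum_in :: "'i set \<Rightarrow> ('i \<Rightarrow> ('k, 'v) module) \<Rightarrow> 'i \<Rightarrow> 'v \<Rightarrow> 'i \<Rightarrow> 'v" where
  "direct_sum_in I V i x = (\<lambda>j\<in>I. if j = i then x else \<zero>\<^bsub>V j\<^esub>)"

definition self_module :: "('k, 'm) ring_scheme \<Rightarrow> ('k, 'k) module" where
  "self_module K =
    \<lparr>carrier = carrier K, mult = mult K, one = one K, zero = zero K, add = add K, smult = mult K\<rparr>"

definition free_module :: "('k, 'm) ring_scheme \<Rightarrow> 's set \<Rightarrow> ('k, 's \<Rightarrow> 'k) module" where
  "free_module K S = direct_sum S (\<lambda>_. self_module K)"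

definition free_basis :: "('k, 'm) ring_scheme \<Rightarrow> 's set \<Rightarrow> 's \<Rightarrow> 's \<Rightarrow> 'k" where
  "free_basis K S s = direct_sum_in S (\<lambda>_. self_module K) s \<one>\<^bsub>K\<^esub>"

subsection \<open>Tensor products of vector spaces\<close>

definition tensor_rel ::
  "('k, 'm) ring_scheme \<Rightarrow> ('k, 'v) module \<Rightarrow> ('k, 'w) module \<Rightarrow> ('v \<times> 'w \<Rightarrow> 'k) set" where
  "tensor_rel K V W =
    (let F = free_module K (carrier V \<times> carrier W);
         e = (\<lambda>v w. free_basis K (carrier V \<times> carrier W) (v, w))
     in lin_span K F
      ({e (v \<oplus>\<^bsub>V\<^esub> v') w \<ominus>\<^bsub>F\<^esub> (e v w \<oplus>\<^bsub>F\<^esub> e v' w) | v v' w.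
          v \<in> carrier V \<and> v' \<in> carrier V \<and> w \<in> carrier W} \<union>
       {e v (w \<oplus>\<^bsub>W\<^esub> w') \<ominus>\<^bsub>F\<^esub> (e v w \<oplus>\<^bsub>F\<^esub> e v w') | v w w'.
          v \<in> carrier V \<and> w \<in> carrier W \<and> w' \<in> carrier W} \<union>
       {e (c \<odot>\<^bsub>V\<^esub> v) w \<ominus>\<^bsub>F\<^esub> (c \<odot>\<^bsub>F\<^esub> e v w) | c v w.
          c \<in> carrier K \<and> v \<in> carrier V \<and> w \<in> carrier W} \<union>
       {e v (c \<odot>\<^bsub>W\<^esub> w) \<ominus>\<^bsub>F\<^esub> (c \<odot>\<^bsub>F\<^esub> e v w) | c v w.
          c \<in> carrier K \<and> v \<in> carrier V \<and> w \<in> carrier W}))"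

definition tensor ::
  "('k, 'm) ring_scheme \<Rightarrow> ('k, 'v) module \<Rightarrow> ('k, 'w) module \<Rightarrow> ('k, ('v \<times> 'w \<Rightarrow> 'k) set) module" where
  "tensor K V W = quot_module (free_module K (carrier V \<times> carrier W)) (tensor_rel K V W)"

definition pure_tensor ::
  "('k, 'm) ring_scheme \<Rightarrow> ('k, 'v) module \<Rightarrow> ('k, 'w) module \<Rightarrow> 'v \<Rightarrow> 'w \<Rightarrow> ('v \<times> 'w \<Rightarrow> 'k) set" where
  "pure_tensor K V W v w =
    tensor_rel K V W +>\<^bsub>free_module K (carrier V \<times> carrier W)\<^esub>
      free_basis K (carrier V \<times> carrier W) (v, w)"

text \<open>The map \<open>f \<otimes> g : V \<otimes> W \<rightarrow> V' \<otimes> W'\<close>, sending the class of the formal combination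
  \<open>\<Sum> x (v, w) (v, w)\<close> to \<open>\<Sum> x (v, w) (f v \<otimes> g w)\<close>.\<close>

definition tensor_map ::
  "('k, 'm) ring_scheme \<Rightarrow> ('k, 'v) module \<Rightarrow> ('k, 'w) module \<Rightarrow> ('k, 'v') module \<Rightarrow> ('k, 'w') module \<Rightarrow>
   ('v \<Rightarrow> 'v') \<Rightarrow> ('w \<Rightarrow> 'w') \<Rightarrow> ('v \<times> 'w \<Rightarrow> 'k) set \<Rightarrow> ('v' \<times> 'w' \<Rightarrow> 'k) set" where
  "tensor_map K V W V' W' f g X =
    the_elem ((\<lambda>x. finsum (tensor K V' W')
        (\<lambda>(v, w). x (v, w) \<odot>\<^bsub>tensor K V' W'\<^esub> pure_tensor K V' W' (f v) (g w))
        {p \<in> carrier V \<times> carrier W. x p \<noteq> \<zero>\<^bsub>K\<^esub>}) ` X)"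

subsection \<open>Colimits of diagrams of vector spaces over posets\<close>

definition colim_rel ::
  "('k, 'm) ring_scheme \<Rightarrow> 'i::order set \<Rightarrow> ('i \<Rightarrow> ('k, 'v) module) \<Rightarrow> ('i \<Rightarrow> 'i \<Rightarrow> 'v \<Rightarrow> 'v) \<Rightarrow> ('i \<Rightarrow> 'v) set" where
  "colim_rel K I V t = lin_span K (direct_sum I V)
     {direct_sum_in I V i x \<ominus>\<^bsub>direct_sum I V\<^esub> direct_sum_in I V j (t i j x) | i j x.
        i \<in> I \<and> j \<in> I \<and> i \<le> j \<and> x \<in> carrier (V i)}"

definition colim ::
  "('k, 'm) ring_scheme \<Rightarrow> 'i::order set \<Rightarrow> ('i \<Rightarrow> ('k, 'v) module) \<Rightarrow> ('i \<Rightarrow> 'i \<Rightarrow> 'v \<Rightarrow> 'v) \<Rightarrow>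
   ('k, ('i \<Rightarrow> 'v) set) module" where
  "colim K I V t = quot_module (direct_sum I V) (colim_rel K I V t)"

text \<open>Given a diagram on \<open>I\<close>, a diagram \<open>(V', t')\<close> on \<open>I' \<supseteq> I\<close> and compatible maps \<open>h i\<close> from the
  \<open>i\<close>-th space of the former to \<open>V' i\<close>, the induced map of colimits.\<close>

definition colim_map ::
  "('k, 'm) ring_scheme \<Rightarrow> 'i::order set \<Rightarrow> 'i set \<Rightarrow> ('i \<Rightarrow> ('k, 'w) module) \<Rightarrow> ('i \<Rightarrow> 'i \<Rightarrow> 'w \<Rightarrow> 'w) \<Rightarrow>
   ('i \<Rightarrow> 'v \<Rightarrow> 'w) \<Rightarrow> ('i \<Rightarrow> 'v) set \<Rightarrow> ('i \<Rightarrow> 'w) set" where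
  "colim_map K I I' V' t' h =
    coset_map (direct_sum I' V') (colim_rel K I' V' t')
      (\<lambda>f. \<lambda>i\<in>I'. if i \<in> I then h i (f i) else \<zero>\<^bsub>V' i\<^esub>)"

section \<open>Persistence modules\<close>

record ('k, 'v) persmod =
  sp :: "real \<Rightarrow> ('k, 'v) module"
  tr :: "real \<Rightarrow> real \<Rightarrow> 'v \<Rightarrow> 'v"

locale persistence_module = field K for K (structure) and M :: "('k, 'v) persmod" +
  assumes vector_space: "\<And>x. module K (sp M x)"
    and tr_linear: "\<And>x y. x \<le> y \<Longrightarrow> tr M x y \<in> linear_maps K (sp M x) (sp M y)"
    and tr_id: "\<And>x v. v \<in> carrier (sp M x) \<Longrightarrow> tr M x x v = v"
    and tr_comp: "\<And>x y z v. x \<le> y \<Longrightarrow> y \<le> z \<Longrightarrow> v \<in> carrier (sp M x) \<Longrightarrow>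
      tr M y z (tr M x y v) = tr M x z v"

definition nat_trans ::
  "('k, 'm) ring_scheme \<Rightarrow> ('k, 'v) persmod \<Rightarrow> ('k, 'w) persmod \<Rightarrow> (real \<Rightarrow> 'v \<Rightarrow> 'w) set" where
  "nat_trans K M N = {\<phi>.
     (\<forall>x. \<phi> x \<in> linear_maps K (sp M x) (sp N x)) \<and>
     (\<forall>x y. x \<le> y \<longrightarrow> (\<forall>v\<in>carrier (sp M x). \<phi> y (tr M x y v) = tr N x y (\<phi> x v)))}"

definition pm_isomorphic :: "('k, 'm) ring_scheme \<Rightarrow> ('k, 'v) persmod \<Rightarrow> ('k, 'w) persmod \<Rightarrow> bool" where
  "pm_isomorphic K M N \<longleftrightarrow> persistence_module K M \<and> persistence_module K N \<and>
     (\<exists>\<phi>\<in>nat_trans K M N. \<exists>\<psi>\<in>nat_trans K N M.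
        (\<forall>x. \<forall>v\<in>carrier (sp M x). \<psi> x (\<phi> x v) = v) \<and>
        (\<forall>x. \<forall>w\<in>carrier (sp N x). \<phi> x (\<psi> x w) = w))"

text \<open>A persistence module if \<open>I\<close> is an interval, i.e. order-convex.\<close>

definition interval_module :: "('k, 'm) ring_scheme \<Rightarrow> real set \<Rightarrow> ('k, 'k) persmod" where
  "interval_module K I =
    \<lparr>sp = (\<lambda>x. (self_module K)\<lparr>carrier := if x \<in> I then carrier K else {\<zero>\<^bsub>K\<^esub>}\<rparr>),
     tr = (\<lambda>x y v. if x \<in> I \<and> y \<in> I then v else \<zero>\<^bsub>K\<^esub>)\<rparr>"

subsection \<open>Graded tensor product\<close>

definition gtensor_index :: "real \<Rightarrow> (real \<times> real) set" where
  "gtensor_index r = {(s, t). s + t \<le> r}"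

definition gtensor_sp ::
  "('k, 'm) ring_scheme \<Rightarrow> ('k, 'v) persmod \<Rightarrow> ('k, 'w) persmod \<Rightarrow>
   real \<times> real \<Rightarrow> ('k, ('v \<times> 'w \<Rightarrow> 'k) set) module" where
  "gtensor_sp K M N = (\<lambda>(s, t). tensor K (sp M s) (sp N t))"

definition gtensor_tr ::
  "('k, 'm) ring_scheme \<Rightarrow> ('k, 'v) persmod \<Rightarrow> ('k, 'w) persmod \<Rightarrow>
   real \<times> real \<Rightarrow> real \<times> real \<Rightarrow> ('v \<times> 'w \<Rightarrow> 'k) set \<Rightarrow> ('v \<times> 'w \<Rightarrow> 'k) set" where
  "gtensor_tr K M N = (\<lambda>(s, t) (s', t').
     tensor_map K (sp M s) (sp N t) (sp M s') (sp N t') (tr M s s') (tr N t t'))"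

text \<open>The order on \<open>real \<times> real\<close> used by \<^const>\<open>colim\<close> is the product order.\<close>

definition gtensor ::
  "('k, 'm) ring_scheme \<Rightarrow> ('k, 'v) persmod \<Rightarrow> ('k, 'w) persmod \<Rightarrow>
   ('k, (real \<times> real \<Rightarrow> ('v \<times> 'w \<Rightarrow> 'k) set) set) persmod" where
  "gtensor K M N =
    \<lparr>sp = (\<lambda>r. colim K (gtensor_index r) (gtensor_sp K M N) (gtensor_tr K M N)),
     tr = (\<lambda>r r'. colim_map K (gtensor_index r) (gtensor_index r')
       (gtensor_sp K M N) (gtensor_tr K M N) (\<lambda>_ x. x))\<rparr>"

text \<open>The map \<open>f \<otimes> N : M \<otimes> N \<rightarrow> M' \<otimes> N\<close> induced by \<open>f : M \<rightarrow> M'\<close>.\<close>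

definition gtensor_map ::
  "('k, 'm) ring_scheme \<Rightarrow> ('k, 'v) persmod \<Rightarrow> ('k, 'v') persmod \<Rightarrow> ('k, 'w) persmod \<Rightarrow>
   (real \<Rightarrow> 'v \<Rightarrow> 'v') \<Rightarrow>
   real \<Rightarrow> (real \<times> real \<Rightarrow> ('v \<times> 'w \<Rightarrow> 'k) set) set \<Rightarrow> (real \<times> real \<Rightarrow> ('v' \<times> 'w \<Rightarrow> 'k) set) set" where
  "gtensor_map K M M' N f r =
    colim_map K (gtensor_index r) (gtensor_index r) (gtensor_sp K M' N) (gtensor_tr K M' N)
      (\<lambda>(s, t). tensor_map K (sp M s) (sp N t) (sp M' s) (sp N t) (f s) (\<lambda>w. w))"

subsection \<open>Graded internal hom\<close>

text \<open>Natural transformations are made extensional so that they form a vector space on the nose.\<close>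

definition hom_space ::
  "('k, 'm) ring_scheme \<Rightarrow> ('k, 'v) persmod \<Rightarrow> ('k, 'w) persmod \<Rightarrow> ('k, real \<Rightarrow> 'v \<Rightarrow> 'w) module" where
  "hom_space K M N =
    \<lparr>carrier = {\<phi> \<in> nat_trans K M N. \<forall>x. \<phi> x \<in> extensional (carrier (sp M x))},
     mult = undefined, one = undefined,
     zero = (\<lambda>x. \<lambda>v\<in>carrier (sp M x). \<zero>\<^bsub>sp N x\<^esub>),
     add = (\<lambda>\<phi> \<psi> x. \<lambda>v\<in>carrier (sp M x). \<phi> x v \<oplus>\<^bsub>sp N x\<^esub> \<psi> x v),
     smult = (\<lambda>c \<phi> x. \<lambda>v\<in>carrier (sp M x). c \<odot>\<^bsub>sp N x\<^esub> \<phi> x v)\<rparr>"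

definition translate :: "('k, 'v) persmod \<Rightarrow> real \<Rightarrow> ('k, 'v) persmod" where
  "translate N s = \<lparr>sp = (\<lambda>x. sp N (s + x)), tr = (\<lambda>x y. tr N (s + x) (s + y))\<rparr>"

definition ghom ::
  "('k, 'm) ring_scheme \<Rightarrow> ('k, 'v) persmod \<Rightarrow> ('k, 'w) persmod \<Rightarrow> ('k, real \<Rightarrow> 'v \<Rightarrow> 'w) persmod" where
  "ghom K M N =
    \<lparr>sp = (\<lambda>s. hom_space K M (translate N s)),
     tr = (\<lambda>s t \<phi> x. \<lambda>v\<in>carrier (sp M x). tr N (s + x) (t + x) (\<phi> x v))\<rparr>"

text \<open>The map from the internal hom out of \<open>M'\<close> to the internal hom out of \<open>M\<close> given by
  precomposition with \<open>f : M \<rightarrow> M'\<close>.\<close>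

definition ghom_map ::
  "('k, 'v) persmod \<Rightarrow> (real \<Rightarrow> 'v \<Rightarrow> 'v') \<Rightarrow> real \<Rightarrow> (real \<Rightarrow> 'v' \<Rightarrow> 'w) \<Rightarrow> real \<Rightarrow> 'v \<Rightarrow> 'w" where
  "ghom_map M f s \<phi> = (\<lambda>x. \<lambda>v\<in>carrier (sp M x). \<phi> x (f x v))"

section \<open>Derived functors\<close>

text \<open>\<open>Z / B\<close> for submodules \<open>B \<subseteq> Z\<close> of \<open>M\<close>.\<close>

definition subquotient ::
  "('k, 'v) persmod \<Rightarrow> (real \<Rightarrow> 'v set) \<Rightarrow> (real \<Rightarrow> 'v set) \<Rightarrow> ('k, 'v set) persmod" where
  "subquotient M Z B =
    \<lparr>sp = (\<lambda>x. quot_module ((sp M x)\<lparr>carrier := Z x\<rparr>) (B x)),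
     tr = (\<lambda>x y. coset_map (sp M y) (B y) (tr M x y))\<rparr>"

text \<open>Homology of \<open>\<dots> \<rightarrow> C 2 \<rightarrow> C 1 \<rightarrow> C 0 \<rightarrow> 0\<close> with \<open>d n : C (n + 1) \<rightarrow> C n\<close>.\<close>

definition homology ::
  "(nat \<Rightarrow> ('k, 'v) persmod) \<Rightarrow> (nat \<Rightarrow> real \<Rightarrow> 'v \<Rightarrow> 'v) \<Rightarrow> nat \<Rightarrow> ('k, 'v set) persmod" where
  "homology C d n = subquotient (C n)
     (\<lambda>x. case n of 0 \<Rightarrow> carrier (sp (C 0) x)
            | Suc m \<Rightarrow> a_kernel (sp (C n) x) (sp (C m) x) (d m x))
     (\<lambda>x. d n x ` carrier (sp (C (Suc n)) x))"

text \<open>Cohomology of \<open>0 \<rightarrow> C 0 \<rightarrow> C 1 \<rightarrow> C 2 \<rightarrow> \<dots>\<close> with \<open>d n : C n \<rightarrow> C (n + 1)\<close>.\<close>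

definition cohomology ::
  "(nat \<Rightarrow> ('k, 'v) persmod) \<Rightarrow> (nat \<Rightarrow> real \<Rightarrow> 'v \<Rightarrow> 'v) \<Rightarrow> nat \<Rightarrow> ('k, 'v set) persmod" where
  "cohomology C d n = subquotient (C n)
     (\<lambda>x. a_kernel (sp (C n) x) (sp (C (Suc n)) x) (d n x))
     (\<lambda>x. case n of 0 \<Rightarrow> {\<zero>\<^bsub>sp (C 0) x\<^esub>}
            | Suc m \<Rightarrow> d m x ` carrier (sp (C m) x))"

text \<open>
  A definition cannot quantify over all types, so the lifting property is tested on modules with
  underlying sets in one fixed type. The type \<open>real \<times> 'k \<times> 'p\<close> is large enough to contain isomorphic
  copies of \<open>P\<close> and of the free module on the homogeneous elements of \<open>P\<close>. Lifting the identity of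
  \<open>P\<close> along the canonical surjection from that free module shows that \<open>P\<close> is a direct summand of
  it, hence projective with respect to test modules of any type.
\<close>

definition projective :: "('k, 'm) ring_scheme \<Rightarrow> ('k, 'p) persmod \<Rightarrow> bool" where
  "projective K P \<longleftrightarrow> persistence_module K P \<and>
     (\<forall>(A :: ('k, real \<times> 'k \<times> 'p) persmod) (B :: ('k, real \<times> 'k \<times> 'p) persmod).
        persistence_module K A \<longrightarrow> persistence_module K B \<longrightarrow>
        (\<forall>q\<in>nat_trans K A B. \<forall>f\<in>nat_trans K P B.
           (\<forall>x. q x ` carrier (sp A x) = carrier (sp B x)) \<longrightarrow>
           (\<exists>g\<in>nat_trans K P A. \<forall>x. \<forall>v\<in>carrier (sp P x). q x (g x v) = f x v)))"

text \<open>\<open>\<dots> \<rightarrow> P 1 \<rightarrow> P 0 \<rightarrow> M \<rightarrow> 0\<close> exact, with \<open>d n : P (n + 1) \<rightarrow> P n\<close> and \<open>\<epsilon> : P 0 \<rightarrow> M\<close>.\<close>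

definition projective_resolution ::
  "('k, 'm) ring_scheme \<Rightarrow> ('k, 'v) persmod \<Rightarrow>
   (nat \<Rightarrow> ('k, 'p) persmod) \<Rightarrow> (nat \<Rightarrow> real \<Rightarrow> 'p \<Rightarrow> 'p) \<Rightarrow> (real \<Rightarrow> 'p \<Rightarrow> 'v) \<Rightarrow> bool" where
  "projective_resolution K M P d \<epsilon> \<longleftrightarrow>
     persistence_module K M \<and>
     (\<forall>n. projective K (P n)) \<and>
     (\<forall>n. d n \<in> nat_trans K (P (Suc n)) (P n)) \<and>
     \<epsilon> \<in> nat_trans K (P 0) M \<and>
     (\<forall>x. \<epsilon> x ` carrier (sp (P 0) x) = carrier (sp M x)) \<and>
     (\<forall>x. d 0 x ` carrier (sp (P 1) x) = a_kernel (sp (P 0) x) (sp M x) (\<epsilon> x)) \<and>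
     (\<forall>n x. d (Suc n) x ` carrier (sp (P (Suc (Suc n))) x) =
        a_kernel (sp (P (Suc n)) x) (sp (P n) x) (d n x))"

text \<open>
  A chosen projective resolution of \<open>M\<close>. Its modules live in the type \<open>real \<times> 'k \<times> 'v\<close>, which is
  large enough for every \<open>M\<close> to have a resolution there (the free modules on homogeneous elements fit).
\<close>

definition resolution ::
  "('k, 'm) ring_scheme \<Rightarrow> ('k, 'v) persmod \<Rightarrow>
   (nat \<Rightarrow> ('k, real \<times> 'k \<times> 'v) persmod) \<times> (nat \<Rightarrow> real \<Rightarrow> real \<times> 'k \<times> 'v \<Rightarrow> real \<times> 'k \<times> 'v)" where
  "resolution K M = (SOME (P, d). \<exists>\<epsilon>. projective_resolution K M P d \<epsilon>)"

text \<open>The left derived functors of \<open>_ \<otimes> N\<close>, evaluated at \<open>M\<close>.\<close>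

definition Tor_gr ::
  "('k, 'm) ring_scheme \<Rightarrow> nat \<Rightarrow> ('k, 'v) persmod \<Rightarrow> ('k, 'w) persmod \<Rightarrow>
   ('k, (real \<times> real \<Rightarrow> ((real \<times> 'k \<times> 'v) \<times> 'w \<Rightarrow> 'k) set) set set) persmod" where
  "Tor_gr K n M N = (case resolution K M of (P, d) \<Rightarrow>
     homology (\<lambda>i. gtensor K (P i) N) (\<lambda>i. gtensor_map K (P (Suc i)) (P i) N (d i)) n)"

text \<open>The right derived functors of the contravariant functor given by the internal hom into \<open>N\<close>,
  evaluated at \<open>M\<close>.\<close>

definition Ext_gr ::
  "('k, 'm) ring_scheme \<Rightarrow> nat \<Rightarrow> ('k, 'v) persmod \<Rightarrow> ('k, 'w) persmod \<Rightarrow>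
   ('k, (real \<Rightarrow> real \<times> 'k \<times> 'v \<Rightarrow> 'w) set) persmod" where
  "Ext_gr K n M N = (case resolution K M of (P, d) \<Rightarrow>
     cohomology (\<lambda>i. ghom K (P i) N) (\<lambda>i. ghom_map (P (Suc i)) (d i)) n)"

end

(*
For every persistence module M, the module M (x) k[c,d) is M_{r-c} / tr(M_{r-d}) in degree r. A projective module
has injective transition maps, so for any projective resolution P of M the sequence
0 -> P_{r-d} -> P_{r-c} -> (P (x) k[c,d))_r -> 0 is exact, and its connecting map identifies Tor_1 with
the kernel of M_{r-d} -> M_{r-c}. For Ext, evaluation at the image of the generator of k[b,oo) under a
comparison of k[b,oo) -> k[a,oo) -> k[a,b) with P identifies Ext^1(k[a,b), N) in degree s with
N_{s+b} / tr(N_{s+a}), and Hom(k[a,b), N) is the kernel of N_{s+a} -> N_{s+b}.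
*)

theory Submission
  imports Defs
begin

section \<open>Linear algebra\<close>

text \<open>\<open>Tor_gr\<close> and \<open>Ext_gr\<close> are computed from a resolution
  \<open>P\<close> picked by \<open>SOME\<close>, so only exactness and projectivity of
  \<open>P\<close> are available, never a formula for it; the explicit resolution serves to show
  that the choice does pick a resolution. Projectivity enters Tor at one point: injectivity of the
  transition maps of \<open>P 0\<close> shows that a boundary goes to zero under the connecting map.
  For Ext, lifting is used twice: for the map \<open>g\<close> back from \<open>P 0\<close> to
  \<open>k[a,\<infinity>)\<close>, and for a homotopy \<open>h\<close> that turns a cocycle with
  trivial class at \<open>e1\<close> into a coboundary. Test modules for projectivity live in one
  fixed type, so modules are carried into it along injections. Maps out of quotients are choice
  expressions, so isomorphisms are obtained from linear relations between representatives. The end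
  points record when a map between spaces of dimension at most one vanishes:
  \<open>M (r - d) \<rightarrow> M (r - c)\<close> has a kernel when
  \<open>a \<le> r - d < b \<le> r - c\<close>, and \<open>N (s + a) \<rightarrow> N (s + b)\<close>
  has a cokernel when \<open>s + a < c \<le> s + b < d\<close>.\<close>

lemma linear_mapsI:
  assumes "\<And>x. x \<in> carrier V \<Longrightarrow> f x \<in> carrier W"
    and "\<And>x y. x \<in> carrier V \<Longrightarrow> y \<in> carrier V \<Longrightarrow> f (x \<oplus>\<^bsub>V\<^esub> y) = f x \<oplus>\<^bsub>W\<^esub> f y"
    and "\<And>c x. c \<in> carrier K \<Longrightarrow> x \<in> carrier V \<Longrightarrow> f (c \<odot>\<^bsub>V\<^esub> x) = c \<odot>\<^bsub>W\<^esub> f x"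
  shows "f \<in> linear_maps K V W"
  using assms unfolding linear_maps_def by auto

lemma lin_closed: "f \<in> linear_maps K V W \<Longrightarrow> x \<in> carrier V \<Longrightarrow> f x \<in> carrier W"
  unfolding linear_maps_def by auto

lemma lin_add:
  "f \<in> linear_maps K V W \<Longrightarrow> x \<in> carrier V \<Longrightarrow> y \<in> carrier V \<Longrightarrow> f (x \<oplus>\<^bsub>V\<^esub> y) = f x \<oplus>\<^bsub>W\<^esub> f y"
  unfolding linear_maps_def by auto

lemma lin_smult:
  "f \<in> linear_maps K V W \<Longrightarrow> c \<in> carrier K \<Longrightarrow> x \<in> carrier V \<Longrightarrow> f (c \<odot>\<^bsub>V\<^esub> x) = c \<odot>\<^bsub>W\<^esub> f x"
  unfolding linear_maps_def by auto

lemma lin_zero: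
  assumes "module K V" "module K W" "f \<in> linear_maps K V W"
  shows "f \<zero>\<^bsub>V\<^esub> = \<zero>\<^bsub>W\<^esub>"
proof -
  interpret V: module K V by fact
  interpret W: module K W by fact
  have "f (\<zero>\<^bsub>K\<^esub> \<odot>\<^bsub>V\<^esub> \<zero>\<^bsub>V\<^esub>) = \<zero>\<^bsub>K\<^esub> \<odot>\<^bsub>W\<^esub> f \<zero>\<^bsub>V\<^esub>"
    using assms(3) by (intro lin_smult) auto
  then show ?thesis using lin_closed[OF assms(3)] by simp
qed

lemma module_neg_eq:
  assumes "module K V" "x \<in> carrier V"
  shows "\<ominus>\<^bsub>V\<^esub> x = (\<ominus>\<^bsub>K\<^esub> \<one>\<^bsub>K\<^esub>) \<odot>\<^bsub>V\<^esub> x"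
proof -
  interpret V: module K V by fact
  show ?thesis using assms(2) by (simp add: V.smult_l_minus)
qed

lemma module_diff_eq_zero_iff:
  assumes "module K V" "x \<in> carrier V" "y \<in> carrier V"
  shows "x \<ominus>\<^bsub>V\<^esub> y = \<zero>\<^bsub>V\<^esub> \<longleftrightarrow> x = y"
proof -
  interpret V: module K V by fact
  show ?thesis
    using V.M.add.inv_solve_right[of "\<zero>\<^bsub>V\<^esub>" x y] assms(2,3) by (auto simp: a_minus_def)
qed

lemma lin_uminus:
  assumes "module K V" "module K W" "f \<in> linear_maps K V W" "x \<in> carrier V"
  shows "f (\<ominus>\<^bsub>V\<^esub> x) = \<ominus>\<^bsub>W\<^esub> f x"
proof -
  interpret V: module K V by fact
  show ?thesis
    using assms lin_closed[OF assms(3,4)] lin_smult[OF assms(3), of "\<ominus>\<^bsub>K\<^esub> \<one>\<^bsub>K\<^esub>" x]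
    by (simp add: module_neg_eq)
qed

lemma lin_diff:
  assumes "module K V" "module K W" "f \<in> linear_maps K V W" "x \<in> carrier V" "y \<in> carrier V"
  shows "f (x \<ominus>\<^bsub>V\<^esub> y) = f x \<ominus>\<^bsub>W\<^esub> f y"
proof -
  interpret V: module K V by fact
  show ?thesis
    using assms by (simp add: a_minus_def lin_add lin_uminus)
qed

lemma lin_compose:
  "f \<in> linear_maps K V W \<Longrightarrow> g \<in> linear_maps K W U \<Longrightarrow> (\<lambda>x. g (f x)) \<in> linear_maps K V U"
  by (rule linear_mapsI) (simp_all add: lin_closed lin_add lin_smult)

lemma lin_id: "(\<lambda>x. x) \<in> linear_maps K V V"
  by (rule linear_mapsI) simp_all

lemma lin_cong:
  assumes "module K V" "f \<in> linear_maps K V W" "\<And>x. x \<in> carrier V \<Longrightarrow> g x = f x"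
  shows "g \<in> linear_maps K V W"
proof -
  interpret V: module K V by fact
  show ?thesis
    by (rule linear_mapsI) (use assms(2,3) in \<open>auto simp: lin_add lin_smult lin_closed\<close>)
qed

lemma lin_const_zero:
  assumes "module K V" "module K W"
  shows "(\<lambda>x. \<zero>\<^bsub>W\<^esub>) \<in> linear_maps K V W"
proof -
  interpret W: module K W by fact
  show ?thesis by (rule linear_mapsI) auto
qed

text \<open>Multiplication by \<open>-1\<close> supplies the inverses that the library notion asks
  for; multiplication by \<open>0\<close> recovers zero from nonemptiness.\<close>

lemma submodule_iff:
  assumes "module K V"
  shows "submodule H K V \<longleftrightarrow> H \<subseteq> carrier V \<and> \<zero>\<^bsub>V\<^esub> \<in> H \<and> (\<forall>x\<in>H. \<forall>y\<in>H. x \<oplus>\<^bsub>V\<^esub> y \<in> H) \<and>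
    (\<forall>c\<in>carrier K. \<forall>x\<in>H. c \<odot>\<^bsub>V\<^esub> x \<in> H)" (is "?L = ?R")
proof -
  interpret V: module K V by fact
  show ?thesis
  proof
    assume L: ?L
    note E = V.submoduleE[OF L]
    obtain x where x: "x \<in> H" using E(2) by blast
    then have "\<zero>\<^bsub>K\<^esub> \<odot>\<^bsub>V\<^esub> x \<in> H" using E(4) by blast
    then have "\<zero>\<^bsub>V\<^esub> \<in> H" using x E(1) by (metis V.smult_l_null subsetD)
    then show ?R using E(1,4,5) by blast
  next
    assume R: ?R
    show ?L
    proof (rule V.submoduleI)
      fix a assume a: "a \<in> H"
      then show "\<ominus>\<^bsub>V\<^esub> a \<in> H" using R module_neg_eq[OF assms, of a] by auto
    qed (use R in auto)
  qed
qed

lemma submoduleD: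
  assumes "module K V" "submodule H K V"
  shows submodule_subset: "H \<subseteq> carrier V"
    and submodule_carrier: "x \<in> H \<Longrightarrow> x \<in> carrier V"
    and submodule_zero: "\<zero>\<^bsub>V\<^esub> \<in> H"
    and submodule_add: "x \<in> H \<Longrightarrow> y \<in> H \<Longrightarrow> x \<oplus>\<^bsub>V\<^esub> y \<in> H"
    and submodule_smult: "c \<in> carrier K \<Longrightarrow> x \<in> H \<Longrightarrow> c \<odot>\<^bsub>V\<^esub> x \<in> H"
  using assms(2) unfolding submodule_iff[OF assms(1)] by auto

lemma submodule_preimage:
  assumes "module K V" "module K W" "f \<in> linear_maps K V W" "submodule T K W"
  shows "submodule {x \<in> carrier V. f x \<in> T} K V"
proof -
  interpret V: module K V by fact
  show ?thesis
    unfolding submodule_iff[OF assms(1)]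
    using submoduleD[OF assms(2,4)] assms(3)
    by (auto simp: lin_zero[OF assms(1-3)] lin_add lin_smult)
qed

lemma submodule_image:
  assumes "module K V" "module K W" "f \<in> linear_maps K V W"
  shows "submodule (f ` carrier V) K W"
proof -
  interpret V: module K V by fact
  interpret W: module K W by fact
  show ?thesis
    unfolding submodule_iff[OF assms(2)]
  proof (intro conjI ballI)
    show "f ` carrier V \<subseteq> carrier W" using lin_closed[OF assms(3)] by auto
    show "\<zero>\<^bsub>W\<^esub> \<in> f ` carrier V" using lin_zero[OF assms] V.zero_closed by (metis imageI)
  next
    fix x y assume "x \<in> f ` carrier V" "y \<in> f ` carrier V"
    then obtain u v where "u \<in> carrier V" "v \<in> carrier V" "x = f u" "y = f v" by auto
    then show "x \<oplus>\<^bsub>W\<^esub> y \<in> f ` carrier V"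
      using lin_add[OF assms(3), of u v] by (metis V.add.m_closed imageI)
  next
    fix c x assume "c \<in> carrier K" "x \<in> f ` carrier V"
    then obtain u where "u \<in> carrier V" "x = f u" by auto
    then show "c \<odot>\<^bsub>W\<^esub> x \<in> f ` carrier V"
      using lin_smult[OF assms(3), of c u] \<open>c \<in> carrier K\<close> by (metis V.smult_closed imageI)
  qed
qed

lemma submodule_singleton_zero:
  assumes "module K V"
  shows "submodule {\<zero>\<^bsub>V\<^esub>} K V"
proof -
  interpret V: module K V by fact
  show ?thesis unfolding submodule_iff[OF assms] by auto
qed

lemma a_kernel_eq: "a_kernel V W f = {x \<in> carrier V. f x = \<zero>\<^bsub>W\<^esub>}"
  unfolding a_kernel_def kernel_def by simp

lemma submodule_kernel:
  assumes "module K V" "module K W" "f \<in> linear_maps K V W"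
  shows "submodule (a_kernel V W f) K V"
  using submodule_preimage[OF assms submodule_singleton_zero[OF assms(2)]]
  unfolding a_kernel_eq by simp

lemma submodule_equalizer:
  assumes "module K V" "module K W" "f \<in> linear_maps K V W" "g \<in> linear_maps K V W"
  shows "submodule {x \<in> carrier V. f x = g x} K V"
proof -
  interpret V: module K V by fact
  show ?thesis
    unfolding submodule_iff[OF assms(1)]
    using lin_zero[OF assms(1-3)] lin_zero[OF assms(1,2,4)]
    by (auto simp: lin_add[OF assms(3)] lin_add[OF assms(4)]
        lin_smult[OF assms(3)] lin_smult[OF assms(4)])
qed

lemma lin_span_submodule:
  assumes "module K V" "S \<subseteq> carrier V"
  shows "submodule (lin_span K V S) K V"
proof -
  interpret V: module K V by fact
  show ?thesis
    using V.carrier_is_submodule assms(2)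
    unfolding submodule_iff[OF assms(1)] lin_span_def hull_def
    by (auto 0 3)
qed

lemma lin_span_inc: "x \<in> S \<Longrightarrow> x \<in> lin_span K V S"
  unfolding lin_span_def by (rule hull_inc)

lemma lin_span_least: "submodule T K V \<Longrightarrow> S \<subseteq> T \<Longrightarrow> lin_span K V S \<subseteq> T"
  unfolding lin_span_def by (rule hull_minimal)

text \<open>The preimage of \<open>T\<close> is a submodule, so testing generators is enough.
  Well-definedness of the maps out of tensor products and colimits is checked this way.\<close>

lemma lin_span_image:
  assumes "module K V" "module K W" "f \<in> linear_maps K V W" "submodule T K W"
    and "S \<subseteq> carrier V" "\<And>x. x \<in> S \<Longrightarrow> f x \<in> T" "y \<in> lin_span K V S"
  shows "f y \<in> T"
proof -
  have "lin_span K V S \<subseteq> {x \<in> carrier V. f x \<in> T}"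
    by (rule lin_span_least[OF submodule_preimage[OF assms(1-4)]]) (use assms(5,6) in auto)
  then show ?thesis using assms(7) by auto
qed

subsection \<open>Quotients\<close>

lemma submodule_abelian_subgroup:
  assumes "module K V" "submodule H K V"
  shows "abelian_subgroup H V"
proof -
  interpret V: module K V by fact
  show ?thesis
    by (rule abelian_subgroupI3[OF additive_subgroupI])
      (use assms(2) V.abelian_group_axioms in \<open>auto simp: submodule_def\<close>)
qed

lemma coset_eq_iff:
  assumes "module K V" "submodule H K V" "x \<in> carrier V" "y \<in> carrier V"
  shows "H +>\<^bsub>V\<^esub> x = H +>\<^bsub>V\<^esub> y \<longleftrightarrow> x \<ominus>\<^bsub>V\<^esub> y \<in> H"
proof -
  interpret V: module K V by fact
  interpret H: abelian_subgroup H V using submodule_abelian_subgroup assms by blast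
  show ?thesis
  proof
    assume "H +>\<^bsub>V\<^esub> x = H +>\<^bsub>V\<^esub> y"
    then have "x \<in> H +>\<^bsub>V\<^esub> y" using H.a_rcos_self[OF assms(3)] by simp
    then show "x \<ominus>\<^bsub>V\<^esub> y \<in> H" using H.a_rcos_module_imp[OF assms(4)] by (simp add: a_minus_def)
  next
    assume "x \<ominus>\<^bsub>V\<^esub> y \<in> H"
    then have "x \<in> H +>\<^bsub>V\<^esub> y" using H.a_rcos_module_rev[OF assms(4,3)] by (simp add: a_minus_def)
    then show "H +>\<^bsub>V\<^esub> x = H +>\<^bsub>V\<^esub> y" using H.a_repr_independence'[OF _ assms(4)] by simp
  qed
qed

lemma mem_coset_iff:
  assumes "module K V" "submodule H K V" "y \<in> carrier V"
  shows "x \<in> H +>\<^bsub>V\<^esub> y \<longleftrightarrow> x \<in> carrier V \<and> x \<ominus>\<^bsub>V\<^esub> y \<in> H"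
proof -
  interpret V: module K V by fact
  interpret H: abelian_subgroup H V using submodule_abelian_subgroup assms by blast
  show ?thesis
    using H.a_rcos_module[of y x] H.a_elemrcos_carrier[of y x] assms(3)
    by (auto simp: a_minus_def)
qed

lemma coset_zero_iff:
  assumes "module K V" "submodule H K V" "x \<in> carrier V"
  shows "H +>\<^bsub>V\<^esub> x = H \<longleftrightarrow> x \<in> H"
proof -
  interpret V: module K V by fact
  have "H = H +>\<^bsub>V\<^esub> \<zero>\<^bsub>V\<^esub>" using V.a_coset_add_zero submodule_subset[OF assms(1,2)] by simp
  moreover have "x \<ominus>\<^bsub>V\<^esub> \<zero>\<^bsub>V\<^esub> = x" using assms(3) by (simp add: a_minus_def V.M.add.inv_one)
  ultimately show ?thesis using coset_eq_iff[OF assms(1-3), of "\<zero>\<^bsub>V\<^esub>"] assms(3) by simp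
qed

text \<open>\<open>the_elem\<close> needs an image with exactly one element: \<open>x\<close> itself
  makes it nonempty, and the last assumption makes all values agree.\<close>

lemma coset_map_coset:
  assumes "module K V" "submodule H K V" "x \<in> carrier V"
    and "\<And>y. y \<in> carrier V \<Longrightarrow> y \<ominus>\<^bsub>V\<^esub> x \<in> H \<Longrightarrow> H' +>\<^bsub>W\<^esub> f y = H' +>\<^bsub>W\<^esub> f x"
  shows "coset_map W H' f (H +>\<^bsub>V\<^esub> x) = H' +>\<^bsub>W\<^esub> f x"
  unfolding coset_map_def
proof (rule the_elem_image_unique)
  interpret V: module K V by fact
  have "x \<in> H +>\<^bsub>V\<^esub> x"
    using assms(3) submodule_zero[OF assms(1,2)] by (simp add: mem_coset_iff[OF assms(1-3)] V.r_neg a_minus_def)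
  then show "H +>\<^bsub>V\<^esub> x \<noteq> {}" by auto
  show "\<And>y. y \<in> H +>\<^bsub>V\<^esub> x \<Longrightarrow> H' +>\<^bsub>W\<^esub> f y = H' +>\<^bsub>W\<^esub> f x"
    using assms(4) by (simp add: mem_coset_iff[OF assms(1-3)])
qed

lemma coset_map_linear_coset:
  assumes "module K V" "submodule H K V" "module K W" "submodule H' K W"
    and "f \<in> linear_maps K V W" "\<And>y. y \<in> H \<Longrightarrow> f y \<in> H'" "x \<in> carrier V"
  shows "coset_map W H' f (H +>\<^bsub>V\<^esub> x) = H' +>\<^bsub>W\<^esub> f x"
proof (rule coset_map_coset[OF assms(1,2,7)])
  fix y assume y: "y \<in> carrier V" "y \<ominus>\<^bsub>V\<^esub> x \<in> H"
  have "f y \<ominus>\<^bsub>W\<^esub> f x \<in> H'"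
    using assms(6)[OF y(2)] lin_diff[OF assms(1,3,5) y(1) assms(7)] by simp
  then show "H' +>\<^bsub>W\<^esub> f y = H' +>\<^bsub>W\<^esub> f x"
    using coset_eq_iff[OF assms(3,4)] lin_closed[OF assms(5)] y(1) assms(7) by blast
qed

lemma quot_module_sel:
  "carrier (quot_module V H) = (\<lambda>x. H +>\<^bsub>V\<^esub> x) ` carrier V"
  "\<zero>\<^bsub>quot_module V H\<^esub> = H"
  "X \<oplus>\<^bsub>quot_module V H\<^esub> Y = X <+>\<^bsub>V\<^esub> Y"
  "c \<odot>\<^bsub>quot_module V H\<^esub> X = coset_map V H (\<lambda>x. c \<odot>\<^bsub>V\<^esub> x) X"
  unfolding quot_module_def A_RCOSETS_def' by auto

lemma smult_linear_maps:
  assumes "module K V" "c \<in> carrier K"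
  shows "(\<lambda>x. c \<odot>\<^bsub>V\<^esub> x) \<in> linear_maps K V V"
proof -
  interpret V: module K V by fact
  show ?thesis using assms(2)
    by (intro linear_mapsI) (auto simp: V.smult_r_distr V.smult_assoc1[symmetric] V.R.m_comm)
qed

lemma
  assumes "module K V" "submodule H K V"
  shows quot_module_add: "x \<in> carrier V \<Longrightarrow> y \<in> carrier V \<Longrightarrow>
      (H +>\<^bsub>V\<^esub> x) \<oplus>\<^bsub>quot_module V H\<^esub> (H +>\<^bsub>V\<^esub> y) = H +>\<^bsub>V\<^esub> (x \<oplus>\<^bsub>V\<^esub> y)"
    and quot_module_smult: "c \<in> carrier K \<Longrightarrow> x \<in> carrier V \<Longrightarrow>
      c \<odot>\<^bsub>quot_module V H\<^esub> (H +>\<^bsub>V\<^esub> x) = H +>\<^bsub>V\<^esub> (c \<odot>\<^bsub>V\<^esub> x)"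
    and quot_module_zero: "\<zero>\<^bsub>quot_module V H\<^esub> = H +>\<^bsub>V\<^esub> \<zero>\<^bsub>V\<^esub>"
proof -
  interpret V: module K V by fact
  interpret H: abelian_subgroup H V using submodule_abelian_subgroup assms by blast
  show "x \<in> carrier V \<Longrightarrow> y \<in> carrier V \<Longrightarrow>
      (H +>\<^bsub>V\<^esub> x) \<oplus>\<^bsub>quot_module V H\<^esub> (H +>\<^bsub>V\<^esub> y) = H +>\<^bsub>V\<^esub> (x \<oplus>\<^bsub>V\<^esub> y)"
    by (simp add: quot_module_sel H.a_rcos_sum)
  show "c \<in> carrier K \<Longrightarrow> x \<in> carrier V \<Longrightarrow>
      c \<odot>\<^bsub>quot_module V H\<^esub> (H +>\<^bsub>V\<^esub> x) = H +>\<^bsub>V\<^esub> (c \<odot>\<^bsub>V\<^esub> x)"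
    unfolding quot_module_sel
    by (rule coset_map_linear_coset[OF assms assms]) (auto intro: smult_linear_maps submodule_smult assms)
  show "\<zero>\<^bsub>quot_module V H\<^esub> = H +>\<^bsub>V\<^esub> \<zero>\<^bsub>V\<^esub>"
    using coset_zero_iff[OF assms V.zero_closed] submodule_zero[OF assms] by (simp add: quot_module_sel)
qed

lemma quot_module_module:
  assumes "module K V" "submodule H K V"
  shows "module K (quot_module V H)"
proof -
  interpret V: module K V by fact
  note [simp] = quot_module_add[OF assms] quot_module_smult[OF assms]
  have ex: "\<exists>u\<in>carrier V. X = H +>\<^bsub>V\<^esub> u" if "X \<in> carrier (quot_module V H)" for X
    using that by (auto simp: quot_module_sel)
  have cl: "H +>\<^bsub>V\<^esub> x \<in> carrier (quot_module V H)" if "x \<in> carrier V" for x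
    using that by (auto simp: quot_module_sel)
  show ?thesis
  proof (rule moduleI)
    show "cring K" by (rule V.R.is_cring)
    show "abelian_group (quot_module V H)"
    proof (rule abelian_groupI)
      show "\<zero>\<^bsub>quot_module V H\<^esub> \<in> carrier (quot_module V H)"
        by (simp add: quot_module_zero[OF assms] cl)
    next
      fix X assume "X \<in> carrier (quot_module V H)"
      then obtain x where x: "x \<in> carrier V" "X = H +>\<^bsub>V\<^esub> x" using ex by blast
      then show "\<zero>\<^bsub>quot_module V H\<^esub> \<oplus>\<^bsub>quot_module V H\<^esub> X = X"
        by (simp add: quot_module_zero[OF assms])
      show "\<exists>Y\<in>carrier (quot_module V H). Y \<oplus>\<^bsub>quot_module V H\<^esub> X = \<zero>\<^bsub>quot_module V H\<^esub>"
        using x by (intro bexI[of _ "H +>\<^bsub>V\<^esub> (\<ominus>\<^bsub>V\<^esub> x)"])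
          (auto simp: quot_module_zero[OF assms] V.l_neg cl)
    qed (auto dest!: ex simp: cl V.a_ac)
  qed (auto dest!: ex simp: cl V.smult_l_distr V.smult_r_distr V.smult_assoc1)
qed

lemma coset_closed: "x \<in> carrier V \<Longrightarrow> H +>\<^bsub>V\<^esub> x \<in> carrier (quot_module V H)"
  by (auto simp: quot_module_sel)

lemma coset_linear_maps:
  assumes "module K V" "submodule H K V"
  shows "(\<lambda>x. H +>\<^bsub>V\<^esub> x) \<in> linear_maps K V (quot_module V H)"
  by (rule linear_mapsI)
    (auto simp: coset_closed quot_module_add[OF assms] quot_module_smult[OF assms])

text \<open>The factorization of a linear map through the quotient is stated for any \<open>g\<close> with the right
  values on cosets, because the maps to which it applies are given by various choice expressions.\<close>

lemma quot_module_linear_maps: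
  assumes "module K V" "submodule H K V" "f \<in> linear_maps K V W"
    and "\<And>x. x \<in> carrier V \<Longrightarrow> g (H +>\<^bsub>V\<^esub> x) = f x"
  shows "g \<in> linear_maps K (quot_module V H) W"
proof -
  interpret V: module K V by fact
  show ?thesis
    by (rule linear_mapsI)
      (auto simp: quot_module_sel(1) quot_module_add[OF assms(1,2)] quot_module_smult[OF assms(1,2)]
        assms(4) lin_add[OF assms(3)] lin_smult[OF assms(3)] lin_closed[OF assms(3)])
qed

subsection \<open>Direct sums\<close>

lemma direct_sum_sel:
  "carrier (direct_sum I V) = {f \<in> (\<Pi>\<^sub>E i\<in>I. carrier (V i)). finite {i\<in>I. f i \<noteq> \<zero>\<^bsub>V i\<^esub>}}"
  "\<zero>\<^bsub>direct_sum I V\<^esub> = (\<lambda>i\<in>I. \<zero>\<^bsub>V i\<^esub>)"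
  "f \<oplus>\<^bsub>direct_sum I V\<^esub> g = (\<lambda>i\<in>I. f i \<oplus>\<^bsub>V i\<^esub> g i)"
  "c \<odot>\<^bsub>direct_sum I V\<^esub> f = (\<lambda>i\<in>I. c \<odot>\<^bsub>V i\<^esub> f i)"
  unfolding direct_sum_def by auto

lemma direct_sum_carrierD:
  "f \<in> carrier (direct_sum I V) \<Longrightarrow> i \<in> I \<Longrightarrow> f i \<in> carrier (V i)"
  "f \<in> carrier (direct_sum I V) \<Longrightarrow> finite {i\<in>I. f i \<noteq> \<zero>\<^bsub>V i\<^esub>}"
  "f \<in> carrier (direct_sum I V) \<Longrightarrow> f \<in> extensional I"
  by (auto simp: direct_sum_sel PiE_def)

lemma direct_sum_carrierI:
  assumes "\<And>i. i \<in> I \<Longrightarrow> f i \<in> carrier (V i)" "finite F" "\<And>i. i \<in> I \<Longrightarrow> i \<notin> F \<Longrightarrow> f i = \<zero>\<^bsub>V i\<^esub>"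
    and "f \<in> extensional I"
  shows "f \<in> carrier (direct_sum I V)"
proof -
  have "finite {i\<in>I. f i \<noteq> \<zero>\<^bsub>V i\<^esub>}" by (rule finite_subset[OF _ assms(2)]) (use assms(3) in auto)
  then show ?thesis using assms by (auto simp: direct_sum_sel PiE_def)
qed

lemma direct_sum_module:
  assumes "cring K" and mod: "\<And>i. i \<in> I \<Longrightarrow> module K (V i)"
  shows "module K (direct_sum I V)"
proof -
  let ?D = "direct_sum I V"
  interpret K: cring K by fact
  have ag: "abelian_group (V i)" if "i \<in> I" for i using mod[OF that] by (simp add: module_def)
  note D = direct_sum_carrierD
  note ext = extensionalityI[where A = I]
  have addc: "f \<oplus>\<^bsub>?D\<^esub> g \<in> carrier (?D)"
    if f: "f \<in> carrier (?D)" and g: "g \<in> carrier (?D)" for f g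
    by (rule direct_sum_carrierI[where F = "{i\<in>I. f i \<noteq> \<zero>\<^bsub>V i\<^esub>} \<union> {i\<in>I. g i \<noteq> \<zero>\<^bsub>V i\<^esub>}"])
      (use D[OF f] D[OF g] ag in \<open>auto simp: direct_sum_sel(3) abelian_groupE[OF ag]\<close>)
  have smc: "c \<odot>\<^bsub>?D\<^esub> f \<in> carrier (?D)"
    if f: "f \<in> carrier (?D)" and c: "c \<in> carrier K" for c f
    by (rule direct_sum_carrierI[where F = "{i\<in>I. f i \<noteq> \<zero>\<^bsub>V i\<^esub>}"])
      (use D[OF f] c mod in \<open>auto simp: direct_sum_sel(4) module.smult_closed[OF mod] module.smult_r_null[OF mod]\<close>)
  have abg: "abelian_group (?D)"
  proof (rule abelian_groupI)
    show "\<zero>\<^bsub>?D\<^esub> \<in> carrier (?D)"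
      by (rule direct_sum_carrierI[where F = "{}"]) (use ag in \<open>auto simp: direct_sum_sel abelian_groupE[OF ag]\<close>)
  next
    fix f g assume f: "f \<in> carrier (?D)" and g: "g \<in> carrier (?D)"
    show "f \<oplus>\<^bsub>?D\<^esub> g \<in> carrier (?D)" using addc f g .
    show "f \<oplus>\<^bsub>?D\<^esub> g = g \<oplus>\<^bsub>?D\<^esub> f"
      using D[OF f] D[OF g] ag by (intro ext) (auto simp: direct_sum_sel(3) abelian_groupE[OF ag])
  next
    fix f g h assume f: "f \<in> carrier (?D)" and g: "g \<in> carrier (?D)"
      and h: "h \<in> carrier (?D)"
    show "f \<oplus>\<^bsub>?D\<^esub> g \<oplus>\<^bsub>?D\<^esub> h = f \<oplus>\<^bsub>?D\<^esub> (g \<oplus>\<^bsub>?D\<^esub> h)"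
      using D[OF f] D[OF g] D[OF h] by (intro ext) (auto simp: direct_sum_sel(3) abelian_groupE(1,2,3)[OF ag])
  next
    fix f assume f: "f \<in> carrier (?D)"
    show "\<zero>\<^bsub>?D\<^esub> \<oplus>\<^bsub>?D\<^esub> f = f"
      using D[OF f] by (intro ext) (auto simp: direct_sum_sel abelian_groupE(1,2,3,5)[OF ag])
    show "\<exists>g\<in>carrier (?D). g \<oplus>\<^bsub>?D\<^esub> f = \<zero>\<^bsub>?D\<^esub>"
    proof
      have "(\<ominus>\<^bsub>K\<^esub> \<one>\<^bsub>K\<^esub>) \<odot>\<^bsub>V i\<^esub> f i \<oplus>\<^bsub>V i\<^esub> f i = \<zero>\<^bsub>V i\<^esub>" if "i \<in> I" for i
      proof -
        interpret V: module K "V i" by (rule mod[OF that])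
        show ?thesis using D(1)[OF f that] V.l_neg module_neg_eq[OF mod[OF that], of "f i"] by metis
      qed
      then show "(\<ominus>\<^bsub>K\<^esub> \<one>\<^bsub>K\<^esub>) \<odot>\<^bsub>?D\<^esub> f \<oplus>\<^bsub>?D\<^esub> f = \<zero>\<^bsub>?D\<^esub>"
        by (intro ext) (auto simp: direct_sum_sel)
      show "(\<ominus>\<^bsub>K\<^esub> \<one>\<^bsub>K\<^esub>) \<odot>\<^bsub>?D\<^esub> f \<in> carrier (?D)" using smc f by auto
    qed
  qed
  show ?thesis
  proof (rule moduleI)
    fix c f assume f: "f \<in> carrier (?D)" and c: "c \<in> carrier K"
    show "c \<odot>\<^bsub>?D\<^esub> f \<in> carrier (?D)" using smc f c .
  next
    fix c e f assume f: "f \<in> carrier (?D)" and c: "c \<in> carrier K" and e: "e \<in> carrier K"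
    show "(c \<oplus>\<^bsub>K\<^esub> e) \<odot>\<^bsub>?D\<^esub> f = c \<odot>\<^bsub>?D\<^esub> f \<oplus>\<^bsub>?D\<^esub> e \<odot>\<^bsub>?D\<^esub> f"
      using c e D[OF f] by (intro ext) (auto simp: direct_sum_sel module.smult_l_distr[OF mod])
    show "(c \<otimes>\<^bsub>K\<^esub> e) \<odot>\<^bsub>?D\<^esub> f = c \<odot>\<^bsub>?D\<^esub> (e \<odot>\<^bsub>?D\<^esub> f)"
      using c e D[OF f] by (intro ext) (auto simp: direct_sum_sel module.smult_assoc1[OF mod])
  next
    fix c f g assume f: "f \<in> carrier (?D)" and c: "c \<in> carrier K" and g: "g \<in> carrier (?D)"
    show "c \<odot>\<^bsub>?D\<^esub> (f \<oplus>\<^bsub>?D\<^esub> g) = c \<odot>\<^bsub>?D\<^esub> f \<oplus>\<^bsub>?D\<^esub> c \<odot>\<^bsub>?D\<^esub> g"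
      using c D[OF f] D[OF g] by (intro ext) (auto simp: direct_sum_sel module.smult_r_distr[OF mod])
  next
    fix f assume f: "f \<in> carrier (?D)"
    show "\<one>\<^bsub>K\<^esub> \<odot>\<^bsub>?D\<^esub> f = f"
      using D[OF f] by (intro ext) (auto simp: direct_sum_sel module.smult_one[OF mod])
  qed (use assms abg in auto)
qed

lemma direct_sum_in_linear:
  assumes mod: "\<And>i. i \<in> I \<Longrightarrow> module K (V i)" and "i \<in> I"
  shows "direct_sum_in I V i \<in> linear_maps K (V i) (direct_sum I V)"
proof -
  have ag: "abelian_group (V i)" if "i \<in> I" for i using mod[OF that] by (simp add: module_def)
  show ?thesis
  proof (rule linear_mapsI)
    fix x assume "x \<in> carrier (V i)"
    then show "direct_sum_in I V i x \<in> carrier (direct_sum I V)"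
      by (intro direct_sum_carrierI[where F = "{i}"]) (use ag in \<open>auto simp: direct_sum_in_def abelian_groupE[OF ag]\<close>)
  qed (use ag in \<open>auto simp: direct_sum_in_def direct_sum_sel abelian_groupE[OF ag]
        module.smult_r_null[OF mod] fun_eq_iff restrict_def\<close>)
qed

text \<open>Induction over a finite set containing the support of \<open>f\<close>, splitting off
  one coordinate at a time.\<close>

lemma direct_sum_generated:
  assumes "cring K" and mod: "\<And>i. i \<in> I \<Longrightarrow> module K (V i)"
    and T: "submodule T K (direct_sum I V)"
    and gen: "\<And>i x. i \<in> I \<Longrightarrow> x \<in> carrier (V i) \<Longrightarrow> direct_sum_in I V i x \<in> T"
    and f: "f \<in> carrier (direct_sum I V)"
  shows "f \<in> T"
proof -
  note D = direct_sum_carrierD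
  have ag: "abelian_group (V i)" if "i \<in> I" for i using mod[OF that] by (simp add: module_def)
  have DS: "module K (direct_sum I V)" by (rule direct_sum_module[OF assms(1) mod])
  have "f \<in> T" if "finite F" "f \<in> carrier (direct_sum I V)" "{i\<in>I. f i \<noteq> \<zero>\<^bsub>V i\<^esub>} \<subseteq> F" for F f
    using that
  proof (induction F arbitrary: f)
    case empty
    then have "f = \<zero>\<^bsub>direct_sum I V\<^esub>"
      using D(3)[OF empty(1)] by (intro extensionalityI[of _ I]) (auto simp: direct_sum_sel)
    then show ?case using submodule_zero[OF DS T] by simp
  next
    case (insert j F)
    show ?case
    proof (cases "j \<in> I")
      case False
      then show ?thesis using insert by (intro insert.IH) auto
    next
      case True
      \<comment> \<open>Clearing coordinate \<open>j\<close> shrinks the support bound from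
        \<open>insert j F\<close> to \<open>F\<close>; the cleared part is a single summand.\<close>
      define g where "g = f(j := \<zero>\<^bsub>V j\<^esub>)"
      have g: "g \<in> carrier (direct_sum I V)"
        by (rule direct_sum_carrierI[where F = "{i\<in>I. f i \<noteq> \<zero>\<^bsub>V i\<^esub>}"])
          (use D[OF insert(4)] ag True in \<open>auto simp: g_def abelian_groupE[OF ag] extensional_def\<close>)
      have "g \<in> T" by (rule insert.IH[OF g]) (use insert in \<open>auto simp: g_def\<close>)
      moreover have "direct_sum_in I V j (f j) \<in> T" by (rule gen[OF True]) (use D(1)[OF insert(4) True] in simp)
      moreover have "f = direct_sum_in I V j (f j) \<oplus>\<^bsub>direct_sum I V\<^esub> g"
        using D(3)[OF insert(4)]
        by (intro extensionalityI[of _ I])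
          (use D(1)[OF insert(4)] ag abelian_group.axioms(1)[OF ag] in
            \<open>auto simp: direct_sum_sel direct_sum_in_def g_def abelian_groupE[OF ag] abelian_monoid.r_zero\<close>)
      ultimately show ?thesis using submodule_add[OF DS T] by metis
    qed
  qed
  then show ?thesis using D(2)[OF f] f by blast
qed

definition direct_sum_lift ::
  "'i set \<Rightarrow> ('i \<Rightarrow> ('k, 'v) module) \<Rightarrow> ('k, 'w) module \<Rightarrow> ('i \<Rightarrow> 'v \<Rightarrow> 'w) \<Rightarrow> ('i \<Rightarrow> 'v) \<Rightarrow> 'w" where
  "direct_sum_lift I V U \<phi> f = finsum U (\<lambda>i. \<phi> i (f i)) {i\<in>I. f i \<noteq> \<zero>\<^bsub>V i\<^esub>}"

text \<open>The support varies with \<open>f\<close>. A larger finite index set adds only zero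
  terms, so the sums for \<open>f\<close>, \<open>g\<close> and \<open>f + g\<close> can be compared
  over one common set.\<close>

lemma direct_sum_lift_supset:
  assumes mod: "\<And>i. i \<in> I \<Longrightarrow> module K (V i)" and U: "module K U"
    and lin: "\<And>i. i \<in> I \<Longrightarrow> \<phi> i \<in> linear_maps K (V i) U"
    and "f \<in> carrier (direct_sum I V)" "finite F" "{i\<in>I. f i \<noteq> \<zero>\<^bsub>V i\<^esub>} \<subseteq> F" "F \<subseteq> I"
  shows "direct_sum_lift I V U \<phi> f = finsum U (\<lambda>i. \<phi> i (f i)) F"
proof -
  interpret U: module K U by fact
  show ?thesis
    unfolding direct_sum_lift_def
  proof (rule U.M.add.finprod_mono_neutral_cong_left)
    fix i assume i: "i \<in> F - {i \<in> I. f i \<noteq> \<zero>\<^bsub>V i\<^esub>}"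
    then have "i \<in> I" using assms(7) by auto
    with i show "\<phi> i (f i) = \<zero>\<^bsub>U\<^esub>" using lin_zero[OF mod U lin] by auto
  next
    show "(\<lambda>i. \<phi> i (f i)) \<in> F \<rightarrow> carrier U"
      using assms(7) by (auto intro!: lin_closed[OF lin] direct_sum_carrierD(1)[OF assms(4)])
  qed (use assms in auto)
qed

lemma direct_sum_lift_linear:
  assumes "cring K" and mod: "\<And>i. i \<in> I \<Longrightarrow> module K (V i)" and U: "module K U"
    and lin: "\<And>i. i \<in> I \<Longrightarrow> \<phi> i \<in> linear_maps K (V i) U"
  shows "direct_sum_lift I V U \<phi> \<in> linear_maps K (direct_sum I V) U"
proof -
  let ?L = "direct_sum_lift I V U \<phi>"
  let ?D = "direct_sum I V"
  interpret U: module K U by fact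
  interpret DS: module K "?D" by (rule direct_sum_module[OF assms(1) mod])
  note D = direct_sum_carrierD
  note sup = direct_sum_lift_supset[of I K V U \<phi>, OF mod U lin]
  have cl: "\<phi> i (f i) \<in> carrier U" if "f \<in> carrier (?D)" "i \<in> I" for f i
    using lin_closed[OF lin[OF that(2)] D(1)[OF that]] .
  show ?thesis
  proof (rule linear_mapsI)
    fix f assume "f \<in> carrier (?D)"
    then show "?L f \<in> carrier U"
      unfolding direct_sum_lift_def using cl by (intro U.finsum_closed) auto
  next
    fix f g assume f: "f \<in> carrier (?D)" and g: "g \<in> carrier (?D)"
    let ?F = "{i\<in>I. f i \<noteq> \<zero>\<^bsub>V i\<^esub>} \<union> {i\<in>I. g i \<noteq> \<zero>\<^bsub>V i\<^esub>} \<union> {i\<in>I. (f \<oplus>\<^bsub>?D\<^esub> g) i \<noteq> \<zero>\<^bsub>V i\<^esub>}"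
    have fg: "f \<oplus>\<^bsub>?D\<^esub> g \<in> carrier (?D)" using f g by simp
    have fin: "finite ?F" using D(2)[OF f] D(2)[OF g] D(2)[OF fg] by simp
    have "?L (f \<oplus>\<^bsub>?D\<^esub> g) = finsum U (\<lambda>i. \<phi> i ((f \<oplus>\<^bsub>?D\<^esub> g) i)) ?F"
      by (rule sup[OF _ _ fg fin]) auto
    also have "\<dots> = finsum U (\<lambda>i. \<phi> i (f i) \<oplus>\<^bsub>U\<^esub> \<phi> i (g i)) ?F"
      using cl f g D(1)[OF f] D(1)[OF g]
      by (intro U.finsum_cong') (auto simp: direct_sum_sel lin_add[OF lin])
    also have "\<dots> = finsum U (\<lambda>i. \<phi> i (f i)) ?F \<oplus>\<^bsub>U\<^esub> finsum U (\<lambda>i. \<phi> i (g i)) ?F"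
      using cl f g by (intro U.finsum_addf) auto
    also have "finsum U (\<lambda>i. \<phi> i (f i)) ?F = ?L f"
      by (rule sup[OF _ _ f fin, symmetric]) auto
    also have "finsum U (\<lambda>i. \<phi> i (g i)) ?F = ?L g"
      by (rule sup[OF _ _ g fin, symmetric]) auto
    finally show "?L (f \<oplus>\<^bsub>?D\<^esub> g) =
      ?L f \<oplus>\<^bsub>U\<^esub> ?L g" .
  next
    fix c f assume c: "c \<in> carrier K" and f: "f \<in> carrier (?D)"
    let ?F = "{i\<in>I. f i \<noteq> \<zero>\<^bsub>V i\<^esub>} \<union> {i\<in>I. (c \<odot>\<^bsub>?D\<^esub> f) i \<noteq> \<zero>\<^bsub>V i\<^esub>}"
    have cf: "c \<odot>\<^bsub>?D\<^esub> f \<in> carrier (?D)" using f c by simp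
    have fin: "finite ?F" using D(2)[OF f] D(2)[OF cf] by simp
    have "?L (c \<odot>\<^bsub>?D\<^esub> f) = finsum U (\<lambda>i. \<phi> i ((c \<odot>\<^bsub>?D\<^esub> f) i)) ?F"
      by (rule sup[OF _ _ cf fin]) auto
    also have "\<dots> = finsum U (\<lambda>i. c \<odot>\<^bsub>U\<^esub> \<phi> i (f i)) ?F"
      using cl f c D(1)[OF f]
      by (intro U.finsum_cong') (auto simp: direct_sum_sel lin_smult[OF lin])
    also have "\<dots> = c \<odot>\<^bsub>U\<^esub> finsum U (\<lambda>i. \<phi> i (f i)) ?F"
      using cl f c by (intro U.finsum_smult_ldistr[symmetric] fin) auto
    also have "finsum U (\<lambda>i. \<phi> i (f i)) ?F = ?L f"
      by (rule sup[OF _ _ f fin, symmetric]) auto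
    finally show "?L (c \<odot>\<^bsub>?D\<^esub> f) = c \<odot>\<^bsub>U\<^esub> ?L f" .
  qed
qed

lemma direct_sum_lift_in:
  assumes mod: "\<And>i. i \<in> I \<Longrightarrow> module K (V i)" and U: "module K U"
    and lin: "\<And>i. i \<in> I \<Longrightarrow> \<phi> i \<in> linear_maps K (V i) U"
    and i: "i \<in> I" and x: "x \<in> carrier (V i)"
  shows "direct_sum_lift I V U \<phi> (direct_sum_in I V i x) = \<phi> i x"
proof -
  interpret U: module K U by fact
  have "direct_sum_lift I V U \<phi> (direct_sum_in I V i x) =
      finsum U (\<lambda>j. \<phi> j (direct_sum_in I V i x j)) {i}"
    by (rule direct_sum_lift_supset[OF mod U lin])
      (use i lin_closed[OF direct_sum_in_linear[of I K V, OF mod i] x] in \<open>auto simp: direct_sum_in_def\<close>)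
  also have "\<dots> = \<phi> i x"
    using lin_closed[OF lin[OF i] x] i by (simp add: direct_sum_in_def)
  finally show ?thesis .
qed

subsection \<open>Universal property of the tensor product\<close>

definition bilinear_maps ::
  "('k, 'm) ring_scheme \<Rightarrow> ('k, 'v, 'p) module_scheme \<Rightarrow> ('k, 'w, 'q) module_scheme \<Rightarrow>
   ('k, 'u, 'r) module_scheme \<Rightarrow> ('v \<Rightarrow> 'w \<Rightarrow> 'u) set" where
  "bilinear_maps K V W U = {\<beta>.
     (\<forall>v\<in>carrier V. \<beta> v \<in> linear_maps K W U) \<and> (\<forall>w\<in>carrier W. (\<lambda>v. \<beta> v w) \<in> linear_maps K V U)}"

lemma bilinear_mapsI:
  "(\<And>v. v \<in> carrier V \<Longrightarrow> \<beta> v \<in> linear_maps K W U) \<Longrightarrow>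
   (\<And>w. w \<in> carrier W \<Longrightarrow> (\<lambda>v. \<beta> v w) \<in> linear_maps K V U) \<Longrightarrow> \<beta> \<in> bilinear_maps K V W U"
  unfolding bilinear_maps_def by auto

lemma bilinear_mapsD:
  "\<beta> \<in> bilinear_maps K V W U \<Longrightarrow> v \<in> carrier V \<Longrightarrow> \<beta> v \<in> linear_maps K W U"
  "\<beta> \<in> bilinear_maps K V W U \<Longrightarrow> w \<in> carrier W \<Longrightarrow> (\<lambda>v. \<beta> v w) \<in> linear_maps K V U"
  unfolding bilinear_maps_def by auto

lemma bilinear_maps_closed:
  "\<beta> \<in> bilinear_maps K V W U \<Longrightarrow> v \<in> carrier V \<Longrightarrow> w \<in> carrier W \<Longrightarrow> \<beta> v w \<in> carrier U"
  by (rule lin_closed[OF bilinear_mapsD(1)])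

lemma bilinear_maps_compose:
  assumes "\<beta> \<in> bilinear_maps K V' W' U" "f \<in> linear_maps K V V'" "g \<in> linear_maps K W W'"
  shows "(\<lambda>v w. \<beta> (f v) (g w)) \<in> bilinear_maps K V W U"
proof (rule bilinear_mapsI)
  fix v assume "v \<in> carrier V"
  then show "(\<lambda>w. \<beta> (f v) (g w)) \<in> linear_maps K W U"
    by (intro lin_compose[OF assms(3)] bilinear_mapsD(1)[OF assms(1)] lin_closed[OF assms(2)])
next
  fix w assume "w \<in> carrier W"
  then show "(\<lambda>v. \<beta> (f v) (g w)) \<in> linear_maps K V U"
    by (intro lin_compose[OF assms(2) bilinear_mapsD(2)[OF assms(1)]] lin_closed[OF assms(3)])
qed

lemma bilinear_maps_linear_compose:
  "\<beta> \<in> bilinear_maps K V W U \<Longrightarrow> f \<in> linear_maps K U U' \<Longrightarrow> (\<lambda>v w. f (\<beta> v w)) \<in> bilinear_maps K V W U'"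
  by (auto intro!: bilinear_mapsI intro: lin_compose[OF bilinear_mapsD(1)] lin_compose[OF bilinear_mapsD(2)])

section \<open>Free modules and maps out of them\<close>

lemma self_module_sel:
  "carrier (self_module K) = carrier K" "\<zero>\<^bsub>self_module K\<^esub> = \<zero>\<^bsub>K\<^esub>"
  "x \<oplus>\<^bsub>self_module K\<^esub> y = x \<oplus>\<^bsub>K\<^esub> y" "x \<odot>\<^bsub>self_module K\<^esub> y = x \<otimes>\<^bsub>K\<^esub> y"
  by (simp_all add: self_module_def)

lemma self_module_module:
  assumes "cring K"
  shows "module K (self_module K)"
proof -
  interpret K: cring K by fact
  show ?thesis
  proof (rule moduleI)
    show "abelian_group (self_module K)"
      by (rule abelian_groupI)
        (auto simp: self_module_sel K.a_ac intro: bexI[of _ "\<ominus>\<^bsub>K\<^esub> x" for x] K.l_neg)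
  qed (auto simp: self_module_sel assms K.l_distr K.r_distr K.m_assoc)
qed

lemma free_module_module: "cring K \<Longrightarrow> module K (free_module K S)"
  unfolding free_module_def by (intro direct_sum_module self_module_module)

lemma direct_sum_in_self:
  assumes "cring K" "c \<in> carrier K"
  shows "direct_sum_in S (\<lambda>_. self_module K) s c = c \<odot>\<^bsub>free_module K S\<^esub> free_basis K S s"
proof -
  interpret K: cring K by fact
  show ?thesis
    using assms(2)
    by (auto simp: free_module_def free_basis_def direct_sum_in_def direct_sum_sel self_module_sel fun_eq_iff)
qed

lemma free_basis_closed:
  assumes "cring K" "s \<in> S"
  shows "free_basis K S s \<in> carrier (free_module K S)"
proof -
  interpret K: cring K by fact
  show ?thesis
    unfolding free_basis_def free_module_def
    by (rule lin_closed[OF direct_sum_in_linear[of S K]])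
      (use assms(2) self_module_module[OF assms(1)] in \<open>auto simp: self_module_sel\<close>)
qed

lemma free_module_generated:
  assumes "cring K" "submodule T K (free_module K S)" "\<And>s. s \<in> S \<Longrightarrow> free_basis K S s \<in> T"
    and "f \<in> carrier (free_module K S)"
  shows "f \<in> T"
proof (rule direct_sum_generated[OF assms(1), of S "\<lambda>_. self_module K"])
  fix s c assume "s \<in> S" "c \<in> carrier (self_module K)"
  then show "direct_sum_in S (\<lambda>_. self_module K) s c \<in> T"
    using assms(3) submodule_smult[OF free_module_module[OF assms(1)] assms(2)]
    by (simp add: direct_sum_in_self[OF assms(1)] self_module_sel)
qed (use assms self_module_module in \<open>auto simp: free_module_def\<close>)

definition free_lift ::
  "('k, 'm) ring_scheme \<Rightarrow> 's set \<Rightarrow> ('k, 'u) module \<Rightarrow> ('s \<Rightarrow> 'u) \<Rightarrow> ('s \<Rightarrow> 'k) \<Rightarrow> 'u" where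
  "free_lift K S U \<beta> x = finsum U (\<lambda>s. x s \<odot>\<^bsub>U\<^esub> \<beta> s) {s\<in>S. x s \<noteq> \<zero>\<^bsub>K\<^esub>}"

lemma
  assumes "cring K" "module K U" "\<And>s. s \<in> S \<Longrightarrow> \<beta> s \<in> carrier U"
  shows free_lift_linear: "free_lift K S U \<beta> \<in> linear_maps K (free_module K S) U"
    and free_lift_basis: "s \<in> S \<Longrightarrow> free_lift K S U \<beta> (free_basis K S s) = \<beta> s"
proof -
  interpret U: module K U by fact
  have eq: "free_lift K S U \<beta> = direct_sum_lift S (\<lambda>_. self_module K) U (\<lambda>s c. c \<odot>\<^bsub>U\<^esub> \<beta> s)"
    by (auto simp: fun_eq_iff free_lift_def direct_sum_lift_def self_module_sel)
  have lin: "(\<lambda>c. c \<odot>\<^bsub>U\<^esub> \<beta> s) \<in> linear_maps K (self_module K) U" if "s \<in> S" for s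
    by (rule linear_mapsI) (use assms(3)[OF that] in \<open>auto simp: self_module_sel U.smult_l_distr U.smult_assoc1\<close>)
  show "free_lift K S U \<beta> \<in> linear_maps K (free_module K S) U"
    unfolding eq free_module_def
    by (rule direct_sum_lift_linear[OF assms(1) self_module_module[OF assms(1)] assms(2) lin])
  show "free_lift K S U \<beta> (free_basis K S s) = \<beta> s" if "s \<in> S"
    unfolding eq free_basis_def
    using direct_sum_lift_in[of S K "\<lambda>_. self_module K" U, OF self_module_module[OF assms(1)] assms(2) lin that]
      assms(3)[OF that]
    by (simp add: self_module_sel)
qed

text \<open>The generating set inside \<open>tensor_rel\<close>, named separately so that facts
  about spans apply to it.\<close>

definition tensor_gens ::
  "('k, 'm) ring_scheme \<Rightarrow> ('k, 'v) module \<Rightarrow> ('k, 'w) module \<Rightarrow> ('v \<times> 'w \<Rightarrow> 'k) set" where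
  "tensor_gens K V W =
    (let F = free_module K (carrier V \<times> carrier W);
         e = (\<lambda>v w. free_basis K (carrier V \<times> carrier W) (v, w))
     in
      ({e (v \<oplus>\<^bsub>V\<^esub> v') w \<ominus>\<^bsub>F\<^esub> (e v w \<oplus>\<^bsub>F\<^esub> e v' w) | v v' w.
          v \<in> carrier V \<and> v' \<in> carrier V \<and> w \<in> carrier W} \<union>
       {e v (w \<oplus>\<^bsub>W\<^esub> w') \<ominus>\<^bsub>F\<^esub> (e v w \<oplus>\<^bsub>F\<^esub> e v w') | v w w'.
          v \<in> carrier V \<and> w \<in> carrier W \<and> w' \<in> carrier W} \<union>
       {e (c \<odot>\<^bsub>V\<^esub> v) w \<ominus>\<^bsub>F\<^esub> (c \<odot>\<^bsub>F\<^esub> e v w) | c v w.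
          c \<in> carrier K \<and> v \<in> carrier V \<and> w \<in> carrier W} \<union>
       {e v (c \<odot>\<^bsub>W\<^esub> w) \<ominus>\<^bsub>F\<^esub> (c \<odot>\<^bsub>F\<^esub> e v w) | c v w.
          c \<in> carrier K \<and> v \<in> carrier V \<and> w \<in> carrier W}))"

lemma tensor_rel_eq:
  "tensor_rel K V W = lin_span K (free_module K (carrier V \<times> carrier W)) (tensor_gens K V W)"
  unfolding tensor_rel_def tensor_gens_def Let_def by simp

text \<open>Has the shape of the choice expression in \<open>tensor_map\<close>, so that
  \<open>tensor_map\<close> is an instance and one universal property covers both.\<close>

definition tensor_lift ::
  "('k, 'm) ring_scheme \<Rightarrow> ('k, 'v) module \<Rightarrow> ('k, 'w) module \<Rightarrow> ('k, 'u) module \<Rightarrow>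
   ('v \<Rightarrow> 'w \<Rightarrow> 'u) \<Rightarrow> ('v \<times> 'w \<Rightarrow> 'k) set \<Rightarrow> 'u" where
  "tensor_lift K V W U \<beta> X =
    the_elem (free_lift K (carrier V \<times> carrier W) U (\<lambda>(v, w). \<beta> v w) ` X)"

lemma tensor_map_eq:
  "tensor_map K V W V' W' f g =
    tensor_lift K V W (tensor K V' W') (\<lambda>v w. pure_tensor K V' W' (f v) (g w))"
  unfolding tensor_map_def tensor_lift_def free_lift_def fun_eq_iff
  by (simp add: case_prod_unfold)

context
  fixes K :: "('k, 'm) ring_scheme" and V :: "('k, 'v) module" and W :: "('k, 'w) module"
  assumes V: "module K V" and W: "module K W"
begin

interpretation V: module K V by (rule V)
interpretation W: module K W by (rule W)

private abbreviation (input) "F \<equiv> free_module K (carrier V \<times> carrier W)"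
private abbreviation (input) "e v w \<equiv> free_basis K (carrier V \<times> carrier W) (v, w)"

interpretation F: module K F by (rule free_module_module[OF V.R.is_cring])

private lemma e_closed: "v \<in> carrier V \<Longrightarrow> w \<in> carrier W \<Longrightarrow> e v w \<in> carrier F"
  by (rule free_basis_closed[OF V.R.is_cring]) simp

private lemma gens_carrier: "tensor_gens K V W \<subseteq> carrier F"
  unfolding tensor_gens_def Let_def by (auto simp: e_closed a_minus_def)

lemma tensor_rel_submodule: "submodule (tensor_rel K V W) K F"
  unfolding tensor_rel_eq by (rule lin_span_submodule[OF F.module_axioms gens_carrier])

lemma tensor_module: "module K (tensor K V W)"
  unfolding tensor_def by (rule quot_module_module[OF F.module_axioms tensor_rel_submodule])

private lemma proj: "(\<lambda>x. tensor_rel K V W +>\<^bsub>F\<^esub> x) \<in> linear_maps K F (tensor K V W)"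
  unfolding tensor_def by (rule coset_linear_maps[OF F.module_axioms tensor_rel_submodule])

private lemma proj_gen:
  assumes "x \<ominus>\<^bsub>F\<^esub> y \<in> tensor_gens K V W" "x \<in> carrier F" "y \<in> carrier F"
  shows "tensor_rel K V W +>\<^bsub>F\<^esub> x = tensor_rel K V W +>\<^bsub>F\<^esub> y"
  using coset_eq_iff[OF F.module_axioms tensor_rel_submodule assms(2,3)] lin_span_inc[OF assms(1)]
  unfolding tensor_rel_eq by blast

lemma pure_tensor_bilinear: "pure_tensor K V W \<in> bilinear_maps K V W (tensor K V W)"
proof -
  note pr = lin_closed[OF proj] lin_add[OF proj] lin_smult[OF proj]
  have g1: "e (v \<oplus>\<^bsub>V\<^esub> v') w \<ominus>\<^bsub>F\<^esub> (e v w \<oplus>\<^bsub>F\<^esub> e v' w) \<in> tensor_gens K V W"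
    if "v \<in> carrier V" "v' \<in> carrier V" "w \<in> carrier W" for v v' w
    unfolding tensor_gens_def Let_def by (rule UnI1, rule UnI1, rule UnI1, rule CollectI, rule exI[of _ v], rule exI[of _ v'], rule exI[of _ w], simp add: that)
  have g2: "e v (w \<oplus>\<^bsub>W\<^esub> w') \<ominus>\<^bsub>F\<^esub> (e v w \<oplus>\<^bsub>F\<^esub> e v w') \<in> tensor_gens K V W"
    if "v \<in> carrier V" "w \<in> carrier W" "w' \<in> carrier W" for v w w'
    unfolding tensor_gens_def Let_def by (rule UnI1, rule UnI1, rule UnI2, rule CollectI, rule exI[of _ v], rule exI[of _ w], rule exI[of _ w'], simp add: that)
  have g3: "e (c \<odot>\<^bsub>V\<^esub> v) w \<ominus>\<^bsub>F\<^esub> (c \<odot>\<^bsub>F\<^esub> e v w) \<in> tensor_gens K V W"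
    if "c \<in> carrier K" "v \<in> carrier V" "w \<in> carrier W" for c v w
    unfolding tensor_gens_def Let_def by (rule UnI1, rule UnI2, rule CollectI, rule exI[of _ c], rule exI[of _ v], rule exI[of _ w], simp add: that)
  have g4: "e v (c \<odot>\<^bsub>W\<^esub> w) \<ominus>\<^bsub>F\<^esub> (c \<odot>\<^bsub>F\<^esub> e v w) \<in> tensor_gens K V W"
    if "c \<in> carrier K" "v \<in> carrier V" "w \<in> carrier W" for c v w
    unfolding tensor_gens_def Let_def by (rule UnI2, rule CollectI, rule exI[of _ c], rule exI[of _ v], rule exI[of _ w], simp add: that)
  show ?thesis
    unfolding pure_tensor_def
    by (intro bilinear_mapsI linear_mapsI)
      (simp_all add: pr(1) pr(2,3)[symmetric] e_closed proj_gen[OF g1] proj_gen[OF g2] proj_gen[OF g3] proj_gen[OF g4])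
qed

text \<open>Pulled back to the free module, \<open>T\<close> contains every basis element, since
  these represent the pure tensors.\<close>

lemma tensor_generated:
  assumes "submodule T K (tensor K V W)"
    and "\<And>v w. v \<in> carrier V \<Longrightarrow> w \<in> carrier W \<Longrightarrow> pure_tensor K V W v w \<in> T"
    and "X \<in> carrier (tensor K V W)"
  shows "X \<in> T"
proof -
  obtain x where x: "x \<in> carrier F" "X = tensor_rel K V W +>\<^bsub>F\<^esub> x"
    using assms(3) by (auto simp: tensor_def quot_module_sel)
  have "x \<in> {x \<in> carrier F. tensor_rel K V W +>\<^bsub>F\<^esub> x \<in> T}"
    by (rule free_module_generated[OF V.R.is_cring
          submodule_preimage[OF F.module_axioms tensor_module proj assms(1)] _ x(1)])
      (use assms(2) e_closed in \<open>auto simp: pure_tensor_def\<close>)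
  then show ?thesis using x by simp
qed

context
  fixes U :: "('k, 'u) module" and \<beta> :: "'v \<Rightarrow> 'w \<Rightarrow> 'u"
  assumes U: "module K U" and \<beta>: "\<beta> \<in> bilinear_maps K V W U"
begin

interpretation U: module K U by (rule U)

private abbreviation (input) "L \<equiv> free_lift K (carrier V \<times> carrier W) U (\<lambda>(v, w). \<beta> v w)"

private lemma L_lin: "L \<in> linear_maps K F U"
  by (rule free_lift_linear[OF V.R.is_cring U]) (auto intro: bilinear_maps_closed[OF \<beta>])

private lemma L_e: "v \<in> carrier V \<Longrightarrow> w \<in> carrier W \<Longrightarrow> L (e v w) = \<beta> v w"
  by (subst free_lift_basis[OF V.R.is_cring U]) (auto intro: bilinear_maps_closed[OF \<beta>])

text \<open>Each of the four families of generators expresses additivity or homogeneity in one slot,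
  which bilinearity of \<open>\<beta>\<close> turns into a zero difference.\<close>

private lemma L_rel:
  assumes "x \<in> tensor_rel K V W"
  shows "L x = \<zero>\<^bsub>U\<^esub>"
proof -
  note bc = bilinear_maps_closed[OF \<beta>]
  note b1 = lin_add[OF bilinear_mapsD(1)[OF \<beta>]] lin_smult[OF bilinear_mapsD(1)[OF \<beta>]]
  note b2 = lin_add[OF bilinear_mapsD(2)[OF \<beta>]] lin_smult[OF bilinear_mapsD(2)[OF \<beta>]]
  have [simp]: "u \<ominus>\<^bsub>U\<^esub> u = \<zero>\<^bsub>U\<^esub>" if "u \<in> carrier U" for u using that by (simp add: a_minus_def U.r_neg)
  have "L x \<in> {\<zero>\<^bsub>U\<^esub>}"
    by (rule lin_span_image[OF F.module_axioms U L_lin submodule_singleton_zero[OF U] gens_carrier _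
          assms[unfolded tensor_rel_eq]])
      (auto simp: tensor_gens_def Let_def lin_diff[OF F.module_axioms U L_lin] e_closed
        lin_add[OF L_lin] lin_smult[OF L_lin] L_e bc b1 b2)
  then show ?thesis by simp
qed

private lemma lift_coset:
  assumes "x \<in> carrier F"
  shows "tensor_lift K V W U \<beta> (tensor_rel K V W +>\<^bsub>F\<^esub> x) = L x"
  unfolding tensor_lift_def
proof (rule the_elem_image_unique)
  show "tensor_rel K V W +>\<^bsub>F\<^esub> x \<noteq> {}"
    using mem_coset_iff[OF F.module_axioms tensor_rel_submodule assms, of x] assms
      submodule_zero[OF F.module_axioms tensor_rel_submodule]
    by (auto simp: a_minus_def F.M.r_neg)
  fix y assume "y \<in> tensor_rel K V W +>\<^bsub>F\<^esub> x"
  then have y: "y \<in> carrier F" "y \<ominus>\<^bsub>F\<^esub> x \<in> tensor_rel K V W"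
    by (auto simp: mem_coset_iff[OF F.module_axioms tensor_rel_submodule assms])
  then have "L y \<ominus>\<^bsub>U\<^esub> L x = \<zero>\<^bsub>U\<^esub>"
    using L_rel[OF y(2)] lin_diff[OF F.module_axioms U L_lin y(1) assms] by simp
  then show "L y = L x"
    using lin_closed[OF L_lin] y(1) assms module_diff_eq_zero_iff[OF U] by blast
qed

lemma tensor_lift_linear: "tensor_lift K V W U \<beta> \<in> linear_maps K (tensor K V W) U"
  unfolding tensor_def
  by (rule quot_module_linear_maps[OF F.module_axioms tensor_rel_submodule L_lin lift_coset])

lemma tensor_lift_pure:
  "v \<in> carrier V \<Longrightarrow> w \<in> carrier W \<Longrightarrow> tensor_lift K V W U \<beta> (pure_tensor K V W v w) = \<beta> v w"
  unfolding pure_tensor_def by (simp add: lift_coset e_closed L_e)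

end

text \<open>The equalizer of \<open>f\<close> and \<open>g\<close> is a submodule that contains the
  pure tensors.\<close>

lemma tensor_maps_ext:
  assumes "module K U" "f \<in> linear_maps K (tensor K V W) U" "g \<in> linear_maps K (tensor K V W) U"
    and "\<And>v w. v \<in> carrier V \<Longrightarrow> w \<in> carrier W \<Longrightarrow> f (pure_tensor K V W v w) = g (pure_tensor K V W v w)"
    and "X \<in> carrier (tensor K V W)"
  shows "f X = g X"
proof -
  have "X \<in> {X \<in> carrier (tensor K V W). f X = g X}"
    by (rule tensor_generated[OF submodule_equalizer[OF tensor_module assms(1-3)] _ assms(5)])
      (use assms(4) bilinear_maps_closed[OF pure_tensor_bilinear] in auto)
  then show ?thesis by simp
qed

end

lemma
  assumes "module K V" "module K W" "module K V'" "module K W'"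
    and f: "f \<in> linear_maps K V V'" and g: "g \<in> linear_maps K W W'"
  shows tensor_map_linear: "tensor_map K V W V' W' f g \<in> linear_maps K (tensor K V W) (tensor K V' W')"
    and tensor_map_pure: "v \<in> carrier V \<Longrightarrow> w \<in> carrier W \<Longrightarrow>
      tensor_map K V W V' W' f g (pure_tensor K V W v w) = pure_tensor K V' W' (f v) (g w)"
proof -
  note b = bilinear_maps_compose[OF pure_tensor_bilinear[OF assms(3,4)] f g]
  note m = tensor_module[OF assms(3,4)]
  show "tensor_map K V W V' W' f g \<in> linear_maps K (tensor K V W) (tensor K V' W')"
    unfolding tensor_map_eq by (rule tensor_lift_linear[OF assms(1,2) m b])
  show "v \<in> carrier V \<Longrightarrow> w \<in> carrier W \<Longrightarrow>
      tensor_map K V W V' W' f g (pure_tensor K V W v w) = pure_tensor K V' W' (f v) (g w)"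
    unfolding tensor_map_eq by (rule tensor_lift_pure[OF assms(1,2) m b])
qed

subsection \<open>Universal property of colimits\<close>

definition colim_in ::
  "('k, 'm) ring_scheme \<Rightarrow> 'i::order set \<Rightarrow> ('i \<Rightarrow> ('k, 'v) module) \<Rightarrow> ('i \<Rightarrow> 'i \<Rightarrow> 'v \<Rightarrow> 'v) \<Rightarrow>
   'i \<Rightarrow> 'v \<Rightarrow> ('i \<Rightarrow> 'v) set" where
  "colim_in K I V t i x = colim_rel K I V t +>\<^bsub>direct_sum I V\<^esub> direct_sum_in I V i x"

locale diagram =
  fixes K :: "('k, 'm) ring_scheme" and I :: "'i::order set" and V :: "'i \<Rightarrow> ('k, 'v) module"
    and t :: "'i \<Rightarrow> 'i \<Rightarrow> 'v \<Rightarrow> 'v"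
  assumes cring: "cring K"
    and vs: "\<And>i. i \<in> I \<Longrightarrow> module K (V i)"
    and lin: "\<And>i j. i \<in> I \<Longrightarrow> j \<in> I \<Longrightarrow> i \<le> j \<Longrightarrow> t i j \<in> linear_maps K (V i) (V j)"
begin

abbreviation "DS \<equiv> direct_sum I V"
abbreviation "inD \<equiv> direct_sum_in I V"

definition gens where
  "gens = {inD i x \<ominus>\<^bsub>DS\<^esub> inD j (t i j x) | i j x. i \<in> I \<and> j \<in> I \<and> i \<le> j \<and> x \<in> carrier (V i)}"

lemma colim_rel_eq: "colim_rel K I V t = lin_span K DS gens"
  unfolding colim_rel_def gens_def by simp

lemma DS: "module K DS"
  by (rule direct_sum_module[OF cring vs])

lemma in_linear: "i \<in> I \<Longrightarrow> inD i \<in> linear_maps K (V i) DS"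
  by (rule direct_sum_in_linear[OF vs])

lemma gens_carrier: "gens \<subseteq> carrier DS"
proof -
  interpret DS: module K DS by (rule DS)
  show ?thesis unfolding gens_def a_minus_def
    using lin_closed[OF in_linear] lin_closed[OF lin] by auto
qed

lemma colim_rel_submodule: "submodule (colim_rel K I V t) K DS"
  unfolding colim_rel_eq by (rule lin_span_submodule[OF DS gens_carrier])

lemma colim_module: "module K (colim K I V t)"
  unfolding colim_def by (rule quot_module_module[OF DS colim_rel_submodule])

lemma proj_linear: "(\<lambda>x. colim_rel K I V t +>\<^bsub>DS\<^esub> x) \<in> linear_maps K DS (colim K I V t)"
  unfolding colim_def by (rule coset_linear_maps[OF DS colim_rel_submodule])

lemma colim_in_linear: "i \<in> I \<Longrightarrow> colim_in K I V t i \<in> linear_maps K (V i) (colim K I V t)"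
  unfolding colim_in_def by (rule lin_compose[OF in_linear proj_linear])

lemma colim_in_compat:
  assumes "i \<in> I" "j \<in> I" "i \<le> j" "x \<in> carrier (V i)"
  shows "colim_in K I V t j (t i j x) = colim_in K I V t i x"
proof -
  have "inD i x \<ominus>\<^bsub>DS\<^esub> inD j (t i j x) \<in> colim_rel K I V t"
    unfolding colim_rel_eq by (rule lin_span_inc) (use assms in \<open>auto simp: gens_def\<close>)
  then have "colim_in K I V t i x = colim_in K I V t j (t i j x)"
    unfolding colim_in_def
    using coset_eq_iff[OF DS colim_rel_submodule, of "inD i x" "inD j (t i j x)"]
      lin_closed[OF in_linear[OF assms(1)] assms(4)]
      lin_closed[OF in_linear[OF assms(2)] lin_closed[OF lin[OF assms(1-3)] assms(4)]]
    by blast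
  then show ?thesis by simp
qed

lemma colim_generated:
  assumes T: "submodule T K (colim K I V t)"
    and "\<And>i x. i \<in> I \<Longrightarrow> x \<in> carrier (V i) \<Longrightarrow> colim_in K I V t i x \<in> T"
    and "X \<in> carrier (colim K I V t)"
  shows "X \<in> T"
proof -
  obtain x where x: "x \<in> carrier DS" "X = colim_rel K I V t +>\<^bsub>DS\<^esub> x"
    using assms(3) by (auto simp: colim_def quot_module_sel)
  have "x \<in> {x \<in> carrier DS. colim_rel K I V t +>\<^bsub>DS\<^esub> x \<in> T}"
    by (rule direct_sum_generated[OF cring vs submodule_preimage[OF DS colim_module proj_linear T] _ x(1)])
      (use assms(2) lin_closed[OF in_linear] in \<open>auto simp: colim_in_def\<close>)
  then show ?thesis using x by simp
qed

text \<open>The submodule \<open>H\<close> is arbitrary so that the lemma serves twice: with the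
  relations of another colimit it yields \<open>colim_map\<close>, with the zero submodule it yields
  the universal property.\<close>

lemma coset_map_colim:
  assumes W: "module K W" and H: "submodule H K W" and E: "E \<in> linear_maps K DS W"
    and rel: "\<And>i j x. i \<in> I \<Longrightarrow> j \<in> I \<Longrightarrow> i \<le> j \<Longrightarrow> x \<in> carrier (V i) \<Longrightarrow>
      E (inD i x) \<ominus>\<^bsub>W\<^esub> E (inD j (t i j x)) \<in> H"
  shows "coset_map W H E \<in> linear_maps K (colim K I V t) (quot_module W H)"
    and "i \<in> I \<Longrightarrow> x \<in> carrier (V i) \<Longrightarrow> coset_map W H E (colim_in K I V t i x) = H +>\<^bsub>W\<^esub> E (inD i x)"
proof -
  have k: "E y \<in> H" if "y \<in> colim_rel K I V t" for y
  proof (rule lin_span_image[OF DS W E H gens_carrier _ that[unfolded colim_rel_eq]])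
    fix x assume "x \<in> gens"
    then show "E x \<in> H"
      unfolding gens_def
      using rel lin_diff[OF DS W E] lin_closed[OF in_linear] lin_closed[OF lin] by auto
  qed
  have c: "coset_map W H E (colim_rel K I V t +>\<^bsub>DS\<^esub> x) = H +>\<^bsub>W\<^esub> E x" if "x \<in> carrier DS" for x
    by (rule coset_map_linear_coset[OF DS colim_rel_submodule W H E k that])
  show "coset_map W H E \<in> linear_maps K (colim K I V t) (quot_module W H)"
    unfolding colim_def
    by (rule quot_module_linear_maps[OF DS colim_rel_submodule
          lin_compose[OF E coset_linear_maps[OF W H]] c])
  show "i \<in> I \<Longrightarrow> x \<in> carrier (V i) \<Longrightarrow> coset_map W H E (colim_in K I V t i x) = H +>\<^bsub>W\<^esub> E (inD i x)"
    unfolding colim_in_def using c lin_closed[OF in_linear] by blast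
qed

lemma colim_desc:
  fixes U :: "('k, 'u) module"
  assumes U: "module K U" and \<phi>: "\<And>i. i \<in> I \<Longrightarrow> \<phi> i \<in> linear_maps K (V i) U"
    and comp: "\<And>i j x. i \<in> I \<Longrightarrow> j \<in> I \<Longrightarrow> i \<le> j \<Longrightarrow> x \<in> carrier (V i) \<Longrightarrow> \<phi> j (t i j x) = \<phi> i x"
  shows "\<exists>L\<in>linear_maps K (colim K I V t) U. \<forall>i\<in>I. \<forall>x\<in>carrier (V i). L (colim_in K I V t i x) = \<phi> i x"
proof -
  interpret U: module K U by (rule U)
  \<comment> \<open>Modulo the zero submodule cosets are singletons, and \<open>the_elem\<close>
    reads off their element; this turns the map into cosets into a map into
    \<open>U\<close>.\<close>
  let ?E = "direct_sum_lift I V U \<phi>" and ?Z = "{\<zero>\<^bsub>U\<^esub>}"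
  note Z = submodule_singleton_zero[OF U]
  note E = direct_sum_lift_linear[of K I V U \<phi>, OF cring vs U \<phi>]
  have Ein: "?E (inD i x) = \<phi> i x" if "i \<in> I" "x \<in> carrier (V i)" for i x
    using direct_sum_lift_in[of I K V U \<phi>, OF vs U \<phi>] that by blast
  have rel: "?E (inD i x) \<ominus>\<^bsub>U\<^esub> ?E (inD j (t i j x)) \<in> ?Z"
    if "i \<in> I" "j \<in> I" "i \<le> j" "x \<in> carrier (V i)" for i j x
    using that lin_closed[OF lin[OF that(1-3)] that(4)] lin_closed[OF \<phi>[OF that(1)] that(4)]
    by (simp add: Ein comp a_minus_def U.M.r_neg)
  have single: "the_elem (?Z +>\<^bsub>U\<^esub> u) = u" if "u \<in> carrier U" for u
    using that by (simp add: a_r_coset_def')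
  have sl: "the_elem \<in> linear_maps K (quot_module U ?Z) U"
    by (rule quot_module_linear_maps[OF U Z lin_id]) (rule single)
  show ?thesis
  proof (intro bexI ballI)
    show "(\<lambda>X. the_elem (coset_map U ?Z ?E X)) \<in> linear_maps K (colim K I V t) U"
      by (rule lin_compose[OF coset_map_colim(1)[OF U Z E rel] sl])
    fix i x assume "i \<in> I" "x \<in> carrier (V i)"
    then show "the_elem (coset_map U ?Z ?E (colim_in K I V t i x)) = \<phi> i x"
      using lin_closed[OF \<phi>] by (simp add: coset_map_colim(2)[OF U Z E rel] Ein single)
  qed
qed

lemma colim_maps_ext:
  assumes "module K U" "f \<in> linear_maps K (colim K I V t) U" "g \<in> linear_maps K (colim K I V t) U"
    and "\<And>i x. i \<in> I \<Longrightarrow> x \<in> carrier (V i) \<Longrightarrow> f (colim_in K I V t i x) = g (colim_in K I V t i x)"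
    and "X \<in> carrier (colim K I V t)"
  shows "f X = g X"
proof -
  have "X \<in> {X \<in> carrier (colim K I V t). f X = g X}"
    by (rule colim_generated[OF submodule_equalizer[OF colim_module assms(1-3)] _ assms(5)])
      (use assms(4) lin_closed[OF colim_in_linear] in auto)
  then show ?thesis by simp
qed

end

lemma
  assumes D: "diagram K I V t" and D': "diagram K I' V' t'" and sub: "I \<subseteq> I'"
    and h: "\<And>i. i \<in> I \<Longrightarrow> h i \<in> linear_maps K (V i) (V' i)"
    and nat: "\<And>i j x. i \<in> I \<Longrightarrow> j \<in> I \<Longrightarrow> i \<le> j \<Longrightarrow> x \<in> carrier (V i) \<Longrightarrow>
      h j (t i j x) = t' i j (h i x)"
  shows colim_map_linear: "colim_map K I I' V' t' h \<in> linear_maps K (colim K I V t) (colim K I' V' t')"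
    and colim_map_in: "i \<in> I \<Longrightarrow> x \<in> carrier (V i) \<Longrightarrow>
      colim_map K I I' V' t' h (colim_in K I V t i x) = colim_in K I' V' t' i (h i x)"
proof -
  interpret D: diagram K I V t by fact
  interpret D': diagram K I' V' t' by fact
  interpret DS: module K "direct_sum I V" by (rule D.DS)
  interpret DS': module K "direct_sum I' V'" by (rule D'.DS)
  let ?E = "\<lambda>f. \<lambda>i\<in>I'. if i \<in> I then h i (f i) else \<zero>\<^bsub>V' i\<^esub>"
  \<comment> \<open>\<open>direct_sum_in\<close> fills the other coordinates with zero, so
    \<open>?E\<close> preserves finite support and commutes with the inclusions only because
    \<open>h i\<close> preserves zero.\<close>
  have h0: "h i \<zero>\<^bsub>V i\<^esub> = \<zero>\<^bsub>V' i\<^esub>" if "i \<in> I" for i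
    using that sub lin_zero[OF D.vs[OF that] D'.vs h[OF that]] by blast
  have z: "\<zero>\<^bsub>V' i\<^esub> \<in> carrier (V' i)" "c \<odot>\<^bsub>V' i\<^esub> \<zero>\<^bsub>V' i\<^esub> = \<zero>\<^bsub>V' i\<^esub>" "\<zero>\<^bsub>V' i\<^esub> \<oplus>\<^bsub>V' i\<^esub> \<zero>\<^bsub>V' i\<^esub> = \<zero>\<^bsub>V' i\<^esub>"
    if "i \<in> I'" "c \<in> carrier K" for i c
  proof -
    interpret W: module K "V' i" by (rule D'.vs[OF that(1)])
    show "\<zero>\<^bsub>V' i\<^esub> \<in> carrier (V' i)" "c \<odot>\<^bsub>V' i\<^esub> \<zero>\<^bsub>V' i\<^esub> = \<zero>\<^bsub>V' i\<^esub>" "\<zero>\<^bsub>V' i\<^esub> \<oplus>\<^bsub>V' i\<^esub> \<zero>\<^bsub>V' i\<^esub> = \<zero>\<^bsub>V' i\<^esub>"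
      using that(2) by auto
  qed
  note z1 = z(1)[OF _ DS.R.zero_closed] and z3 = z(3)[OF _ DS.R.zero_closed]
  note dc = direct_sum_carrierD
  have E: "?E \<in> linear_maps K (direct_sum I V) (direct_sum I' V')"
  proof (rule linear_mapsI)
    fix f assume f: "f \<in> carrier (direct_sum I V)"
    show "?E f \<in> carrier (direct_sum I' V')"
      by (rule direct_sum_carrierI[OF _ dc(2)[OF f]])
        (use z1 h0 lin_closed[OF h dc(1)[OF f]] in auto)
  next
    fix f g assume f: "f \<in> carrier (direct_sum I V)" and g: "g \<in> carrier (direct_sum I V)"
    show "?E (f \<oplus>\<^bsub>direct_sum I V\<^esub> g) = ?E f \<oplus>\<^bsub>direct_sum I' V'\<^esub> ?E g"
      using dc(1)[OF f] dc(1)[OF g] z3 by (auto simp: direct_sum_sel fun_eq_iff lin_add[OF h])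
  next
    fix c f assume f: "f \<in> carrier (direct_sum I V)" and c: "c \<in> carrier K"
    show "?E (c \<odot>\<^bsub>direct_sum I V\<^esub> f) = c \<odot>\<^bsub>direct_sum I' V'\<^esub> ?E f"
      using c dc(1)[OF f] z(2)[OF _ c] by (auto simp: direct_sum_sel fun_eq_iff lin_smult[OF h])
  qed
  have Ein: "?E (direct_sum_in I V i x) = direct_sum_in I' V' i (h i x)" if "i \<in> I" "x \<in> carrier (V i)" for i x
    using that h0 sub by (auto simp: direct_sum_in_def fun_eq_iff)
  have rel: "?E (direct_sum_in I V i x) \<ominus>\<^bsub>direct_sum I' V'\<^esub> ?E (direct_sum_in I V j (t i j x))
      \<in> colim_rel K I' V' t'" if "i \<in> I" "j \<in> I" "i \<le> j" "x \<in> carrier (V i)" for i j x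
  proof -
    have "t i j x \<in> carrier (V j)" "h i x \<in> carrier (V' i)"
      using lin_closed[OF D.lin[OF that(1-3)]] lin_closed[OF h[OF that(1)]] that by auto
    then show ?thesis
      unfolding D'.colim_rel_eq using that sub
      by (intro lin_span_inc) (auto simp: Ein nat D'.gens_def)
  qed
  note cm = D.coset_map_colim[OF D'.DS D'.colim_rel_submodule E rel, folded colim_map_def colim_def[of K I' V' t']]
  show "colim_map K I I' V' t' h \<in> linear_maps K (colim K I V t) (colim K I' V' t')" by (rule cm(1))
  show "i \<in> I \<Longrightarrow> x \<in> carrier (V i) \<Longrightarrow>
      colim_map K I I' V' t' h (colim_in K I V t i x) = colim_in K I' V' t' i (h i x)"
    using cm(2) by (simp add: Ein colim_in_def)
qed

section \<open>Persistence modules\<close>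

abbreviation elts :: "('k, 'v) persmod \<Rightarrow> real \<Rightarrow> 'v set" where
  "elts M x \<equiv> carrier (sp M x)"

lemma
  assumes "persistence_module K M"
  shows pm_field: "field K" and pm_cring: "cring K"
    and pm_module: "module K (sp M x)"
    and pm_tr_linear: "x \<le> y \<Longrightarrow> tr M x y \<in> linear_maps K (sp M x) (sp M y)"
    and pm_tr_closed: "x \<le> y \<Longrightarrow> v \<in> elts M x \<Longrightarrow> tr M x y v \<in> elts M y"
    and pm_tr_id: "v \<in> elts M x \<Longrightarrow> tr M x x v = v"
    and pm_tr_comp: "x \<le> y \<Longrightarrow> y \<le> z \<Longrightarrow> v \<in> elts M x \<Longrightarrow> tr M y z (tr M x y v) = tr M x z v"
    and pm_tr_zero: "x \<le> y \<Longrightarrow> tr M x y \<zero>\<^bsub>sp M x\<^esub> = \<zero>\<^bsub>sp M y\<^esub>"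
proof -
  interpret persistence_module K M by fact
  show "field K" by (rule field_axioms)
  show "cring K" by (rule is_cring)
  show "module K (sp M x)" by (rule vector_space)
  show "x \<le> y \<Longrightarrow> tr M x y \<in> linear_maps K (sp M x) (sp M y)" by (rule tr_linear)
  then show "x \<le> y \<Longrightarrow> v \<in> elts M x \<Longrightarrow> tr M x y v \<in> elts M y"
    by (rule lin_closed)
  show "v \<in> elts M x \<Longrightarrow> tr M x x v = v" by (rule tr_id)
  show "x \<le> y \<Longrightarrow> y \<le> z \<Longrightarrow> v \<in> elts M x \<Longrightarrow> tr M y z (tr M x y v) = tr M x z v" by (rule tr_comp)
  show "x \<le> y \<Longrightarrow> tr M x y \<zero>\<^bsub>sp M x\<^esub> = \<zero>\<^bsub>sp M y\<^esub>"
    using lin_zero[OF vector_space vector_space tr_linear] .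
qed

lemma persistence_moduleI:
  assumes "field K" "\<And>x. module K (sp M x)"
    and "\<And>x y. x \<le> y \<Longrightarrow> tr M x y \<in> linear_maps K (sp M x) (sp M y)"
    and "\<And>x v. v \<in> elts M x \<Longrightarrow> tr M x x v = v"
    and "\<And>x y z v. x \<le> y \<Longrightarrow> y \<le> z \<Longrightarrow> v \<in> elts M x \<Longrightarrow> tr M y z (tr M x y v) = tr M x z v"
  shows "persistence_module K M"
  using assms unfolding persistence_module_def persistence_module_axioms_def by blast

lemma submodule_persistence_module:
  assumes M: "persistence_module K M" and Z: "\<And>x. submodule (Z x) K (sp M x)"
    and tr: "\<And>x y v. x \<le> y \<Longrightarrow> v \<in> Z x \<Longrightarrow> tr M x y v \<in> Z y"
  shows "persistence_module K \<lparr>sp = \<lambda>x. (sp M x)\<lparr>carrier := Z x\<rparr>, tr = tr M\<rparr>"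
proof (rule persistence_moduleI)
  note Zc = submodule_carrier[OF pm_module[OF M] Z]
  show "field K" by (rule pm_field[OF M])
  let ?M = "\<lparr>sp = \<lambda>x. (sp M x)\<lparr>carrier := Z x\<rparr>, tr = tr M\<rparr>"
  show "module K (sp ?M x)" for x
    using submodule.submodule_is_module[OF Z pm_module[OF M]] by simp
  show "tr ?M x y \<in> linear_maps K (sp ?M x) (sp ?M y)" if "x \<le> y" for x y
    using pm_tr_linear[OF M that] tr[OF that] Zc
    by (intro linear_mapsI) (auto simp: lin_add lin_smult)
qed (use submodule_carrier[OF pm_module[OF M] Z] in \<open>auto simp: pm_tr_id[OF M] pm_tr_comp[OF M]\<close>)

lemma nat_transI:
  assumes "\<And>x. \<phi> x \<in> linear_maps K (sp M x) (sp N x)"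
    and "\<And>x y v. x \<le> y \<Longrightarrow> v \<in> elts M x \<Longrightarrow> \<phi> y (tr M x y v) = tr N x y (\<phi> x v)"
  shows "\<phi> \<in> nat_trans K M N"
  using assms unfolding nat_trans_def by blast

lemma
  assumes "\<phi> \<in> nat_trans K M N"
  shows nat_trans_linear: "\<phi> x \<in> linear_maps K (sp M x) (sp N x)"
    and nat_trans_closed: "v \<in> elts M x \<Longrightarrow> \<phi> x v \<in> elts N x"
    and nat_trans_tr: "x \<le> y \<Longrightarrow> v \<in> elts M x \<Longrightarrow> \<phi> y (tr M x y v) = tr N x y (\<phi> x v)"
proof -
  show l: "\<phi> x \<in> linear_maps K (sp M x) (sp N x)" using assms unfolding nat_trans_def by simp
  show "v \<in> elts M x \<Longrightarrow> \<phi> x v \<in> elts N x" by (rule lin_closed[OF l])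
  show "x \<le> y \<Longrightarrow> v \<in> elts M x \<Longrightarrow> \<phi> y (tr M x y v) = tr N x y (\<phi> x v)"
    using assms unfolding nat_trans_def by blast
qed

lemma nat_trans_compose:
  assumes "\<phi> \<in> nat_trans K L M" "\<psi> \<in> nat_trans K M N"
  shows "(\<lambda>x v. \<psi> x (\<phi> x v)) \<in> nat_trans K L N"
  by (rule nat_transI, rule lin_compose[OF nat_trans_linear[OF assms(1)] nat_trans_linear[OF assms(2)]])
    (simp add: nat_trans_tr[OF assms(1)] nat_trans_tr[OF assms(2)] nat_trans_closed[OF assms(1)])

subsection \<open>Isomorphisms from linear relations\<close>

text \<open>The map picks a partner by choice; uniqueness of partners makes the choice inherit
  linearity and naturality from the relation.\<close>

lemma nat_trans_of_relation:
  fixes R :: "real \<Rightarrow> 'v \<Rightarrow> 'w \<Rightarrow> bool"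
  assumes X: "persistence_module K X"
    and sub: "\<And>x v w. R x v w \<Longrightarrow> v \<in> elts X x \<and> w \<in> elts Y x"
    and total: "\<And>x v. v \<in> elts X x \<Longrightarrow> \<exists>w. R x v w"
    and uniq: "\<And>x v w w'. R x v w \<Longrightarrow> R x v w' \<Longrightarrow> w = w'"
    and add: "\<And>x v w v' w'. R x v w \<Longrightarrow> R x v' w' \<Longrightarrow> R x (v \<oplus>\<^bsub>sp X x\<^esub> v') (w \<oplus>\<^bsub>sp Y x\<^esub> w')"
    and smult: "\<And>x c v w. c \<in> carrier K \<Longrightarrow> R x v w \<Longrightarrow> R x (c \<odot>\<^bsub>sp X x\<^esub> v) (c \<odot>\<^bsub>sp Y x\<^esub> w)"
    and nat: "\<And>x y v w. x \<le> y \<Longrightarrow> R x v w \<Longrightarrow> R y (tr X x y v) (tr Y x y w)"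
  shows "\<exists>\<phi>\<in>nat_trans K X Y. \<forall>x. \<forall>v\<in>elts X x. R x v (\<phi> x v)"
proof -
  define \<phi> where "\<phi> = (\<lambda>x v. SOME w. R x v w)"
  have R: "R x v (\<phi> x v)" if "v \<in> elts X x" for x v
    unfolding \<phi>_def using total[OF that] by (rule someI_ex)
  have "\<phi> \<in> nat_trans K X Y"
  proof (intro nat_transI linear_mapsI)
    fix x v u assume v: "v \<in> elts X x" and u: "u \<in> elts X x"
    note ad = add[OF R[OF v] R[OF u]]
    show "\<phi> x (v \<oplus>\<^bsub>sp X x\<^esub> u) = \<phi> x v \<oplus>\<^bsub>sp Y x\<^esub> \<phi> x u"
      using uniq[OF R ad] sub[OF ad] by blast
  next
    fix c x v assume v: "v \<in> elts X x" and c: "c \<in> carrier K"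
    note ad = smult[OF c R[OF v]]
    show "\<phi> x (c \<odot>\<^bsub>sp X x\<^esub> v) = c \<odot>\<^bsub>sp Y x\<^esub> \<phi> x v"
      using uniq[OF R ad] sub[OF ad] by blast
  next
    fix x y v assume v: "v \<in> elts X x" and xy: "x \<le> (y::real)"
    note ad = nat[OF xy R[OF v]]
    show "\<phi> y (tr X x y v) = tr Y x y (\<phi> x v)"
      using uniq[OF R ad] sub[OF ad] by blast
  qed (use R sub in blast)
  then show ?thesis using R by blast
qed

text \<open>A relation lets an isomorphism be described through representatives without choosing
  them. The assumptions are symmetric, so the relation gives one map and its converse the inverse;
  by linearity, uniqueness of partners only has to be checked at zero.\<close>

lemma pm_isomorphic_of_relation:
  fixes R :: "real \<Rightarrow> 'v \<Rightarrow> 'w \<Rightarrow> bool"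
  assumes X: "persistence_module K X" and Y: "persistence_module K Y"
    and sub: "\<And>x v w. R x v w \<Longrightarrow> v \<in> elts X x \<and> w \<in> elts Y x"
    and total: "\<And>x v. v \<in> elts X x \<Longrightarrow> \<exists>w. R x v w"
    and onto: "\<And>x w. w \<in> elts Y x \<Longrightarrow> \<exists>v. R x v w"
    and add: "\<And>x v w v' w'. R x v w \<Longrightarrow> R x v' w' \<Longrightarrow> R x (v \<oplus>\<^bsub>sp X x\<^esub> v') (w \<oplus>\<^bsub>sp Y x\<^esub> w')"
    and smult: "\<And>x c v w. c \<in> carrier K \<Longrightarrow> R x v w \<Longrightarrow> R x (c \<odot>\<^bsub>sp X x\<^esub> v) (c \<odot>\<^bsub>sp Y x\<^esub> w)"
    and nat: "\<And>x y v w. x \<le> y \<Longrightarrow> R x v w \<Longrightarrow> R y (tr X x y v) (tr Y x y w)"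
    and zero_r: "\<And>x v. R x v \<zero>\<^bsub>sp Y x\<^esub> \<Longrightarrow> v = \<zero>\<^bsub>sp X x\<^esub>"
    and zero_l: "\<And>x w. R x \<zero>\<^bsub>sp X x\<^esub> w \<Longrightarrow> w = \<zero>\<^bsub>sp Y x\<^esub>"
  shows "pm_isomorphic K X Y"
proof -
  \<comment> \<open>Subtraction is addition of the multiple by \<open>-1\<close>, so the relation is
    closed under it and two partners of one element can be compared through their
    difference.\<close>
  have diff: "R x (v \<ominus>\<^bsub>sp X x\<^esub> v') (w \<ominus>\<^bsub>sp Y x\<^esub> w')" if "R x v w" "R x v' w'" for x v w v' w'
  proof -
    interpret X: module K "sp X x" by (rule pm_module[OF X])
    have "R x ((\<ominus>\<^bsub>K\<^esub> \<one>\<^bsub>K\<^esub>) \<odot>\<^bsub>sp X x\<^esub> v') ((\<ominus>\<^bsub>K\<^esub> \<one>\<^bsub>K\<^esub>) \<odot>\<^bsub>sp Y x\<^esub> w')"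
      by (rule smult[OF _ that(2)]) auto
    then show ?thesis
      using add[OF that(1)] module_neg_eq[OF pm_module[OF X], of v' x] module_neg_eq[OF pm_module[OF Y], of w' x]
        sub[OF that(2)]
      by (simp add: a_minus_def)
  qed
  have ur: "w = w'" if "R x v w" "R x v w'" for x v w w'
  proof -
    interpret X: module K "sp X x" by (rule pm_module[OF X])
    have "w \<ominus>\<^bsub>sp Y x\<^esub> w' = \<zero>\<^bsub>sp Y x\<^esub>"
      using diff[OF that] sub[OF that(1)] by (intro zero_l) (simp add: a_minus_def X.M.r_neg)
    then show ?thesis
      using module_diff_eq_zero_iff[OF pm_module[OF Y]] sub[OF that(1)] sub[OF that(2)] by blast
  qed
  have ul: "v = v'" if "R x v w" "R x v' w" for x v v' w
  proof -
    interpret Y: module K "sp Y x" by (rule pm_module[OF Y])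
    have "v \<ominus>\<^bsub>sp X x\<^esub> v' = \<zero>\<^bsub>sp X x\<^esub>"
      using diff[OF that] sub[OF that(1)] by (intro zero_r) (simp add: a_minus_def Y.M.r_neg)
    then show ?thesis
      using module_diff_eq_zero_iff[OF pm_module[OF X]] sub[OF that(1)] sub[OF that(2)] by blast
  qed
  have "\<exists>\<phi>\<in>nat_trans K X Y. \<forall>x. \<forall>v\<in>elts X x. R x v (\<phi> x v)"
    by (rule nat_trans_of_relation[OF X]) (fact sub total ur add smult nat)+
  then obtain \<phi> where \<phi>: "\<phi> \<in> nat_trans K X Y" "\<And>x v. v \<in> elts X x \<Longrightarrow> R x v (\<phi> x v)"
    by blast
  have "\<exists>\<psi>\<in>nat_trans K Y X. \<forall>x. \<forall>w\<in>elts Y x. R x (\<psi> x w) w"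
    by (rule nat_trans_of_relation[OF Y, where R = "\<lambda>x w v. R x v w"])
      (use sub in blast, (fact onto ul add smult nat)+)
  then obtain \<psi> where \<psi>: "\<psi> \<in> nat_trans K Y X" "\<And>x w. w \<in> elts Y x \<Longrightarrow> R x (\<psi> x w) w"
    by blast
  have "\<psi> x (\<phi> x v) = v" if "v \<in> elts X x" for x v
    using ul[OF \<psi>(2) \<phi>(2)] nat_trans_closed[OF \<phi>(1)] that by blast
  moreover have "\<phi> x (\<psi> x w) = w" if "w \<in> elts Y x" for x w
    using ur[OF \<phi>(2) \<psi>(2)] nat_trans_closed[OF \<psi>(1)] that by blast
  ultimately show ?thesis
    unfolding pm_isomorphic_def using X Y \<phi>(1) \<psi>(1) by blast
qed

subsection \<open>Subquotients\<close>

locale subquotient_data =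
  fixes K :: "('k, 'm) ring_scheme" and C :: "('k, 'v) persmod" and Z B :: "real \<Rightarrow> 'v set"
  assumes C: "persistence_module K C"
    and Z: "\<And>x. submodule (Z x) K (sp C x)"
    and B: "\<And>x. submodule (B x) K (sp C x)"
    and B_Z: "\<And>x. B x \<subseteq> Z x"
    and tr_Z: "\<And>x y v. x \<le> y \<Longrightarrow> v \<in> Z x \<Longrightarrow> tr C x y v \<in> Z y"
    and tr_B: "\<And>x y v. x \<le> y \<Longrightarrow> v \<in> B x \<Longrightarrow> tr C x y v \<in> B y"
begin

abbreviation "VZ x \<equiv> (sp C x)\<lparr>carrier := Z x\<rparr>"
abbreviation "SQ \<equiv> subquotient C Z B"

lemma VZ: "module K (VZ x)"
  by (rule submodule.submodule_is_module[OF Z pm_module[OF C]])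

lemma B_VZ: "submodule (B x) K (VZ x)"
  using B[of x] B_Z[of x] unfolding submodule_iff[OF VZ] submodule_iff[OF pm_module[OF C]] by simp

text \<open>Cosets involve only the addition, which restricting the carrier to \<open>Z x\<close>
  leaves alone.\<close>

lemma coset_VZ: "B x +>\<^bsub>VZ x\<^esub> z = B x +>\<^bsub>sp C x\<^esub> z"
  by (simp add: a_r_coset_def')

lemma Z_closed: "z \<in> Z x \<Longrightarrow> z \<in> elts C x"
  using submodule_carrier[OF pm_module[OF C] Z] .

lemma sp_SQ: "sp SQ x = quot_module (VZ x) (B x)"
  and carrier_SQ: "elts SQ x = (\<lambda>z. B x +>\<^bsub>sp C x\<^esub> z) ` Z x"
  and zero_SQ: "\<zero>\<^bsub>sp SQ x\<^esub> = B x"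
  by (simp_all add: subquotient_def quot_module_sel coset_VZ)

lemma add_SQ: "u \<in> Z x \<Longrightarrow> v \<in> Z x \<Longrightarrow>
    (B x +>\<^bsub>sp C x\<^esub> u) \<oplus>\<^bsub>sp SQ x\<^esub> (B x +>\<^bsub>sp C x\<^esub> v) = B x +>\<^bsub>sp C x\<^esub> (u \<oplus>\<^bsub>sp C x\<^esub> v)"
  and smult_SQ: "c \<in> carrier K \<Longrightarrow> v \<in> Z x \<Longrightarrow>
    c \<odot>\<^bsub>sp SQ x\<^esub> (B x +>\<^bsub>sp C x\<^esub> v) = B x +>\<^bsub>sp C x\<^esub> (c \<odot>\<^bsub>sp C x\<^esub> v)"
  using quot_module_add[OF VZ B_VZ, of u x v] quot_module_smult[OF VZ B_VZ, of c v x]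
  by (simp_all add: coset_VZ sp_SQ)

lemma tr_VZ: "x \<le> y \<Longrightarrow> tr C x y \<in> linear_maps K (VZ x) (VZ y)"
  using pm_tr_linear[OF C, of x y]
  by (intro linear_mapsI) (auto simp: tr_Z Z_closed lin_add lin_smult)

lemma tr_SQ:
  assumes "x \<le> y" "z \<in> Z x"
  shows "tr SQ x y (B x +>\<^bsub>sp C x\<^esub> z) = B y +>\<^bsub>sp C y\<^esub> tr C x y z"
  using coset_map_linear_coset[OF VZ B_VZ VZ B_VZ tr_VZ[OF assms(1)] tr_B[OF assms(1)], of z] assms(2)
  by (simp add: subquotient_def coset_VZ coset_map_def)

lemma subquotient_persistence_module: "persistence_module K SQ"
proof (rule persistence_moduleI)
  show "field K" by (rule pm_field[OF C])
  show "module K (sp SQ x)" for x unfolding sp_SQ by (rule quot_module_module[OF VZ B_VZ])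
  show "tr SQ x y \<in> linear_maps K (sp SQ x) (sp SQ y)" if xy: "x \<le> y" for x y
    unfolding sp_SQ
    by (rule quot_module_linear_maps[OF VZ B_VZ lin_compose[OF tr_VZ[OF xy] coset_linear_maps[OF VZ B_VZ]]])
      (simp add: coset_VZ tr_SQ[OF xy])
  show "tr SQ x x X = X" if "X \<in> elts SQ x" for x X
    using that by (auto simp: carrier_SQ tr_SQ pm_tr_id[OF C] Z_closed)
  show "tr SQ y z (tr SQ x y X) = tr SQ x z X" if "x \<le> y" "y \<le> z" "X \<in> elts SQ x" for x y z X
    using that by (auto simp: carrier_SQ tr_SQ pm_tr_comp[OF C] Z_closed tr_Z)
qed

text \<open>The relation is given on cycles, where computations take place, and descends to cosets;
  \<open>zero_r\<close> and \<open>zero_l\<close> say that its kernel on the left is exactly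
  \<open>B\<close>.\<close>

lemma subquotient_isomorphic_of_relation:
  fixes R :: "real \<Rightarrow> 'v \<Rightarrow> 'w \<Rightarrow> bool"
  assumes Y: "persistence_module K Y"
    and sub: "\<And>x v w. R x v w \<Longrightarrow> v \<in> Z x \<and> w \<in> elts Y x"
    and total: "\<And>x v. v \<in> Z x \<Longrightarrow> \<exists>w. R x v w"
    and onto: "\<And>x w. w \<in> elts Y x \<Longrightarrow> \<exists>v. R x v w"
    and add: "\<And>x v w v' w'. R x v w \<Longrightarrow> R x v' w' \<Longrightarrow> R x (v \<oplus>\<^bsub>sp C x\<^esub> v') (w \<oplus>\<^bsub>sp Y x\<^esub> w')"
    and smult: "\<And>x c v w. c \<in> carrier K \<Longrightarrow> R x v w \<Longrightarrow> R x (c \<odot>\<^bsub>sp C x\<^esub> v) (c \<odot>\<^bsub>sp Y x\<^esub> w)"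
    and nat: "\<And>x y v w. x \<le> y \<Longrightarrow> R x v w \<Longrightarrow> R y (tr C x y v) (tr Y x y w)"
    and zero_r: "\<And>x v. R x v \<zero>\<^bsub>sp Y x\<^esub> \<Longrightarrow> v \<in> B x"
    and zero_l: "\<And>x v w. v \<in> B x \<Longrightarrow> R x v w \<Longrightarrow> w = \<zero>\<^bsub>sp Y x\<^esub>"
  shows "pm_isomorphic K SQ Y"
proof (rule pm_isomorphic_of_relation[OF subquotient_persistence_module Y,
      where R = "\<lambda>x X w. \<exists>z. X = B x +>\<^bsub>sp C x\<^esub> z \<and> R x z w"])
  note zi = coset_zero_iff[OF pm_module[OF C] B]
  show "X \<in> elts SQ x \<and> w \<in> elts Y x" if "\<exists>z. X = B x +>\<^bsub>sp C x\<^esub> z \<and> R x z w" for x X w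
    using that sub by (auto simp: carrier_SQ)
  show "\<exists>w z. X = B x +>\<^bsub>sp C x\<^esub> z \<and> R x z w" if "X \<in> elts SQ x" for x X
    using that total by (fastforce simp: carrier_SQ)
  show "\<exists>X z. X = B x +>\<^bsub>sp C x\<^esub> z \<and> R x z w" if "w \<in> elts Y x" for x w
    using onto[OF that] by blast
  show "\<exists>z. X \<oplus>\<^bsub>sp SQ x\<^esub> X' = B x +>\<^bsub>sp C x\<^esub> z \<and> R x z (w \<oplus>\<^bsub>sp Y x\<^esub> w')"
    if "\<exists>z. X = B x +>\<^bsub>sp C x\<^esub> z \<and> R x z w" "\<exists>z. X' = B x +>\<^bsub>sp C x\<^esub> z \<and> R x z w'" for x X w X' w'
    using that add sub by (metis add_SQ)
  show "\<exists>z. c \<odot>\<^bsub>sp SQ x\<^esub> X = B x +>\<^bsub>sp C x\<^esub> z \<and> R x z (c \<odot>\<^bsub>sp Y x\<^esub> w)"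
    if "c \<in> carrier K" "\<exists>z. X = B x +>\<^bsub>sp C x\<^esub> z \<and> R x z w" for x X w c
    using that smult sub by (metis smult_SQ)
  show "\<exists>z. tr SQ x y X = B y +>\<^bsub>sp C y\<^esub> z \<and> R y z (tr Y x y w)"
    if "x \<le> y" "\<exists>z. X = B x +>\<^bsub>sp C x\<^esub> z \<and> R x z w" for x y X w
    using that nat sub by (metis tr_SQ)
  show "X = \<zero>\<^bsub>sp SQ x\<^esub>" if "\<exists>z. X = B x +>\<^bsub>sp C x\<^esub> z \<and> R x z \<zero>\<^bsub>sp Y x\<^esub>" for x X
    using that zero_r sub Z_closed zi by (metis zero_SQ)
  show "w = \<zero>\<^bsub>sp Y x\<^esub>" if "\<exists>z. \<zero>\<^bsub>sp SQ x\<^esub> = B x +>\<^bsub>sp C x\<^esub> z \<and> R x z w" for x w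
    using that zero_l sub Z_closed zi by (metis zero_SQ)
qed

end

subsection \<open>Interval modules\<close>

lemma interval_sel:
  "elts (interval_module K I) x = (if x \<in> I then carrier K else {\<zero>\<^bsub>K\<^esub>})"
  "\<zero>\<^bsub>sp (interval_module K I) x\<^esub> = \<zero>\<^bsub>K\<^esub>"
  "u \<oplus>\<^bsub>sp (interval_module K I) x\<^esub> v = u \<oplus>\<^bsub>K\<^esub> v"
  "u \<odot>\<^bsub>sp (interval_module K I) x\<^esub> v = u \<otimes>\<^bsub>K\<^esub> v"
  "tr (interval_module K I) x y v = (if x \<in> I \<and> y \<in> I then v else \<zero>\<^bsub>K\<^esub>)"
  by (simp_all add: interval_module_def self_module_def)

lemma interval_module_persistence_module:
  assumes "field K" and conv: "\<And>x y z. x \<in> I \<Longrightarrow> z \<in> I \<Longrightarrow> x \<le> y \<Longrightarrow> y \<le> z \<Longrightarrow> y \<in> I"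
  shows "persistence_module K (interval_module K I)"
proof (rule persistence_moduleI)
  interpret K: field K by fact
  let ?M = "interval_module K I"
  show "field K" by fact
  show "module K (sp ?M x)" for x
  proof -
    have "sp ?M x = (self_module K)\<lparr>carrier := if x \<in> I then carrier K else {\<zero>\<^bsub>K\<^esub>}\<rparr>"
      by (simp add: interval_module_def)
    moreover have "submodule (if x \<in> I then carrier K else {\<zero>\<^bsub>K\<^esub>}) K (self_module K)"
      unfolding submodule_iff[OF self_module_module[OF K.is_cring]] by (auto simp: self_module_sel)
    ultimately show ?thesis
      using submodule.submodule_is_module self_module_module[OF K.is_cring] by metis
  qed
  show "tr ?M x y \<in> linear_maps K (sp ?M x) (sp ?M y)" for x y
    by (rule linear_mapsI) (auto simp: interval_sel)
  show "tr ?M x x v = v" if "v \<in> elts ?M x" for x v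
    using that by (auto simp: interval_sel split: if_splits)
  \<comment> \<open>Convexity enters here: if \<open>x\<close> and \<open>z\<close> lie in
    \<open>I\<close>, so does \<open>y\<close>, and the composite does not pass through a zero
    space.\<close>
  show "tr ?M y z (tr ?M x y v) = tr ?M x z v" if "x \<le> y" "y \<le> z" "v \<in> elts ?M x" for x y z v
    using that conv[of x z y] by (auto simp: interval_sel)
qed

section \<open>The graded tensor product\<close>

text \<open>The class in total degree \<open>r\<close> of \<open>m \<otimes> n\<close>, for
  \<open>m\<close> of degree \<open>s\<close>, \<open>n\<close> of degree \<open>t\<close> and
  \<open>s + t \<le> r\<close>. Computations with the graded tensor product are reduced to these
  classes, which hide the colimit and the free modules beneath it.\<close>

definition gtensor_elem ::
  "('k, 'm) ring_scheme \<Rightarrow> ('k, 'v) persmod \<Rightarrow> ('k, 'w) persmod \<Rightarrow> real \<Rightarrow> real \<Rightarrow> real \<Rightarrow> 'v \<Rightarrow> 'w \<Rightarrow>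
   (real \<times> real \<Rightarrow> ('v \<times> 'w \<Rightarrow> 'k) set) set" where
  "gtensor_elem K M N r s t m n =
    colim_in K (gtensor_index r) (gtensor_sp K M N) (gtensor_tr K M N) (s, t)
      (pure_tensor K (sp M s) (sp N t) m n)"

lemma sp_gtensor: "sp (gtensor K M N) r = colim K (gtensor_index r) (gtensor_sp K M N) (gtensor_tr K M N)"
  by (simp add: gtensor_def)

context
  fixes K :: "('k, 'm) ring_scheme" and M :: "('k, 'v) persmod" and N :: "('k, 'w) persmod"
  assumes M: "persistence_module K M" and N: "persistence_module K N"
begin

private abbreviation (input) "\<iota> r \<equiv> colim_in K (gtensor_index r) (gtensor_sp K M N) (gtensor_tr K M N)"

lemma gtensor_diagram: "diagram K (gtensor_index r) (gtensor_sp K M N) (gtensor_tr K M N)"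
proof (rule diagram.intro)
  show "cring K" by (rule pm_cring[OF M])
  show "module K (gtensor_sp K M N i)" for i
    by (cases i) (simp add: gtensor_sp_def tensor_module pm_module M N)
  show "gtensor_tr K M N i j \<in> linear_maps K (gtensor_sp K M N i) (gtensor_sp K M N j)" if "i \<le> j" for i j
    using that
    by (cases i; cases j)
      (auto simp: gtensor_sp_def gtensor_tr_def intro!: tensor_map_linear pm_module pm_tr_linear M N)
qed

lemma gtensor_module: "module K (sp (gtensor K M N) r)"
  unfolding sp_gtensor by (rule diagram.colim_module[OF gtensor_diagram])

lemma gtensor_elem_bilinear:
  assumes "s + t \<le> r"
  shows "gtensor_elem K M N r s t \<in> bilinear_maps K (sp M s) (sp N t) (sp (gtensor K M N) r)"
  unfolding gtensor_elem_def sp_gtensor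
  using diagram.colim_in_linear[OF gtensor_diagram, of "(s, t)" r] assms
  by (intro bilinear_maps_linear_compose[OF pure_tensor_bilinear[OF pm_module[OF M] pm_module[OF N]]])
    (simp add: gtensor_index_def gtensor_sp_def)

lemma gtensor_elem_closed:
  "s + t \<le> r \<Longrightarrow> m \<in> elts M s \<Longrightarrow> n \<in> elts N t \<Longrightarrow>
    gtensor_elem K M N r s t m n \<in> elts (gtensor K M N) r"
  by (rule bilinear_maps_closed[OF gtensor_elem_bilinear])

text \<open>This plays the part of the balancing relation of a tensor product over
  \<open>k[U_0]\<close>: by comparison with \<open>(s, t)\<close>, a shift can be moved from one
  factor to the other.\<close>

lemma gtensor_elem_compat:
  assumes "s \<le> s'" "t \<le> t'" "s' + t' \<le> r" "m \<in> elts M s" "n \<in> elts N t"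
  shows "gtensor_elem K M N r s' t' (tr M s s' m) (tr N t t' n) = gtensor_elem K M N r s t m n"
proof -
  let ?p = "pure_tensor K (sp M s) (sp N t) m n"
  have "?p \<in> carrier (tensor K (sp M s) (sp N t))"
    using bilinear_maps_closed[OF pure_tensor_bilinear[OF pm_module[OF M] pm_module[OF N]]] assms(4,5) .
  then have "\<iota> r (s', t')
      (gtensor_tr K M N (s, t) (s', t') ?p) = gtensor_elem K M N r s t m n"
    unfolding gtensor_elem_def using assms(1-3)
    by (intro diagram.colim_in_compat[OF gtensor_diagram]) (auto simp: gtensor_index_def gtensor_sp_def)
  then show ?thesis
    using assms
    by (simp add: gtensor_elem_def gtensor_tr_def tensor_map_pure pm_module[OF M] pm_module[OF N]
        pm_tr_linear[OF M] pm_tr_linear[OF N])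
qed

lemma gtensor_maps_ext:
  assumes "module K U" "f \<in> linear_maps K (sp (gtensor K M N) r) U" "g \<in> linear_maps K (sp (gtensor K M N) r) U"
    and eq: "\<And>s t m n. s + t \<le> r \<Longrightarrow> m \<in> elts M s \<Longrightarrow> n \<in> elts N t \<Longrightarrow>
      f (gtensor_elem K M N r s t m n) = g (gtensor_elem K M N r s t m n)"
    and "X \<in> elts (gtensor K M N) r"
  shows "f X = g X"
proof (rule diagram.colim_maps_ext[OF gtensor_diagram assms(1), folded sp_gtensor])
  fix i x assume i: "i \<in> gtensor_index r" and x: "x \<in> carrier (gtensor_sp K M N i)"
  obtain s t where st: "i = (s, t)" by fastforce
  note li = diagram.colim_in_linear[OF gtensor_diagram i, unfolded st gtensor_sp_def prod.case,
      folded sp_gtensor[unfolded gtensor_sp_def]]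
  have "f (\<iota> r (s, t) x)
      = g (\<iota> r (s, t) x)"
    by (rule tensor_maps_ext[OF pm_module[OF M] pm_module[OF N] assms(1)
          lin_compose[OF li assms(2)[folded gtensor_sp_def], folded gtensor_sp_def]
          lin_compose[OF li assms(3)[folded gtensor_sp_def], folded gtensor_sp_def]])
      (use i x eq st in \<open>auto simp: gtensor_index_def gtensor_sp_def gtensor_elem_def\<close>)
  then show "f (\<iota> r i x)
      = g (\<iota> r i x)" using st by simp
qed (use assms in auto)

lemma gtensor_desc:
  fixes U :: "('k, 'u) module"
  assumes U: "module K U"
    and \<beta>: "\<And>s t. s + t \<le> r \<Longrightarrow> \<beta> s t \<in> bilinear_maps K (sp M s) (sp N t) U"
    and comp: "\<And>s t s' t' m n. s \<le> s' \<Longrightarrow> t \<le> t' \<Longrightarrow> s' + t' \<le> r \<Longrightarrow> m \<in> elts M s \<Longrightarrow>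
      n \<in> elts N t \<Longrightarrow> \<beta> s' t' (tr M s s' m) (tr N t t' n) = \<beta> s t m n"
  shows "\<exists>L\<in>linear_maps K (sp (gtensor K M N) r) U. \<forall>s t. \<forall>m\<in>elts M s. \<forall>n\<in>elts N t.
    s + t \<le> r \<longrightarrow> L (gtensor_elem K M N r s t m n) = \<beta> s t m n"
proof -
  \<comment> \<open>Each \<open>\<beta> s t\<close> is lifted to the tensor product at
    \<open>(s, t)\<close>; agreement along the diagram is then tested on pure tensors.\<close>
  define \<phi> where "\<phi> = (\<lambda>(s, t). tensor_lift K (sp M s) (sp N t) U (\<beta> s t))"
  have tl: "\<phi> (s, t) \<in> linear_maps K (tensor K (sp M s) (sp N t)) U" if "s + t \<le> r" for s t
    unfolding \<phi>_def using tensor_lift_linear[OF pm_module[OF M] pm_module[OF N] U \<beta>[OF that]] by simp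
  have tp: "\<phi> (s, t) (pure_tensor K (sp M s) (sp N t) m n) = \<beta> s t m n"
    if "s + t \<le> r" "m \<in> elts M s" "n \<in> elts N t" for s t m n
    unfolding \<phi>_def using tensor_lift_pure[OF pm_module[OF M] pm_module[OF N] U \<beta>[OF that(1)] that(2,3)] by simp
  have nat: "\<phi> (s', t') (gtensor_tr K M N (s, t) (s', t') x) = \<phi> (s, t) x"
    if "s \<le> s'" "t \<le> t'" "s' + t' \<le> r" "x \<in> carrier (tensor K (sp M s) (sp N t))" for s t s' t' x
  proof (rule tensor_maps_ext[OF pm_module[OF M] pm_module[OF N] U _ _ _ that(4)])
    have st: "s + t \<le> r" using that(1-3) by linarith
    show "\<phi> (s, t) \<in> linear_maps K (tensor K (sp M s) (sp N t)) U" by (rule tl[OF st])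
    show "(\<lambda>x. \<phi> (s', t') (gtensor_tr K M N (s, t) (s', t') x)) \<in> linear_maps K (tensor K (sp M s) (sp N t)) U"
      unfolding gtensor_tr_def prod.case
      by (intro lin_compose[OF tensor_map_linear tl] pm_module pm_tr_linear M N that)
    show "\<phi> (s', t') (gtensor_tr K M N (s, t) (s', t') (pure_tensor K (sp M s) (sp N t) v w)) =
        \<phi> (s, t) (pure_tensor K (sp M s) (sp N t) v w)" if "v \<in> elts M s" "w \<in> elts N t" for v w
      using that \<open>s \<le> s'\<close> \<open>t \<le> t'\<close> \<open>s' + t' \<le> r\<close> st
      by (simp add: gtensor_tr_def tensor_map_pure pm_module[OF M] pm_module[OF N]
        pm_tr_linear[OF M] pm_tr_linear[OF N] tp pm_tr_closed[OF M] pm_tr_closed[OF N] comp)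
  qed
  have "\<exists>L\<in>linear_maps K (sp (gtensor K M N) r) U. \<forall>i\<in>gtensor_index r. \<forall>x\<in>carrier (gtensor_sp K M N i).
      L (\<iota> r i x) = \<phi> i x"
    unfolding sp_gtensor
    by (rule diagram.colim_desc[OF gtensor_diagram U])
      (auto simp: gtensor_index_def gtensor_sp_def tl nat)
  then obtain L where L: "L \<in> linear_maps K (sp (gtensor K M N) r) U" "\<And>s t x. s + t \<le> r \<Longrightarrow>
      x \<in> carrier (tensor K (sp M s) (sp N t)) \<Longrightarrow>
      L (\<iota> r (s, t) x) = \<phi> (s, t) x"
    by (auto simp: gtensor_index_def gtensor_sp_def)
  show ?thesis
    by (rule bexI[OF _ L(1)])
      (auto simp: gtensor_elem_def L(2) tp
        bilinear_maps_closed[OF pure_tensor_bilinear[OF pm_module[OF M] pm_module[OF N]]])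
qed

lemma
  assumes "r \<le> r'"
  shows gtensor_tr_linear: "tr (gtensor K M N) r r' \<in> linear_maps K (sp (gtensor K M N) r) (sp (gtensor K M N) r')"
    and gtensor_tr_elem: "s + t \<le> r \<Longrightarrow> m \<in> elts M s \<Longrightarrow> n \<in> elts N t \<Longrightarrow>
      tr (gtensor K M N) r r' (gtensor_elem K M N r s t m n) = gtensor_elem K M N r' s t m n"
proof -
  have sub: "gtensor_index r \<subseteq> gtensor_index r'" using assms by (auto simp: gtensor_index_def)
  have t: "tr (gtensor K M N) r r' = colim_map K (gtensor_index r) (gtensor_index r')
       (gtensor_sp K M N) (gtensor_tr K M N) (\<lambda>_ x. x)" by (simp add: gtensor_def)
  show "tr (gtensor K M N) r r' \<in> linear_maps K (sp (gtensor K M N) r) (sp (gtensor K M N) r')"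
    unfolding t sp_gtensor
    by (rule colim_map_linear[OF gtensor_diagram gtensor_diagram sub lin_id]) simp
  show "s + t \<le> r \<Longrightarrow> m \<in> elts M s \<Longrightarrow> n \<in> elts N t \<Longrightarrow>
      tr (gtensor K M N) r r' (gtensor_elem K M N r s t m n) = gtensor_elem K M N r' s t m n"
    unfolding t gtensor_elem_def
    by (rule colim_map_in[OF gtensor_diagram gtensor_diagram sub lin_id])
      (auto simp: gtensor_index_def gtensor_sp_def
        bilinear_maps_closed[OF pure_tensor_bilinear[OF pm_module[OF M] pm_module[OF N]]])
qed

lemma gtensor_persistence_module: "persistence_module K (gtensor K M N)"
proof (rule persistence_moduleI)
  let ?T = "gtensor K M N"
  show "field K" by (rule pm_field[OF M])
  show "module K (sp ?T x)" for x by (rule gtensor_module)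
  show "x \<le> y \<Longrightarrow> tr ?T x y \<in> linear_maps K (sp ?T x) (sp ?T y)" for x y by (rule gtensor_tr_linear)
  show "tr ?T x x X = X" if "X \<in> elts ?T x" for x X
    by (rule gtensor_maps_ext[OF gtensor_module gtensor_tr_linear lin_id _ that]) (auto simp: gtensor_tr_elem)
  show "tr ?T y z (tr ?T x y X) = tr ?T x z X" if "x \<le> y" "y \<le> z" "X \<in> elts ?T x" for x y z X
    by (rule gtensor_maps_ext[OF gtensor_module lin_compose[OF gtensor_tr_linear gtensor_tr_linear]
          gtensor_tr_linear _ that(3)])
      (use that in \<open>auto simp: gtensor_tr_elem\<close>)
qed

end

lemma
  assumes M: "persistence_module K M" and M': "persistence_module K M'" and N: "persistence_module K N"
    and f: "f \<in> nat_trans K M M'"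
  shows gtensor_map_linear: "gtensor_map K M M' N f r \<in> linear_maps K (sp (gtensor K M N) r) (sp (gtensor K M' N) r)"
    and gtensor_map_elem: "s + t \<le> r \<Longrightarrow> m \<in> elts M s \<Longrightarrow> n \<in> elts N t \<Longrightarrow>
      gtensor_map K M M' N f r (gtensor_elem K M N r s t m n) = gtensor_elem K M' N r s t (f s m) n"
proof -
  let ?h = "\<lambda>(s, t). tensor_map K (sp M s) (sp N t) (sp M' s) (sp N t) (f s) (\<lambda>w. w)"
  note m = pm_module[OF M] pm_module[OF M'] pm_module[OF N]
  have hl: "?h i \<in> linear_maps K (gtensor_sp K M N i) (gtensor_sp K M' N i)" for i
    by (cases i) (auto simp: gtensor_sp_def intro!: tensor_map_linear m lin_id nat_trans_linear[OF f])
  have hn: "?h j (gtensor_tr K M N i j x) = gtensor_tr K M' N i j (?h i x)"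
    if "i \<le> j" "x \<in> carrier (gtensor_sp K M N i)" for i j x
  proof -
    obtain s t s' t' where ij: "i = (s, t)" "j = (s', t')" by fastforce
    then have le: "s \<le> s'" "t \<le> t'" using that(1) by auto
    show ?thesis
      unfolding ij gtensor_tr_def prod.case
      by (rule tensor_maps_ext[OF m(1) m(3) tensor_module[OF m(2,3)] lin_compose lin_compose,
            OF tensor_map_linear tensor_map_linear tensor_map_linear tensor_map_linear])
        (use that(2) le in \<open>auto simp: m ij gtensor_sp_def pm_tr_linear[OF M] pm_tr_linear[OF N] pm_tr_linear[OF M']
          nat_trans_linear[OF f] lin_id tensor_map_pure pm_tr_closed[OF M] pm_tr_closed[OF N]
          nat_trans_closed[OF f] nat_trans_tr[OF f]\<close>)
  qed
  show "gtensor_map K M M' N f r \<in> linear_maps K (sp (gtensor K M N) r) (sp (gtensor K M' N) r)"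
    unfolding gtensor_map_def sp_gtensor
    by (rule colim_map_linear[OF gtensor_diagram[OF M N] gtensor_diagram[OF M' N] subset_refl hl hn])
  show "s + t \<le> r \<Longrightarrow> m \<in> elts M s \<Longrightarrow> n \<in> elts N t \<Longrightarrow>
      gtensor_map K M M' N f r (gtensor_elem K M N r s t m n) = gtensor_elem K M' N r s t (f s m) n"
    unfolding gtensor_map_def gtensor_elem_def
    by (subst colim_map_in[OF gtensor_diagram[OF M N] gtensor_diagram[OF M' N] subset_refl hl hn])
      (auto simp: gtensor_index_def gtensor_sp_def tensor_map_pure m lin_id nat_trans_linear[OF f]
        bilinear_maps_closed[OF pure_tensor_bilinear[OF m(1,3)]])
qed

text \<open>The quotient map by \<open>T\<close> and the zero map agree on the classes
  \<open>gtensor_elem\<close>, hence everywhere, so every element lies in \<open>T\<close>.\<close>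

lemma gtensor_generated:
  assumes M: "persistence_module K M" and N: "persistence_module K N"
    and T: "submodule T K (sp (gtensor K M N) r)"
    and gen: "\<And>s t m n. s + t \<le> r \<Longrightarrow> m \<in> elts M s \<Longrightarrow> n \<in> elts N t \<Longrightarrow>
      gtensor_elem K M N r s t m n \<in> T"
    and X: "X \<in> elts (gtensor K M N) r"
  shows "X \<in> T"
proof -
  let ?G = "sp (gtensor K M N) r"
  note G = gtensor_module[OF M N, of r]
  note Q = quot_module_module[OF G T]
  have "T +>\<^bsub>?G\<^esub> X = \<zero>\<^bsub>quot_module ?G T\<^esub>"
    by (rule gtensor_maps_ext[OF M N Q coset_linear_maps[OF G T] lin_const_zero[OF G Q] _ X])
      (simp add: quot_module_sel coset_zero_iff[OF G T] gtensor_elem_closed[OF M N] gen)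
  then show ?thesis by (simp add: quot_module_sel coset_zero_iff[OF G T X])
qed

subsection \<open>Tensoring with a bounded interval module\<close>

text \<open>\<open>m\<close> tensored with the generator of \<open>k[c,d)\<close>. Since the
  generator has degree \<open>c\<close> and \<open>m\<close> has degree \<open>r - c\<close>, the
  total degree is exactly \<open>r\<close>.\<close>

definition shift_elem ::
  "('k, 'm) ring_scheme \<Rightarrow> ('k, 'v) persmod \<Rightarrow> real \<Rightarrow> real \<Rightarrow> real \<Rightarrow> 'v \<Rightarrow>
   (real \<times> real \<Rightarrow> ('v \<times> 'k \<Rightarrow> 'k) set) set" where
  "shift_elem K M c d r m = gtensor_elem K M (interval_module K {c..<d}) r (r - c) c m \<one>\<^bsub>K\<^esub>"

lemma bounded_interval_pm: "field K \<Longrightarrow> persistence_module K (interval_module K {c..<d})"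
  by (rule interval_module_persistence_module) auto

lemma unbounded_interval_pm: "field K \<Longrightarrow> persistence_module K (interval_module K {c..})"
  by (rule interval_module_persistence_module) auto

context
  fixes K :: "('k, 'm) ring_scheme" and M :: "('k, 'v) persmod" and c d :: real
  assumes M: "persistence_module K M" and cd: "c < d"
begin

interpretation K: field K by (rule pm_field[OF M])

private abbreviation (input) "N \<equiv> interval_module K {c..<d}"
private abbreviation (input) "G r \<equiv> sp (gtensor K M N) r"
private abbreviation (input) "\<sigma> r m \<equiv> shift_elem K M c d r m"

private lemma N: "persistence_module K N"
  by (rule bounded_interval_pm[OF pm_field[OF M]])

private lemma one_N: "\<one>\<^bsub>K\<^esub> \<in> elts N c"
  using cd by (simp add: interval_sel)

lemma shift_elem_linear: "shift_elem K M c d r \<in> linear_maps K (sp M (r - c)) (G r)"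
  unfolding shift_elem_def
  using bilinear_mapsD(2)[OF gtensor_elem_bilinear[OF M N, of "r - c" c r] one_N] by simp

lemma shift_elem_tr:
  assumes "r \<le> r'" "m \<in> elts M (r - c)"
  shows "tr (gtensor K M N) r r' (\<sigma> r m) = \<sigma> r' (tr M (r - c) (r' - c) m)"
proof -
  have "tr (gtensor K M N) r r' (\<sigma> r m) = gtensor_elem K M N r' (r - c) c m \<one>\<^bsub>K\<^esub>"
    unfolding shift_elem_def by (rule gtensor_tr_elem[OF M N]) (use assms one_N in auto)
  also have "\<dots> = gtensor_elem K M N r' (r' - c) c (tr M (r - c) (r' - c) m) (tr N c c \<one>\<^bsub>K\<^esub>)"
    by (rule gtensor_elem_compat[OF M N, symmetric]) (use assms one_N in auto)
  finally show ?thesis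
    using pm_tr_id[OF N one_N] by (simp add: shift_elem_def)
qed

lemma gtensor_map_shift_elem:
  assumes "persistence_module K M'" "f \<in> nat_trans K M M'" "m \<in> elts M (r - c)"
  shows "gtensor_map K M M' N f r (\<sigma> r m) = shift_elem K M' c d r (f (r - c) m)"
  unfolding shift_elem_def
  by (rule gtensor_map_elem[OF M assms(1) N assms(2)]) (use assms(3) one_N in auto)

private lemma elem_zero:
  assumes "s + t \<le> r" "m \<in> elts M s"
  shows "gtensor_elem K M N r s t m \<zero>\<^bsub>K\<^esub> = \<zero>\<^bsub>G r\<^esub>"
  using lin_zero[OF pm_module[OF N] gtensor_module[OF M N]
      bilinear_mapsD(1)[OF gtensor_elem_bilinear[OF M N assms(1)] assms(2)]]
  by (simp add: interval_sel)

text \<open>\<open>k[c,d)\<close> is generated in degree \<open>c\<close>: in a class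
  \<open>m \<otimes> n\<close> the second factor can be moved down to degree \<open>c\<close>, after
  which the first can be moved up to degree \<open>r - c\<close>, and the scalar \<open>n\<close> is
  pulled out.\<close>

lemma shift_elem_surj:
  assumes "X \<in> carrier (G r)"
  shows "\<exists>m\<in>elts M (r - c). X = \<sigma> r m"
proof -
  note S = submodule_image[OF pm_module[OF M] gtensor_module[OF M N] shift_elem_linear[of r]]
  have "X \<in> shift_elem K M c d r ` elts M (r - c)"
  proof (rule gtensor_generated[OF M N S _ assms])
    fix s t m n assume st: "s + t \<le> r" and m: "m \<in> elts M s" and n: "n \<in> elts N t"
    show "gtensor_elem K M N r s t m n \<in> shift_elem K M c d r ` elts M (r - c)"
    proof (cases "t \<in> {c..<d}")
      case False
      then have "n = \<zero>\<^bsub>K\<^esub>" using n by (simp add: interval_sel split: if_splits)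
      then show ?thesis
        using elem_zero[OF st m] submodule_zero[OF gtensor_module[OF M N] S] by simp
    next
      case True
      then have nK: "n \<in> carrier K" and t: "c \<le> t" and n': "n \<in> elts N c"
        using n cd by (auto simp: interval_sel)
      have "gtensor_elem K M N r s t m n = gtensor_elem K M N r s t (tr M s s m) (tr N c t n)"
        using True cd pm_tr_id[OF M m] by (simp add: interval_sel)
      also have "\<dots> = gtensor_elem K M N r s c m n"
        by (rule gtensor_elem_compat[OF M N _ t st m n']) simp
      also have "\<dots> = gtensor_elem K M N r (r - c) c (tr M s (r - c) m) (tr N c c n)"
        by (rule gtensor_elem_compat[OF M N _ _ _ m n', symmetric]) (use t st in auto)
      also have "tr N c c n = n \<odot>\<^bsub>sp N c\<^esub> \<one>\<^bsub>K\<^esub>"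
        using pm_tr_id[OF N n'] nK by (simp add: interval_sel(4))
      also have "gtensor_elem K M N r (r - c) c (tr M s (r - c) m) \<dots> = n \<odot>\<^bsub>G r\<^esub> \<sigma> r (tr M s (r - c) m)"
        unfolding shift_elem_def
        by (rule lin_smult[OF bilinear_mapsD(1)[OF gtensor_elem_bilinear[OF M N]] nK one_N])
          (use t st in \<open>auto intro!: pm_tr_closed[OF M] m\<close>)
      finally show ?thesis
        using submodule_smult[OF gtensor_module[OF M N] S nK] pm_tr_closed[OF M _ m, of "r - c"] t st by auto
    qed
  qed
  then show ?thesis by blast
qed

text \<open>The transition from \<open>r - d\<close> to \<open>r - c\<close> has length
  \<open>d - c\<close>. Moved onto the generator it carries it to degree \<open>d\<close>, the first
  degree in which the half-open interval is zero.\<close>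

lemma shift_elem_tr_zero:
  assumes "m \<in> elts M (r - d)"
  shows "\<sigma> r (tr M (r - d) (r - c) m) = \<zero>\<^bsub>G r\<^esub>"
proof -
  have "\<sigma> r (tr M (r - d) (r - c) m)
      = gtensor_elem K M N r (r - c) c (tr M (r - d) (r - c) m) (tr N c c \<one>\<^bsub>K\<^esub>)"
    using pm_tr_id[OF N one_N] by (simp add: shift_elem_def)
  also have "\<dots> = gtensor_elem K M N r (r - d) c m \<one>\<^bsub>K\<^esub>"
    by (rule gtensor_elem_compat[OF M N]) (use assms one_N cd in auto)
  also have "\<dots> = gtensor_elem K M N r (r - d) d (tr M (r - d) (r - d) m) (tr N c d \<one>\<^bsub>K\<^esub>)"
    by (rule gtensor_elem_compat[OF M N, symmetric]) (use assms one_N cd in auto)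
  also have "\<dots> = \<zero>\<^bsub>G r\<^esub>"
    using elem_zero[of "r - d" d r m] assms pm_tr_id[OF M assms] by (simp add: interval_sel(5))
  finally show ?thesis .
qed

text \<open>The kernel is found by the map of the tensor product to \<open>M (r - c) / tr (M (r - d))\<close> which
  sends \<open>m \<otimes> n\<close> to the class of \<open>n m\<close>.\<close>

lemma shift_elem_zero_iff:
  assumes m: "m \<in> elts M (r - c)"
  shows "\<sigma> r m = \<zero>\<^bsub>G r\<^esub> \<longleftrightarrow> m \<in> tr M (r - d) (r - c) ` elts M (r - d)"
proof
  assume z: "\<sigma> r m = \<zero>\<^bsub>G r\<^esub>"
  define V where "V = sp M (r - c)"
  define H where "H = tr M (r - d) (r - c) ` elts M (r - d)"
  define U where "U = quot_module V H"
  have V: "module K V" unfolding V_def by (rule pm_module[OF M])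
  have H: "submodule H K V"
    unfolding H_def V_def
    by (rule submodule_image[OF pm_module[OF M] pm_module[OF M] pm_tr_linear[OF M]]) (use cd in simp)
  have U: "module K U" unfolding U_def by (rule quot_module_module[OF V H])
  interpret U: module K U by (rule U)
  have zeroU: "\<zero>\<^bsub>U\<^esub> = H" by (simp add: U_def quot_module_sel)
  have cl: "H +>\<^bsub>V\<^esub> v \<in> carrier U" if "v \<in> carrier V" for v using that by (simp add: U_def coset_closed)
  have lin: "(\<lambda>m. H +>\<^bsub>V\<^esub> tr M s (r - c) m) \<in> linear_maps K (sp M s) U" if "s \<le> r - c" for s
    unfolding U_def
    by (rule lin_compose[OF _ coset_linear_maps[OF V H]]) (use pm_tr_linear[OF M that] V_def in simp)
  \<comment> \<open>Outside \<open>{c..<d}\<close> the scalar \<open>n\<close> is zero, which forces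
    the value zero. Inside, \<open>t \<ge> c\<close> gives \<open>s \<le> r - c\<close>, so the
    transition map is available.\<close>
  define \<beta> where "\<beta> = (\<lambda>s t m n. if t \<in> {c..<d} then n \<odot>\<^bsub>U\<^esub> (H +>\<^bsub>V\<^esub> tr M s (r - c) m) else \<zero>\<^bsub>U\<^esub>)"
  have bil: "\<beta> s t \<in> bilinear_maps K (sp M s) (sp N t) U" if st: "s + t \<le> r" for s t
  proof (cases "t \<in> {c..<d}")
    case False
    then show ?thesis
      unfolding \<beta>_def by (intro bilinear_mapsI) (auto intro!: lin_const_zero pm_module M N U)
  next
    case True
    then have s: "s \<le> r - c" using st by auto
    show ?thesis
    proof (rule bilinear_mapsI)
      fix v assume "v \<in> elts M s"
      then have "H +>\<^bsub>V\<^esub> tr M s (r - c) v \<in> carrier U" by (rule lin_closed[OF lin[OF s]])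
      then show "\<beta> s t v \<in> linear_maps K (sp N t) U"
        unfolding \<beta>_def using True
        by (intro linear_mapsI) (auto simp: interval_sel U.smult_l_distr U.smult_assoc1)
    next
      fix w assume "w \<in> elts N t"
      then have w: "w \<in> carrier K" using True by (simp add: interval_sel)
      show "(\<lambda>v. \<beta> s t v w) \<in> linear_maps K (sp M s) U"
        unfolding \<beta>_def using True lin_compose[OF lin[OF s] smult_linear_maps[OF U w]] by simp
    qed
  qed
  have comp: "\<beta> s' t' (tr M s s' m) (tr N t t' n) = \<beta> s t m n"
    if le: "s \<le> s'" "t \<le> t'" "s' + t' \<le> r" and m: "m \<in> elts M s" and n: "n \<in> elts N t"
    for s t s' t' m n
  proof (cases "t \<in> {c..<d}")
    case False
    then have n0: "n = \<zero>\<^bsub>K\<^esub>" using n by (simp add: interval_sel split: if_splits)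
    show ?thesis
    proof (cases "t' \<in> {c..<d}")
      case True
      have "H +>\<^bsub>V\<^esub> tr M s' (r - c) (tr M s s' m) \<in> carrier U"
        by (rule lin_closed[OF lin pm_tr_closed[OF M le(1) m]]) (use True le in auto)
      then show ?thesis using False True n0 by (auto simp: \<beta>_def interval_sel)
    qed (use False in \<open>auto simp: \<beta>_def\<close>)
  next
    case True
    then have nK: "n \<in> carrier K" using n by (simp add: interval_sel)
    show ?thesis
    proof (cases "t' \<in> {c..<d}")
      case t': True
      then show ?thesis
        using True le pm_tr_comp[OF M le(1) _ m, of "r - c"] by (simp add: \<beta>_def interval_sel)
    next
      \<comment> \<open>As \<open>c \<le> t \<le> t'\<close>, leaving the interval means
        \<open>t' \<ge> d\<close>, hence \<open>s \<le> r - d\<close>: the transition to degree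
        \<open>r - c\<close> factors through degree \<open>r - d\<close> and vanishes modulo
        \<open>H\<close>.\<close>
      case False
      then have s: "s \<le> r - d" using True le by auto
      then have "tr M s (r - c) m = tr M (r - d) (r - c) (tr M s (r - d) m)"
        using pm_tr_comp[OF M s _ m, of "r - c"] cd by simp
      then have "tr M s (r - c) m \<in> H" unfolding H_def using pm_tr_closed[OF M s m] by simp
      then have "H +>\<^bsub>V\<^esub> tr M s (r - c) m = \<zero>\<^bsub>U\<^esub>"
        using coset_zero_iff[OF V H submodule_carrier[OF V H]] by (simp add: zeroU)
      then show ?thesis using True False nK by (auto simp: \<beta>_def)
    qed
  qed
  obtain L where L: "L \<in> linear_maps K (G r) U"
    "\<And>s t m n. m\<in>elts M s \<Longrightarrow> n\<in>elts N t \<Longrightarrow> s + t \<le> r \<Longrightarrow>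
      L (gtensor_elem K M N r s t m n) = \<beta> s t m n"
    using gtensor_desc[of K M N U r \<beta>, OF M N U bil comp] by (auto simp: Ball_def)
  have "L (\<sigma> r m) = \<beta> (r - c) c m \<one>\<^bsub>K\<^esub>"
    unfolding shift_elem_def by (rule L(2)[OF m one_N]) simp
  also have "\<dots> = H +>\<^bsub>V\<^esub> m"
    using cd m cl[of m] pm_tr_id[OF M m] by (simp add: \<beta>_def V_def)
  finally have "H +>\<^bsub>V\<^esub> m = H"
    using z lin_zero[OF gtensor_module[OF M N] U L(1)] zeroU by simp
  then show "m \<in> tr M (r - d) (r - c) ` elts M (r - d)"
    using coset_zero_iff[OF V H] m by (simp add: V_def H_def)
next
  assume "m \<in> tr M (r - d) (r - c) ` elts M (r - d)"
  then show "\<sigma> r m = \<zero>\<^bsub>G r\<^esub>" using shift_elem_tr_zero by auto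
qed

end

text \<open>The quotient of \<open>M (r - c)\<close> by the image of \<open>M (r - d)\<close> is
  nonzero exactly when \<open>a \<le> r - c < b\<close> and \<open>r - d < a\<close>; these
  inequalities give the three end points.\<close>

theorem gtensor_interval:
  assumes K: "field K" and ab: "a < b" and cd: "c < d"
  shows "pm_isomorphic K
    (gtensor K (interval_module K {a..<b}) (interval_module K {c..<d}))
    (interval_module K {a + c..<min (a + d) (b + c)})"
proof -
  interpret K: field K by (rule K)
  let ?M = "interval_module K {a..<b}" and ?J = "{a + c..<min (a + d) (b + c)}"
  let ?\<sigma> = "shift_elem K ?M c d" and ?G = "gtensor K ?M (interval_module K {c..<d})"
  note M = bounded_interval_pm[OF K, of a b] and N = bounded_interval_pm[OF K, of c d]
    and J = bounded_interval_pm[OF K, of "a + c" "min (a + d) (b + c)"]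
  note G = gtensor_module[OF M N]
  note lin = shift_elem_linear[OF M cd]
  note M' = pm_module[OF M]
  show ?thesis
  \<comment> \<open>A class is paired with the scalar of any representative \<open>m\<close>.
    Outside \<open>?J\<close> either \<open>m\<close> is zero or it comes from degree
    \<open>r - d\<close>, so its class vanishes and zero is recorded.\<close>
  proof (rule pm_isomorphic_of_relation[OF gtensor_persistence_module[OF M N] J, where
        R = "\<lambda>r X n. \<exists>m\<in>elts ?M (r - c). X = ?\<sigma> r m \<and> n = (if r \<in> ?J then m else \<zero>\<^bsub>K\<^esub>)"],
      goal_cases)
    case (1 r X n)
    then show ?case using lin_closed[OF lin] by (auto simp: interval_sel split: if_splits)
  next
    case (2 r X)
    then show ?case using shift_elem_surj[OF M cd] by blast
  next
    case (3 r n)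
    show ?case
      by (rule exI[of _ "?\<sigma> r n"], rule bexI[of _ n]) (use 3 in \<open>auto simp: interval_sel split: if_splits\<close>)
  next
    case (4 r X n X' n')
    then obtain m m' where m: "m \<in> elts ?M (r - c)" "m' \<in> elts ?M (r - c)"
      "X = ?\<sigma> r m" "X' = ?\<sigma> r m'"
      "n = (if r \<in> ?J then m else \<zero>\<^bsub>K\<^esub>)" "n' = (if r \<in> ?J then m' else \<zero>\<^bsub>K\<^esub>)" by blast
    interpret V: module K "sp ?M (r - c)" by (rule M')
    have "X \<oplus>\<^bsub>sp ?G r\<^esub> X' = ?\<sigma> r (m \<oplus>\<^bsub>sp ?M (r - c)\<^esub> m')"
      using lin_add[OF lin m(1,2)] m(3,4) by simp
    moreover have "n \<oplus>\<^bsub>sp (interval_module K ?J) r\<^esub> n' = (if r \<in> ?J then m \<oplus>\<^bsub>sp ?M (r - c)\<^esub> m' else \<zero>\<^bsub>K\<^esub>)"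
      using m(5,6) by (simp add: interval_sel(3))
    ultimately show ?case using V.M.add.m_closed[OF m(1,2)] by blast
  next
    case (5 r k X n)
    then obtain m where m: "m \<in> elts ?M (r - c)" "X = ?\<sigma> r m"
      "n = (if r \<in> ?J then m else \<zero>\<^bsub>K\<^esub>)" by blast
    interpret V: module K "sp ?M (r - c)" by (rule M')
    have "k \<odot>\<^bsub>sp ?G r\<^esub> X = ?\<sigma> r (k \<odot>\<^bsub>sp ?M (r - c)\<^esub> m)"
      using lin_smult[OF lin 5(1) m(1)] m(2) by simp
    moreover have "k \<odot>\<^bsub>sp (interval_module K ?J) r\<^esub> n = (if r \<in> ?J then k \<odot>\<^bsub>sp ?M (r - c)\<^esub> m else \<zero>\<^bsub>K\<^esub>)"
      using m(3) 5(1) by (simp add: interval_sel(4))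
    ultimately show ?case using V.smult_closed[OF 5(1) m(1)] by blast
  next
    case (6 r r' X n)
    then obtain m where m: "m \<in> elts ?M (r - c)" "X = ?\<sigma> r m"
      "n = (if r \<in> ?J then m else \<zero>\<^bsub>K\<^esub>)" by blast
    \<comment> \<open>Entering \<open>?J\<close> from outside happens only at its left end, where
      \<open>r - c < a\<close> forces \<open>m\<close> to be zero.\<close>
    have "tr (interval_module K ?J) r r' n = (if r' \<in> ?J then tr ?M (r - c) (r' - c) m else \<zero>\<^bsub>K\<^esub>)"
      using m(1) 6(1) unfolding m(3) interval_sel by (auto split: if_splits)
    then show ?case
      using m pm_tr_closed[OF M _ m(1), of "r' - c"] 6(1) by (auto simp: shift_elem_tr[OF M cd 6(1)])
  next
    case (7 r X)
    then obtain m where m: "m \<in> elts ?M (r - c)" "X = ?\<sigma> r m"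
      "\<zero>\<^bsub>K\<^esub> = (if r \<in> ?J then m else \<zero>\<^bsub>K\<^esub>)" by (auto simp: interval_sel(2))
    \<comment> \<open>A nonzero \<open>m\<close> with recorded value zero lives in a degree
      \<open>r \<ge> a + d\<close>; there the transition from \<open>r - d\<close> to
      \<open>r - c\<close> is the identity, so \<open>m\<close> is its own preimage.\<close>
    have "m \<in> tr ?M (r - d) (r - c) ` elts ?M (r - d)"
    proof (cases "m = \<zero>\<^bsub>K\<^esub>")
      case True
      then show ?thesis using cd by (intro image_eqI[of _ _ "\<zero>\<^bsub>K\<^esub>"]) (auto simp: interval_sel)
    next
      case False
      then show ?thesis
        using m(1,3) cd by (intro image_eqI[of _ _ m]) (auto simp: interval_sel split: if_splits)
    qed
    then show ?case using shift_elem_zero_iff[OF M cd m(1)] m(2) by simp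
  next
    case (8 r n)
    then obtain m where m: "m \<in> elts ?M (r - c)" "?\<sigma> r m = \<zero>\<^bsub>sp ?G r\<^esub>"
      "n = (if r \<in> ?J then m else \<zero>\<^bsub>K\<^esub>)" by metis
    then have "m \<in> tr ?M (r - d) (r - c) ` elts ?M (r - d)"
      using shift_elem_zero_iff[OF M cd m(1)] by simp
    then show ?case using m(3) by (auto simp: interval_sel split: if_splits)
  qed
qed

section \<open>The graded internal hom\<close>

lemma translate_sel: "sp (translate N s) x = sp N (s + x)" "tr (translate N s) x y = tr N (s + x) (s + y)"
  by (simp_all add: translate_def)

lemma translate_persistence_module:
  "persistence_module K N \<Longrightarrow> persistence_module K (translate N s)"
  by (rule persistence_moduleI)
    (auto simp: translate_sel pm_field pm_module pm_tr_linear pm_tr_id pm_tr_comp)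

lemma nat_trans_cong:
  assumes M: "persistence_module K M" and "\<phi> \<in> nat_trans K M N" "\<And>x v. v \<in> elts M x \<Longrightarrow> \<psi> x v = \<phi> x v"
  shows "\<psi> \<in> nat_trans K M N"
proof (rule nat_transI)
  show "\<psi> x \<in> linear_maps K (sp M x) (sp N x)" for x
    by (rule lin_cong[OF pm_module[OF M] nat_trans_linear[OF assms(2)] assms(3)])
qed (simp add: assms(3) pm_tr_closed[OF M] nat_trans_tr[OF assms(2)])

context
  fixes K :: "('k, 'm) ring_scheme" and M :: "('k, 'v) persmod" and N :: "('k, 'w) persmod"
  assumes M: "persistence_module K M" and N: "persistence_module K N"
begin

lemma nat_trans_zero: "(\<lambda>x v. \<zero>\<^bsub>sp N x\<^esub>) \<in> nat_trans K M N"
  by (rule nat_transI) (simp_all add: lin_const_zero pm_module[OF M] pm_module[OF N] pm_tr_zero[OF N])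

lemma nat_trans_smult:
  assumes "c \<in> carrier K" "\<phi> \<in> nat_trans K M N"
  shows "(\<lambda>x v. c \<odot>\<^bsub>sp N x\<^esub> \<phi> x v) \<in> nat_trans K M N"
proof (rule nat_transI)
  show "(\<lambda>v. c \<odot>\<^bsub>sp N x\<^esub> \<phi> x v) \<in> linear_maps K (sp M x) (sp N x)" for x
    by (rule lin_compose[OF nat_trans_linear[OF assms(2)] smult_linear_maps[OF pm_module[OF N] assms(1)]])
qed (simp add: assms(1) nat_trans_tr[OF assms(2)] nat_trans_closed[OF assms(2)] lin_smult[OF pm_tr_linear[OF N]])

lemma nat_trans_add:
  assumes "\<phi> \<in> nat_trans K M N" "\<psi> \<in> nat_trans K M N"
  shows "(\<lambda>x v. \<phi> x v \<oplus>\<^bsub>sp N x\<^esub> \<psi> x v) \<in> nat_trans K M N"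
proof (rule nat_transI)
  fix x
  interpret W: module K "sp N x" by (rule pm_module[OF N])
  note cl = nat_trans_closed[OF assms(1), of _ x] nat_trans_closed[OF assms(2), of _ x]
  note l = nat_trans_linear[OF assms(1), of x] nat_trans_linear[OF assms(2), of x]
  show "(\<lambda>v. \<phi> x v \<oplus>\<^bsub>sp N x\<^esub> \<psi> x v) \<in> linear_maps K (sp M x) (sp N x)"
    by (rule linear_mapsI)
      (simp_all add: cl lin_add[OF l(1)] lin_add[OF l(2)] lin_smult[OF l(1)]
        lin_smult[OF l(2)] W.M.a_ac W.smult_r_distr)
qed (simp add: nat_trans_tr[OF assms(1)] nat_trans_closed[OF assms(1)] nat_trans_tr[OF assms(2)]
    nat_trans_closed[OF assms(2)] lin_add[OF pm_tr_linear[OF N]])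

lemma nat_trans_diff:
  assumes "\<phi> \<in> nat_trans K M N" "\<psi> \<in> nat_trans K M N"
  shows "(\<lambda>x v. \<phi> x v \<ominus>\<^bsub>sp N x\<^esub> \<psi> x v) \<in> nat_trans K M N"
proof -
  interpret K: field K by (rule pm_field[OF M])
  have "(\<lambda>x v. \<phi> x v \<oplus>\<^bsub>sp N x\<^esub> (\<ominus>\<^bsub>K\<^esub> \<one>\<^bsub>K\<^esub>) \<odot>\<^bsub>sp N x\<^esub> \<psi> x v) \<in> nat_trans K M N"
    by (rule nat_trans_add[OF assms(1) nat_trans_smult[OF _ assms(2)]]) simp
  moreover have "\<phi> x v \<ominus>\<^bsub>sp N x\<^esub> \<psi> x v = \<phi> x v \<oplus>\<^bsub>sp N x\<^esub> (\<ominus>\<^bsub>K\<^esub> \<one>\<^bsub>K\<^esub>) \<odot>\<^bsub>sp N x\<^esub> \<psi> x v"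
    if "v \<in> elts M x" for x v
    using module_neg_eq[OF pm_module[OF N] nat_trans_closed[OF assms(2) that]] by (simp add: a_minus_def)
  ultimately show ?thesis by (rule nat_trans_cong[OF M])
qed

end


section \<open>The vector space of natural transformations\<close>

lemma hom_space_sel:
  "carrier (hom_space K M N) = {\<phi> \<in> nat_trans K M N. \<forall>x. \<phi> x \<in> extensional (elts M x)}"
  "\<zero>\<^bsub>hom_space K M N\<^esub> = (\<lambda>x. \<lambda>v\<in>elts M x. \<zero>\<^bsub>sp N x\<^esub>)"
  "\<phi> \<oplus>\<^bsub>hom_space K M N\<^esub> \<psi> = (\<lambda>x. \<lambda>v\<in>elts M x. \<phi> x v \<oplus>\<^bsub>sp N x\<^esub> \<psi> x v)"
  "c \<odot>\<^bsub>hom_space K M N\<^esub> \<phi> = (\<lambda>x. \<lambda>v\<in>elts M x. c \<odot>\<^bsub>sp N x\<^esub> \<phi> x v)"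
  by (simp_all add: hom_space_def)

lemma hom_space_eqI:
  assumes "\<phi> \<in> carrier (hom_space K M N)" "\<psi> \<in> carrier (hom_space K M N)"
    and "\<And>x v. v \<in> elts M x \<Longrightarrow> \<phi> x v = \<psi> x v"
  shows "\<phi> = \<psi>"
proof
  fix x
  show "\<phi> x = \<psi> x"
    by (rule extensionalityI[where A = "elts M x"]) (use assms in \<open>auto simp: hom_space_sel\<close>)
qed

lemma hom_space_nat_trans: "\<phi> \<in> carrier (hom_space K M N) \<Longrightarrow> \<phi> \<in> nat_trans K M N"
  by (simp add: hom_space_sel)

lemma restrict_hom_space:
  assumes "persistence_module K M" "\<phi> \<in> nat_trans K M N" "\<And>x v. v \<in> elts M x \<Longrightarrow> \<psi> x v = \<phi> x v"
  shows "(\<lambda>x. \<lambda>v\<in>elts M x. \<psi> x v) \<in> carrier (hom_space K M N)"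
  using nat_trans_cong[OF assms(1,2)] assms(3) by (simp add: hom_space_sel)

lemma hom_space_module:
  assumes M: "persistence_module K M" and N: "persistence_module K N"
  shows "module K (hom_space K M N)"
proof -
  let ?H = "hom_space K M N"
  note nt = hom_space_nat_trans and cl = nat_trans_closed[OF hom_space_nat_trans]
  note N' = pm_module[OF N]
  note ag = module.axioms(2)[OF N']
  note E = abelian_groupE[OF ag]
  have zc: "\<zero>\<^bsub>?H\<^esub> \<in> carrier ?H"
    unfolding hom_space_sel(2) by (rule restrict_hom_space[OF M nat_trans_zero[OF M N]]) simp
  have ac: "\<phi> \<oplus>\<^bsub>?H\<^esub> \<psi> \<in> carrier ?H" if "\<phi> \<in> carrier ?H" "\<psi> \<in> carrier ?H" for \<phi> \<psi>
    unfolding hom_space_sel(3)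
    by (rule restrict_hom_space[OF M nat_trans_add[OF M N nt[OF that(1)] nt[OF that(2)]]]) simp
  have sc: "c \<odot>\<^bsub>?H\<^esub> \<phi> \<in> carrier ?H" if "c \<in> carrier K" "\<phi> \<in> carrier ?H" for \<phi> c
    unfolding hom_space_sel(4)
    by (rule restrict_hom_space[OF M nat_trans_smult[OF M N that(1) nt[OF that(2)]]]) simp
  note ap = hom_space_sel(2-4)
  have "abelian_group ?H"
  proof (rule abelian_groupI)
    fix \<phi> \<psi> assume a: "\<phi> \<in> carrier ?H" "\<psi> \<in> carrier ?H"
    show "\<phi> \<oplus>\<^bsub>?H\<^esub> \<psi> \<in> carrier ?H" by (rule ac[OF a])
    show "\<phi> \<oplus>\<^bsub>?H\<^esub> \<psi> = \<psi> \<oplus>\<^bsub>?H\<^esub> \<phi>"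
      by (rule hom_space_eqI[OF ac[OF a] ac[OF a(2,1)]]) (simp add: ap E(4) cl[OF a(1)] cl[OF a(2)])
  next
    fix \<phi> \<psi> \<chi> assume a: "\<phi> \<in> carrier ?H" "\<psi> \<in> carrier ?H" "\<chi> \<in> carrier ?H"
    show "\<phi> \<oplus>\<^bsub>?H\<^esub> \<psi> \<oplus>\<^bsub>?H\<^esub> \<chi> = \<phi> \<oplus>\<^bsub>?H\<^esub> (\<psi> \<oplus>\<^bsub>?H\<^esub> \<chi>)"
      by (rule hom_space_eqI[OF ac[OF ac[OF a(1,2)] a(3)] ac[OF a(1) ac[OF a(2,3)]]])
        (simp add: ap E(3) cl[OF a(1)] cl[OF a(2)] cl[OF a(3)])
  next
    fix \<phi> assume a: "\<phi> \<in> carrier ?H"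
    show "\<zero>\<^bsub>?H\<^esub> \<oplus>\<^bsub>?H\<^esub> \<phi> = \<phi>"
      by (rule hom_space_eqI[OF ac[OF zc a] a]) (simp add: ap E(5) cl[OF a])
    have m1: "\<ominus>\<^bsub>K\<^esub> \<one>\<^bsub>K\<^esub> \<in> carrier K"
    proof -
      interpret K: field K by (rule pm_field[OF M])
      show ?thesis by simp
    qed
    show "\<exists>\<psi>\<in>carrier ?H. \<psi> \<oplus>\<^bsub>?H\<^esub> \<phi> = \<zero>\<^bsub>?H\<^esub>"
    proof (rule bexI[OF _ sc[OF m1 a]], rule hom_space_eqI[OF ac[OF sc[OF m1 a] a] zc])
      fix x v assume v: "v \<in> elts M x"
      interpret W: module K "sp N x" by (rule N')
      have "(\<ominus>\<^bsub>K\<^esub> \<one>\<^bsub>K\<^esub>) \<odot>\<^bsub>sp N x\<^esub> \<phi> x v \<oplus>\<^bsub>sp N x\<^esub> \<phi> x v = \<zero>\<^bsub>sp N x\<^esub>"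
        using W.M.l_neg[OF cl[OF a v]] module_neg_eq[OF N' cl[OF a v]] by metis
      then show "(((\<ominus>\<^bsub>K\<^esub> \<one>\<^bsub>K\<^esub>) \<odot>\<^bsub>?H\<^esub> \<phi>) \<oplus>\<^bsub>?H\<^esub> \<phi>) x v = \<zero>\<^bsub>?H\<^esub> x v" using v by (simp add: ap)
    qed
  qed (rule zc)
  then show ?thesis
  proof (rule moduleI[OF pm_cring[OF M]])
    fix c \<phi> assume a: "c \<in> carrier K" "\<phi> \<in> carrier ?H"
    show "c \<odot>\<^bsub>?H\<^esub> \<phi> \<in> carrier ?H" by (rule sc[OF a])
  next
    fix c e \<phi> assume c: "c \<in> carrier K" "e \<in> carrier K" and a: "\<phi> \<in> carrier ?H"
    interpret K: field K by (rule pm_field[OF M])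
    show "(c \<oplus>\<^bsub>K\<^esub> e) \<odot>\<^bsub>?H\<^esub> \<phi> = c \<odot>\<^bsub>?H\<^esub> \<phi> \<oplus>\<^bsub>?H\<^esub> e \<odot>\<^bsub>?H\<^esub> \<phi>"
      by (rule hom_space_eqI[OF sc[OF _ a] ac[OF sc[OF c(1) a] sc[OF c(2) a]]])
        (use c in \<open>simp_all add: ap module.smult_l_distr[OF N'] cl[OF a]\<close>)
    show "(c \<otimes>\<^bsub>K\<^esub> e) \<odot>\<^bsub>?H\<^esub> \<phi> = c \<odot>\<^bsub>?H\<^esub> (e \<odot>\<^bsub>?H\<^esub> \<phi>)"
      by (rule hom_space_eqI[OF sc[OF _ a] sc[OF c(1) sc[OF c(2) a]]])
        (use c in \<open>simp_all add: ap module.smult_assoc1[OF N'] cl[OF a]\<close>)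
  next
    fix c \<phi> \<psi> assume c: "c \<in> carrier K" and a: "\<phi> \<in> carrier ?H" "\<psi> \<in> carrier ?H"
    show "c \<odot>\<^bsub>?H\<^esub> (\<phi> \<oplus>\<^bsub>?H\<^esub> \<psi>) = c \<odot>\<^bsub>?H\<^esub> \<phi> \<oplus>\<^bsub>?H\<^esub> c \<odot>\<^bsub>?H\<^esub> \<psi>"
      by (rule hom_space_eqI[OF sc[OF c ac[OF a]] ac[OF sc[OF c a(1)] sc[OF c a(2)]]])
        (use c in \<open>simp add: ap module.smult_r_distr[OF N'] cl[OF a(1)] cl[OF a(2)]\<close>)
  next
    fix \<phi> assume a: "\<phi> \<in> carrier ?H"
    interpret K: field K by (rule pm_field[OF M])
    show "\<one>\<^bsub>K\<^esub> \<odot>\<^bsub>?H\<^esub> \<phi> = \<phi>"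
      by (rule hom_space_eqI[OF sc[OF K.one_closed a] a]) (simp add: ap module.smult_one[OF N'] cl[OF a])
  qed
qed

lemma ghom_sel:
  "sp (ghom K M N) s = hom_space K M (translate N s)"
  "tr (ghom K M N) s t \<phi> = (\<lambda>x. \<lambda>v\<in>elts M x. tr N (s + x) (t + x) (\<phi> x v))"
  by (simp_all add: ghom_def)

lemma ghom_eqI:
  assumes "\<phi> \<in> elts (ghom K M N) s" "\<psi> \<in> elts (ghom K M N) s"
    and "\<And>x v. v \<in> elts M x \<Longrightarrow> \<phi> x v = \<psi> x v"
  shows "\<phi> = \<psi>"
  using hom_space_eqI[OF assms(1,2)[unfolded ghom_sel(1)] assms(3)] .

lemma ghom_nat_trans: "\<phi> \<in> elts (ghom K M N) s \<Longrightarrow> \<phi> \<in> nat_trans K M (translate N s)"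
  unfolding ghom_sel(1) by (rule hom_space_nat_trans)

lemma
  assumes "\<phi> \<in> elts (ghom K M N) s"
  shows ghom_linear: "\<phi> x \<in> linear_maps K (sp M x) (sp N (s + x))"
    and ghom_closed: "v \<in> elts M x \<Longrightarrow> \<phi> x v \<in> elts N (s + x)"
    and ghom_tr: "x \<le> y \<Longrightarrow> v \<in> elts M x \<Longrightarrow> \<phi> y (tr M x y v) = tr N (s + x) (s + y) (\<phi> x v)"
  using nat_trans_linear[OF ghom_nat_trans[OF assms], of x] nat_trans_closed[OF ghom_nat_trans[OF assms], of v x]
    nat_trans_tr[OF ghom_nat_trans[OF assms], of x y v]
  by (simp_all add: translate_sel)

context
  fixes K :: "('k, 'm) ring_scheme" and M :: "('k, 'v) persmod" and N :: "('k, 'w) persmod"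
  assumes M: "persistence_module K M" and N: "persistence_module K N"
begin

private abbreviation (input) "H s \<equiv> sp (ghom K M N) s"

lemma ghom_module: "module K (H s)"
  unfolding ghom_sel by (rule hom_space_module[OF M translate_persistence_module[OF N]])

lemma ghom_tr_linear:
  assumes st: "s \<le> t"
  shows "tr (ghom K M N) s t \<in> linear_maps K (H s) (H t)"
proof -
  note trl = pm_tr_linear[OF N, of "s + x" "t + x" for x]
  have cl: "tr (ghom K M N) s t \<phi> \<in> carrier (H t)" if "\<phi> \<in> carrier (H s)" for \<phi>
    unfolding ghom_sel
  proof (rule restrict_hom_space[OF M])
    show "(\<lambda>x v. tr N (s + x) (t + x) (\<phi> x v)) \<in> nat_trans K M (translate N t)"
    proof (rule nat_transI)
      show "(\<lambda>v. tr N (s + x) (t + x) (\<phi> x v)) \<in> linear_maps K (sp M x) (sp (translate N t) x)" for x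
        unfolding translate_sel
        by (rule lin_compose[OF ghom_linear[OF that] trl]) (use st in simp)
      show "tr N (s + y) (t + y) (\<phi> y (tr M x y v)) = tr (translate N t) x y (tr N (s + x) (t + x) (\<phi> x v))"
        if "x \<le> y" "v \<in> elts M x" for x y v
        using that st ghom_closed[OF \<open>\<phi> \<in> carrier (H s)\<close>]
        by (simp add: translate_sel ghom_tr[OF \<open>\<phi> \<in> carrier (H s)\<close>] pm_tr_comp[OF N])
    qed
  qed simp
  interpret Hs: module K "H s" by (rule ghom_module)
  interpret Ht: module K "H t" by (rule ghom_module)
  have le: "s + x \<le> t + x" for x using st by simp
  show ?thesis
  proof (rule linear_mapsI)
    fix \<phi> \<psi> assume a: "\<phi> \<in> carrier (H s)" "\<psi> \<in> carrier (H s)"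
    show "tr (ghom K M N) s t (\<phi> \<oplus>\<^bsub>H s\<^esub> \<psi>) = tr (ghom K M N) s t \<phi> \<oplus>\<^bsub>H t\<^esub> tr (ghom K M N) s t \<psi>"
      by (auto simp: ghom_sel hom_space_sel translate_sel fun_eq_iff restrict_def
          lin_add[OF trl[OF le]] ghom_closed[OF a(1)] ghom_closed[OF a(2)])
  next
    fix c \<phi> assume c: "c \<in> carrier K" and a: "\<phi> \<in> carrier (H s)"
    show "tr (ghom K M N) s t (c \<odot>\<^bsub>H s\<^esub> \<phi>) = c \<odot>\<^bsub>H t\<^esub> tr (ghom K M N) s t \<phi>"
      by (auto simp: ghom_sel hom_space_sel translate_sel fun_eq_iff restrict_def
          lin_smult[OF trl[OF le] c] ghom_closed[OF a])
  qed (rule cl)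
qed

lemma ghom_persistence_module: "persistence_module K (ghom K M N)"
proof (rule persistence_moduleI)
  show "field K" by (rule pm_field[OF M])
  show "module K (H s)" for s by (rule ghom_module)
  show "s \<le> t \<Longrightarrow> tr (ghom K M N) s t \<in> linear_maps K (H s) (H t)" for s t by (rule ghom_tr_linear)
  note cl = lin_closed[OF ghom_tr_linear, unfolded ghom_sel(1)]
  show "tr (ghom K M N) s s \<phi> = \<phi>" if "\<phi> \<in> carrier (H s)" for s \<phi>
    by (rule hom_space_eqI[OF cl]) (use that ghom_closed[OF that] in \<open>auto simp: ghom_sel pm_tr_id[OF N]\<close>)
  show "tr (ghom K M N) t u (tr (ghom K M N) s t \<phi>) = tr (ghom K M N) s u \<phi>"
    if "s \<le> t" "t \<le> u" "\<phi> \<in> carrier (H s)" for s t u \<phi>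
    using that by (auto simp: ghom_sel fun_eq_iff restrict_def ghom_closed[OF that(3)] pm_tr_comp[OF N])
qed

end

lemma
  assumes M: "persistence_module K M" and M': "persistence_module K M'" and N: "persistence_module K N"
    and f: "f \<in> nat_trans K M M'"
  shows ghom_map_linear: "ghom_map M f s \<in> linear_maps K (sp (ghom K M' N) s) (sp (ghom K M N) s)"
    and ghom_map_tr: "\<phi> \<in> elts (ghom K M' N) s \<Longrightarrow>
      ghom_map M f t (tr (ghom K M' N) s t \<phi>) = tr (ghom K M N) s t (ghom_map M f s \<phi>)"
proof -
  note fc = nat_trans_closed[OF f]
  show "ghom_map M f s \<in> linear_maps K (sp (ghom K M' N) s) (sp (ghom K M N) s)"
  proof (rule linear_mapsI)
    show "ghom_map M f s \<phi> \<in> elts (ghom K M N) s" if "\<phi> \<in> elts (ghom K M' N) s" for \<phi>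
      unfolding ghom_map_def ghom_sel
      by (rule restrict_hom_space[OF M nat_trans_compose[OF f ghom_nat_trans[OF that]]]) simp
  qed (auto simp: ghom_map_def ghom_sel hom_space_sel translate_sel fun_eq_iff restrict_def fc)
  show "\<phi> \<in> elts (ghom K M' N) s \<Longrightarrow>
      ghom_map M f t (tr (ghom K M' N) s t \<phi>) = tr (ghom K M N) s t (ghom_map M f s \<phi>)"
    by (auto simp: ghom_map_def ghom_sel fun_eq_iff restrict_def fc)
qed

subsection \<open>Maps out of interval modules\<close>

text \<open>For \<open>I\<close> an interval starting at \<open>a\<close>: the map that sends the
  generator \<open>\<one>\<close> of degree \<open>a\<close> to \<open>n\<close>. One definition
  serves \<open>{a..}\<close> and \<open>{a..<b}\<close>.\<close>

definition interval_map :: "real set \<Rightarrow> real \<Rightarrow> ('k, 'v) persmod \<Rightarrow> 'v \<Rightarrow> real \<Rightarrow> 'k \<Rightarrow> 'v" where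
  "interval_map I a N n x k = (if x \<in> I then k \<odot>\<^bsub>sp N x\<^esub> tr N a x n else \<zero>\<^bsub>sp N x\<^esub>)"

text \<open>The only relation on the generator is that it dies where \<open>I\<close> ends, and the
  second condition on \<open>n\<close> respects it; for \<open>I = {a..}\<close> that condition is
  vacuous.\<close>

lemma interval_map_nat_trans:
  assumes N: "persistence_module K N"
    and I: "\<And>x. x \<in> I \<Longrightarrow> a \<le> x" "\<And>x y. y \<in> I \<Longrightarrow> a \<le> x \<Longrightarrow> x \<le> y \<Longrightarrow> x \<in> I"
    and n: "n \<in> elts N a" "\<And>x. a \<le> x \<Longrightarrow> x \<notin> I \<Longrightarrow> tr N a x n = \<zero>\<^bsub>sp N x\<^esub>"
  shows "interval_map I a N n \<in> nat_trans K (interval_module K I) N"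
proof (rule nat_transI)
  note N' = pm_module[OF N]
  fix x
  interpret W: module K "sp N x" by (rule N')
  show "interval_map I a N n x \<in> linear_maps K (sp (interval_module K I) x) (sp N x)"
    using pm_tr_closed[OF N I(1) n(1), of x]
    by (intro linear_mapsI) (auto simp: interval_map_def interval_sel W.smult_l_distr W.smult_assoc1)
  fix y k assume xy: "x \<le> y" and k: "k \<in> elts (interval_module K I) x"
  interpret W': module K "sp N y" by (rule N')
  show "interval_map I a N n y (tr (interval_module K I) x y k) = tr N x y (interval_map I a N n x k)"
  proof (cases "x \<in> I")
    case x: True
    note ax = I(1)[OF x]
    have kK: "k \<in> carrier K" using k x by (simp add: interval_sel)
    have "tr N x y (interval_map I a N n x k) = k \<odot>\<^bsub>sp N y\<^esub> tr N a y n"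
      using lin_smult[OF pm_tr_linear[OF N xy] kK pm_tr_closed[OF N ax n(1)]] x
        pm_tr_comp[OF N ax xy n(1)] by (simp add: interval_map_def)
    then show ?thesis using n(2)[of y] ax xy kK x by (auto simp: interval_map_def interval_sel)
  next
    case False
    then have "k = \<zero>\<^bsub>K\<^esub>" using k by (simp add: interval_sel)
    then show ?thesis
      using False pm_tr_closed[OF N I(1) n(1), of y]
      by (auto simp: interval_map_def interval_sel pm_tr_zero[OF N xy])
  qed
qed

text \<open>A map into the shift by \<open>s\<close> is determined by the value \<open>n\<close> at
  the generator of degree \<open>a\<close>, and \<open>n\<close> may be any element of degree
  \<open>s + a\<close> killed in degree \<open>s + b\<close>, where the generator dies.\<close>

theorem ghom_interval:
  assumes K: "field K" and ab: "a < b" and cd: "c < d"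
  shows "pm_isomorphic K
    (ghom K (interval_module K {a..<b}) (interval_module K {c..<d}))
    (interval_module K {max (c - a) (d - b)..<d - a})"
proof -
  interpret K: field K by (rule K)
  let ?M = "interval_module K {a..<b}" and ?N = "interval_module K {c..<d}"
  let ?J = "{max (c - a) (d - b)..<d - a}" and ?G = "ghom K (interval_module K {a..<b}) (interval_module K {c..<d})"
  note M = bounded_interval_pm[OF K, of a b] and N = bounded_interval_pm[OF K, of c d]
    and J = bounded_interval_pm[OF K, of "max (c - a) (d - b)" "d - a"]
  note N' = pm_module[OF N]
  have one: "\<one>\<^bsub>K\<^esub> \<in> elts ?M a" using ab by (simp add: interval_sel)
  \<comment> \<open>Since \<open>s + a \<ge> c\<close> excludes \<open>s + b < c\<close>, a nonzero
    \<open>n\<close> is killed exactly when \<open>s + b \<ge> d\<close>; together with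
    \<open>c \<le> s + a < d\<close> this is membership of \<open>s\<close> in
    \<open>?J\<close>.\<close>
  have J_iff: "n \<in> elts (interval_module K ?J) s \<longleftrightarrow>
      n \<in> elts ?N (s + a) \<and> tr ?N (s + a) (s + b) n = \<zero>\<^bsub>K\<^esub>" for s n
    using ab by (auto simp: interval_sel split: if_splits)
  show ?thesis
  proof (rule pm_isomorphic_of_relation[OF ghom_persistence_module[OF M N] J, where
        R = "\<lambda>s \<phi> n. \<phi> \<in> elts ?G s \<and> n = \<phi> a \<one>\<^bsub>K\<^esub>"], goal_cases)
    case (1 s \<phi> n)
    then have \<phi>: "\<phi> \<in> elts ?G s" and n: "n = \<phi> a \<one>\<^bsub>K\<^esub>" by auto
    have "tr ?N (s + a) (s + b) n = \<phi> b (tr ?M a b \<one>\<^bsub>K\<^esub>)"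
      using ghom_tr[OF \<phi> _ one, of b] ab n by simp
    also have "\<dots> = \<zero>\<^bsub>K\<^esub>"
      using lin_zero[OF pm_module[OF M] N' ghom_linear[OF \<phi>]] ab by (simp add: interval_sel)
    finally show ?case using \<phi> n ghom_closed[OF \<phi> one] J_iff by blast
  next
    case (3 s n)
    let ?f = "interval_map {a..<b} a (translate ?N s) n"
    have n: "n \<in> elts (translate ?N s) a" and 0: "tr ?N (s + a) (s + b) n = \<zero>\<^bsub>K\<^esub>"
      using 3 J_iff by (auto simp: translate_sel)
    have "tr (translate ?N s) a x n = \<zero>\<^bsub>sp (translate ?N s) x\<^esub>" if "a \<le> x" "x \<notin> {a..<b}" for x
    proof -
      have "tr (translate ?N s) a x n = tr ?N (s + b) (s + x) (tr ?N (s + a) (s + b) n)"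
        using pm_tr_comp[OF N, of "s + a" "s + b" "s + x" n] n that ab by (simp add: translate_sel)
      then show ?thesis using 0 pm_tr_zero[OF N, of "s + b" "s + x"] that by (simp add: translate_sel interval_sel(2))
    qed
    then have f: "?f \<in> nat_trans K ?M (translate ?N s)"
      by (intro interval_map_nat_trans[OF translate_persistence_module[OF N] _ _ n]) auto
    have "?f a \<one>\<^bsub>K\<^esub> = n"
      using n ab pm_tr_id[OF N, of n "s + a"] module.smult_one[OF N', of n "s + a"]
      by (simp add: interval_map_def translate_sel)
    then show ?case
      using restrict_hom_space[OF M f, of ?f] one
      by (intro exI[of _ "\<lambda>x. \<lambda>v\<in>elts ?M x. ?f x v"]) (simp add: ghom_sel)
  next
    case (4 s \<phi> n \<psi> n')
    interpret G: module K "sp ?G s" by (rule ghom_module[OF M N])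
    show ?case using 4 one G.M.add.m_closed[of \<phi> \<psi>] by (simp add: ghom_sel hom_space_sel translate_sel interval_sel(3))
  next
    case (5 s k \<phi> n)
    interpret G: module K "sp ?G s" by (rule ghom_module[OF M N])
    show ?case using 5 one G.smult_closed[of k \<phi>] by (simp add: ghom_sel hom_space_sel translate_sel interval_sel(4))
  next
    case (6 s t \<phi> n)
    then have \<phi>: "\<phi> \<in> elts ?G s" and n: "n = \<phi> a \<one>\<^bsub>K\<^esub>" and st: "s \<le> t" by auto
    have nN: "n \<in> elts ?N (s + a)" using ghom_closed[OF \<phi> one] n by simp
    have "tr ?N (s + a) (s + b) n = \<phi> b (tr ?M a b \<one>\<^bsub>K\<^esub>)"
      using ghom_tr[OF \<phi> _ one, of b] ab n by simp
    also have "\<dots> = \<zero>\<^bsub>K\<^esub>"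
      using lin_zero[OF pm_module[OF M] N' ghom_linear[OF \<phi>]] ab by (simp add: interval_sel)
    finally have "n \<in> elts (interval_module K ?J) s" using nN J_iff by blast
    then have "tr (interval_module K ?J) s t n = tr ?N (s + a) (t + a) n"
      using st nN ab by (auto simp: interval_sel split: if_splits)
    then show ?case
      using lin_closed[OF ghom_tr_linear[OF M N st] \<phi>] n one by (simp add: ghom_sel)
  next
    case (7 s \<phi>)
    then have \<phi>: "\<phi> \<in> elts ?G s" and 0: "\<phi> a \<one>\<^bsub>K\<^esub> = \<zero>\<^bsub>K\<^esub>" by (auto simp: interval_sel(2))
    have "\<phi> x v = \<zero>\<^bsub>sp ?G s\<^esub> x v" if v: "v \<in> elts ?M x" for x v
    proof (cases "x \<in> {a..<b}")
      case False
      then have "v = \<zero>\<^bsub>sp ?M x\<^esub>" using v by (auto simp: interval_sel split: if_splits)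
      then show ?thesis
        using lin_zero[OF pm_module[OF M] N' ghom_linear[OF \<phi>]] v
        by (simp add: ghom_sel hom_space_sel translate_sel)
    next
      case True
      then have vK: "v \<in> carrier K" using v by (simp add: interval_sel)
      \<comment> \<open>The generator in degree \<open>a\<close> spans all of \<open>?M\<close>, so
        vanishing there propagates to every degree by naturality.\<close>
      have "v = tr ?M a x (v \<odot>\<^bsub>sp ?M a\<^esub> \<one>\<^bsub>K\<^esub>)" using True vK ab by (simp add: interval_sel)
      then have "\<phi> x v = \<phi> x (tr ?M a x (v \<odot>\<^bsub>sp ?M a\<^esub> \<one>\<^bsub>K\<^esub>))" by simp
      also have "\<dots> = tr ?N (s + a) (s + x) (\<phi> a (v \<odot>\<^bsub>sp ?M a\<^esub> \<one>\<^bsub>K\<^esub>))"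
        by (rule ghom_tr[OF \<phi>]) (use True vK in \<open>auto simp: interval_sel\<close>)
      also have "\<phi> a (v \<odot>\<^bsub>sp ?M a\<^esub> \<one>\<^bsub>K\<^esub>) = \<zero>\<^bsub>K\<^esub>"
        using lin_smult[OF ghom_linear[OF \<phi>] vK one] 0 vK by (simp add: interval_sel(4))
      finally show ?thesis using v by (simp add: ghom_sel hom_space_sel translate_sel interval_sel)
    qed
    then show ?case
      using module.axioms(2)[OF ghom_module[OF M N, of s]] \<phi>
      by (intro hom_space_eqI[of \<phi> K ?M "translate ?N s"]) (auto simp: ghom_sel abelian_groupE(2))
  next
    case (8 s n)
    then show ?case using one by (simp add: ghom_sel hom_space_sel translate_sel interval_sel(2))
  qed auto
qed

section \<open>Projective modules and resolutions\<close>

subsection \<open>Transport along an injection of underlying types\<close>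

text \<open>\<open>projective\<close> tests lifting only on modules over one fixed type, and
  \<open>resolution\<close> prescribes the type of its terms; an isomorphic copy along an injection
  brings a module into the required type.\<close>

definition embed_module :: "('v \<Rightarrow> 'w) \<Rightarrow> ('k, 'v) module \<Rightarrow> ('k, 'w) module" where
  "embed_module j V =
    \<lparr>carrier = j ` carrier V, mult = undefined, one = undefined,
     zero = j \<zero>\<^bsub>V\<^esub>, add = (\<lambda>u v. j (the_inv j u \<oplus>\<^bsub>V\<^esub> the_inv j v)), smult = (\<lambda>c u. j (c \<odot>\<^bsub>V\<^esub> the_inv j u))\<rparr>"

definition embed_pm :: "('v \<Rightarrow> 'w) \<Rightarrow> ('k, 'v) persmod \<Rightarrow> ('k, 'w) persmod" where
  "embed_pm j M = \<lparr>sp = (\<lambda>x. embed_module j (sp M x)), tr = (\<lambda>x y u. j (tr M x y (the_inv j u)))\<rparr>"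

lemma embed_pm_sel:
  "elts (embed_pm j M) x = j ` elts M x"
  "\<zero>\<^bsub>sp (embed_pm j M) x\<^esub> = j \<zero>\<^bsub>sp M x\<^esub>"
  "u \<oplus>\<^bsub>sp (embed_pm j M) x\<^esub> v = j (the_inv j u \<oplus>\<^bsub>sp M x\<^esub> the_inv j v)"
  "c \<odot>\<^bsub>sp (embed_pm j M) x\<^esub> u = j (c \<odot>\<^bsub>sp M x\<^esub> the_inv j u)"
  "tr (embed_pm j M) x y u = j (tr M x y (the_inv j u))"
  by (simp_all add: embed_pm_def embed_module_def)

lemma embed_persistence_module:
  assumes M: "persistence_module K M" and j: "inj j"
  shows "persistence_module K (embed_pm j M)"
proof (rule persistence_moduleI)
  note [simp] = embed_pm_sel the_inv_f_f[OF j]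
  show "field K" by (rule pm_field[OF M])
  show "module K (sp (embed_pm j M) x)" for x
  proof -
    interpret V: module K "sp M x" by (rule pm_module[OF M])
    show ?thesis
    proof (rule moduleI)
      show "abelian_group (sp (embed_pm j M) x)"
      proof (rule abelian_groupI)
        fix u assume "u \<in> elts (embed_pm j M) x"
        then obtain v where v: "v \<in> elts M x" "u = j v" by auto
        then show "\<exists>w\<in>elts (embed_pm j M) x. w \<oplus>\<^bsub>sp (embed_pm j M) x\<^esub> u = \<zero>\<^bsub>sp (embed_pm j M) x\<^esub>"
          by (intro bexI[of _ "j (\<ominus>\<^bsub>sp M x\<^esub> v)"]) (auto simp: V.M.l_neg)
      qed (auto simp: V.M.a_ac)
    qed (auto simp: V.R.is_cring V.smult_l_distr V.smult_r_distr V.smult_assoc1)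
  qed
  show "tr (embed_pm j M) x y \<in> linear_maps K (sp (embed_pm j M) x) (sp (embed_pm j M) y)" if "x \<le> y" for x y
    using pm_tr_linear[OF M that]
    by (intro linear_mapsI) (auto simp: lin_add lin_smult pm_tr_closed[OF M that])
qed (auto simp: embed_pm_sel the_inv_f_f[OF j] pm_tr_id[OF M] pm_tr_comp[OF M])

lemma embed_nat_trans:
  assumes "inj j"
  shows "(\<lambda>x. j) \<in> nat_trans K M (embed_pm j M)"
  by (intro nat_transI linear_mapsI) (auto simp: embed_pm_sel the_inv_f_f[OF assms])

lemma unembed_nat_trans:
  assumes M: "persistence_module K M" and j: "inj j"
  shows "(\<lambda>x. the_inv j) \<in> nat_trans K (embed_pm j M) M"
proof (rule nat_transI)
  fix x
  interpret V: module K "sp M x" by (rule pm_module[OF M])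
  show "the_inv j \<in> linear_maps K (sp (embed_pm j M) x) (sp M x)"
    by (rule linear_mapsI) (auto simp: embed_pm_sel the_inv_f_f[OF j])
qed (auto simp: embed_pm_sel the_inv_f_f[OF j])

lemma projective_pm: "projective K P \<Longrightarrow> persistence_module K P"
  unfolding projective_def by blast

text \<open>Conjugation with the two injections moves the lifting problem into the test type and the
  solution back, so \<open>A\<close> and \<open>B\<close> may have any types that inject into
  it.\<close>

lemma projective_lift:
  fixes P :: "('k, 'p) persmod" and A :: "('k, 'v) persmod" and B :: "('k, 'w) persmod"
    and jA :: "'v \<Rightarrow> real \<times> 'k \<times> 'p" and jB :: "'w \<Rightarrow> real \<times> 'k \<times> 'p"
  assumes P: "projective K P" and A: "persistence_module K A" and B: "persistence_module K B"
    and jA: "inj jA" and jB: "inj jB"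
    and q: "q \<in> nat_trans K A B" and f: "f \<in> nat_trans K P B"
    and surj: "\<And>x w. w \<in> elts B x \<Longrightarrow> \<exists>v\<in>elts A x. q x v = w"
  obtains g where "g \<in> nat_trans K P A" "\<And>x v. v \<in> elts P x \<Longrightarrow> q x (g x v) = f x v"
proof -
  let ?A = "embed_pm jA A" and ?B = "embed_pm jB B"
  define q' where "q' = (\<lambda>x u. jB (q x (the_inv jA u)))"
  define f' where "f' = (\<lambda>x v. jB (f x v))"
  have q': "q' \<in> nat_trans K ?A ?B"
    unfolding q'_def
    by (rule nat_trans_compose[OF nat_trans_compose[OF unembed_nat_trans[OF A jA] q] embed_nat_trans[OF jB]])
  have f': "f' \<in> nat_trans K P ?B"
    unfolding f'_def by (rule nat_trans_compose[OF f embed_nat_trans[OF jB]])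
  have "q' x ` elts ?A x = elts ?B x" for x
  proof -
    have "q x ` elts A x = elts B x" using surj nat_trans_closed[OF q] by blast
    moreover have "q' x ` elts ?A x = jB ` q x ` elts A x"
      by (simp add: embed_pm_sel q'_def image_image the_inv_f_f[OF jA])
    ultimately show ?thesis by (simp add: embed_pm_sel)
  qed
  then obtain g where g: "g \<in> nat_trans K P ?A" "\<forall>x. \<forall>v\<in>elts P x. q' x (g x v) = f' x v"
    using P[unfolded projective_def, THEN conjunct2, rule_format, OF embed_persistence_module[OF A jA]
        embed_persistence_module[OF B jB] q' f'] by blast
  show thesis
  proof (rule that)
    show "(\<lambda>x v. the_inv jA (g x v)) \<in> nat_trans K P A"
      by (rule nat_trans_compose[OF g(1) unembed_nat_trans[OF A jA]])
    show "q x (the_inv jA (g x v)) = f x v" if "v \<in> elts P x" for x v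
      using g(2) that injD[OF jB] unfolding q'_def f'_def by blast
  qed
qed

subsection \<open>Projective modules are torsion free\<close>

text \<open>Let \<open>B\<close> be \<open>P x\<close> in all degrees up to \<open>x\<close> and zero above. The map \<open>P \<rightarrow> B\<close> given by \<open>tr s x\<close> in
  degree \<open>s\<close> lifts along the surjection onto \<open>B\<close> from the constant module on \<open>P x\<close>, whose
  transition maps are injective.\<close>

lemma projective_tr_injective:
  fixes P :: "('k, 'p) persmod"
  assumes P: "projective K P" and xy: "x \<le> y" and v: "v \<in> elts P x"
    and 0: "tr P x y v = \<zero>\<^bsub>sp P y\<^esub>"
  shows "v = \<zero>\<^bsub>sp P x\<^esub>"
proof (cases "x = y")
  case True
  then show ?thesis using 0 pm_tr_id[OF projective_pm[OF P] v] by simp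
next
  case False
  note Pm = projective_pm[OF P]
  interpret V: module K "sp P x" by (rule pm_module[OF Pm])
  define A :: "('k, 'p) persmod" where "A = \<lparr>sp = (\<lambda>_. sp P x), tr = (\<lambda>_ _ v. v)\<rparr>"
  define B :: "('k, 'p) persmod" where
    "B = \<lparr>sp = (\<lambda>s. if s \<le> x then sp P x else (sp P x)\<lparr>carrier := {\<zero>\<^bsub>sp P x\<^esub>}\<rparr>),
      tr = (\<lambda>s t v. if t \<le> x then v else \<zero>\<^bsub>sp P x\<^esub>)\<rparr>"
  have A: "persistence_module K A"
    by (rule persistence_moduleI) (auto simp: A_def pm_field[OF Pm] pm_module[OF Pm] lin_id)
  have Z: "module K ((sp P x)\<lparr>carrier := {\<zero>\<^bsub>sp P x\<^esub>}\<rparr>)"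
    by (rule submodule.submodule_is_module[OF submodule_singleton_zero V.module_axioms]) (rule V.module_axioms)
  have B: "persistence_module K B"
  proof (rule persistence_moduleI)
    show "field K" by (rule pm_field[OF Pm])
    show "module K (sp B s)" for s using Z V.module_axioms by (simp add: B_def)
    show "tr B s t \<in> linear_maps K (sp B s) (sp B t)" if "s \<le> t" for s t
      using that by (intro linear_mapsI) (auto simp: B_def split: if_splits)
  qed (auto simp: B_def split: if_splits)
  define q where "q = (\<lambda>s v. if s \<le> x then v else \<zero>\<^bsub>sp P x\<^esub>)"
  define f where "f = (\<lambda>s v. if s \<le> x then tr P s x v else \<zero>\<^bsub>sp P x\<^esub>)"
  have q: "q \<in> nat_trans K A B"
    by (intro nat_transI linear_mapsI) (auto simp: A_def B_def q_def)
  have f: "f \<in> nat_trans K P B"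
  proof (rule nat_transI)
    show "f s \<in> linear_maps K (sp P s) (sp B s)" for s
      using pm_tr_linear[OF Pm, of s x]
      by (cases "s \<le> x") (auto simp: B_def f_def intro!: linear_mapsI dest: lin_closed lin_add lin_smult)
    show "f t (tr P s t u) = tr B s t (f s u)" if "s \<le> t" "u \<in> elts P s" for s t u
      using that by (auto simp: B_def f_def pm_tr_comp[OF Pm])
  qed
  \<comment> \<open>An injection of the type of \<open>P\<close> into its test type; the first two
    components are arbitrary constants.\<close>
  have inj: "inj (\<lambda>v::'p. (0::real, undefined::'k, v))" by (rule injI) simp
  have surj: "\<exists>u\<in>elts A s. q s u = w" if "w \<in> elts B s" for s w
    using that by (auto simp: A_def B_def q_def split: if_splits)
  obtain g where g: "g \<in> nat_trans K P A" "\<And>s v. v \<in> elts P s \<Longrightarrow> q s (g s v) = f s v"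
    using projective_lift[OF P A B inj inj q f surj] by metis
  \<comment> \<open>The transitions of \<open>A\<close> are identities, so \<open>g y\<close> also
    sends \<open>tr P x y v\<close> to \<open>v\<close>, whereas by linearity it sends zero to
    zero.\<close>
  have "g x v = v" using g(2)[OF v] pm_tr_id[OF Pm v] by (simp add: q_def f_def)
  moreover have "g y (tr P x y v) = g x v" using nat_trans_tr[OF g(1) xy v] by (simp add: A_def)
  moreover have "g y \<zero>\<^bsub>sp P y\<^esub> = \<zero>\<^bsub>sp P x\<^esub>"
    using lin_zero[OF pm_module[OF Pm] pm_module[OF A] nat_trans_linear[OF g(1)], of y] by (simp add: A_def)
  ultimately show ?thesis using 0 by simp
qed

subsection \<open>The standard resolution of a bounded interval module\<close>

text \<open>The assumption \<open>lift\<close> ranges over the test modules for the type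
  \<open>'w\<close> of the copy rather than for the type of \<open>M\<close>; composing with
  \<open>j\<close> and its inverse then transfers a lift.\<close>

lemma projective_embed:
  fixes j :: "'v \<Rightarrow> 'w" and M :: "('k, 'v) persmod"
  assumes M: "persistence_module K M" and j: "inj j"
    and lift: "\<And>(A :: ('k, real \<times> 'k \<times> 'w) persmod) (B :: ('k, real \<times> 'k \<times> 'w) persmod) q f.
      persistence_module K A \<Longrightarrow> persistence_module K B \<Longrightarrow> q \<in> nat_trans K A B \<Longrightarrow> f \<in> nat_trans K M B \<Longrightarrow>
      (\<And>x. q x ` elts A x = elts B x) \<Longrightarrow>
      \<exists>g\<in>nat_trans K M A. \<forall>x. \<forall>v\<in>elts M x. q x (g x v) = f x v"
  shows "projective K (embed_pm j M)"
  unfolding projective_def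
proof (intro conjI allI impI ballI)
  show "persistence_module K (embed_pm j M)" by (rule embed_persistence_module[OF M j])
  fix A B :: "('k, real \<times> 'k \<times> 'w) persmod" and q f
  assume "persistence_module K A" "persistence_module K B" "q \<in> nat_trans K A B"
    and f: "f \<in> nat_trans K (embed_pm j M) B" and "\<forall>x. q x ` elts A x = elts B x"
  moreover have "(\<lambda>x v. f x (j v)) \<in> nat_trans K M B"
    by (rule nat_trans_compose[OF embed_nat_trans[OF j] f])
  ultimately obtain g where g: "g \<in> nat_trans K M A" "\<And>x v. v \<in> elts M x \<Longrightarrow> q x (g x v) = f x (j v)"
    using lift[of A B q "\<lambda>x v. f x (j v)"] by blast
  have "(\<lambda>x v. g x (the_inv j v)) \<in> nat_trans K (embed_pm j M) A"
    by (rule nat_trans_compose[OF unembed_nat_trans[OF M j] g(1)])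
  then show "\<exists>g\<in>nat_trans K (embed_pm j M) A. \<forall>x. \<forall>v\<in>elts (embed_pm j M) x. q x (g x v) = f x v"
    by (rule bexI[rotated]) (auto simp: embed_pm_sel the_inv_f_f[OF j] g(2))
qed

text \<open>\<open>k[a,\<infinity>)\<close> is free on one generator of degree \<open>a\<close>: any
  preimage of the image of the generator determines a lift, and as the interval never ends there is
  no relation to respect.\<close>

lemma projective_embed_unbounded_interval:
  fixes j :: "'k \<Rightarrow> 'w"
  assumes K: "field K" and j: "inj j"
  shows "projective K (embed_pm j (interval_module K {a..}))"
proof (rule projective_embed[OF unbounded_interval_pm[OF K] j])
  interpret K: field K by (rule K)
  let ?M = "interval_module K {a..}"
  fix A B :: "('k, real \<times> 'k \<times> 'w) persmod" and q f
  assume A: "persistence_module K A" and B: "persistence_module K B" and q: "q \<in> nat_trans K A B"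
    and f: "f \<in> nat_trans K ?M B" and surj: "\<And>x. q x ` elts A x = elts B x"
  have one: "\<one>\<^bsub>K\<^esub> \<in> elts ?M a" by (simp add: interval_sel)
  have "f a \<one>\<^bsub>K\<^esub> \<in> q a ` elts A a"
    unfolding surj by (rule nat_trans_closed[OF f one])
  then obtain u where u: "u \<in> elts A a" "q a u = f a \<one>\<^bsub>K\<^esub>" by auto
  let ?g = "interval_map {a..} a A u"
  have g: "?g \<in> nat_trans K ?M A" by (rule interval_map_nat_trans[OF A _ _ u(1)]) auto
  have "q x (?g x v) = f x v" if v: "v \<in> elts ?M x" for x v
  proof (cases "a \<le> x")
    case False
    then have "v = \<zero>\<^bsub>sp ?M x\<^esub>" using v by (simp add: interval_sel)
    then show ?thesis
      using lin_zero[OF pm_module[OF unbounded_interval_pm[OF K]] pm_module[OF B] nat_trans_linear[OF f]]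
        lin_zero[OF pm_module[OF A] pm_module[OF B] nat_trans_linear[OF q]] False
      by (simp add: interval_map_def)
  next
    case True
    then have vK: "v \<in> carrier K" using v by (simp add: interval_sel)
    have "v = v \<odot>\<^bsub>sp ?M x\<^esub> tr ?M a x \<one>\<^bsub>K\<^esub>" using vK True by (simp add: interval_sel)
    then have "f x v = v \<odot>\<^bsub>sp B x\<^esub> f x (tr ?M a x \<one>\<^bsub>K\<^esub>)"
      using lin_smult[OF nat_trans_linear[OF f] vK
          pm_tr_closed[OF unbounded_interval_pm[OF K] True one]] by metis
    also have "f x (tr ?M a x \<one>\<^bsub>K\<^esub>) = q x (tr A a x u)"
      using nat_trans_tr[OF f True one] nat_trans_tr[OF q True u(1)] u(2) by simp
    also have "v \<odot>\<^bsub>sp B x\<^esub> \<dots> = q x (?g x v)"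
      using lin_smult[OF nat_trans_linear[OF q] vK pm_tr_closed[OF A True u(1)]] True
      by (simp add: interval_map_def)
    finally show ?thesis by simp
  qed
  then show "\<exists>g\<in>nat_trans K ?M A. \<forall>x. \<forall>v\<in>elts ?M x. q x (g x v) = f x v" using g by blast
qed

text \<open>The zero module, which fills the resolution from degree two on.\<close>

lemma projective_embed_empty_interval:
  fixes j :: "'k \<Rightarrow> 'w"
  assumes K: "field K" and j: "inj j"
  shows "projective K (embed_pm j (interval_module K {}))"
proof -
  have M: "persistence_module K (interval_module K {})"
    by (rule interval_module_persistence_module[OF K]) auto
  show ?thesis
  proof (rule projective_embed[OF M j])
    fix A B :: "('k, real \<times> 'k \<times> 'w) persmod" and q f
    assume A: "persistence_module K A" and B: "persistence_module K B" and q: "q \<in> nat_trans K A B"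
      and f: "f \<in> nat_trans K (interval_module K {}) B"
    show "\<exists>g\<in>nat_trans K (interval_module K {}) A.
        \<forall>x. \<forall>v\<in>elts (interval_module K {}) x. q x (g x v) = f x v"
      using lin_zero[OF pm_module[OF M] pm_module[OF B] nat_trans_linear[OF f]]
        lin_zero[OF pm_module[OF A] pm_module[OF B] nat_trans_linear[OF q]]
      by (intro bexI[OF _ nat_trans_zero[OF M A]]) (simp add: interval_sel)
  qed
qed

text \<open>\<open>k[b,\<infinity>)\<close> includes into \<open>k[a,\<infinity>)\<close> with
  quotient \<open>k[a,b)\<close>. The copies are placed in the type that \<open>resolution\<close>
  prescribes for a module over \<open>'k\<close>, so its \<open>SOME\<close> has a witness.\<close>

lemma interval_resolution_exists:
  fixes K :: "('k, 'm) ring_scheme"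
  assumes K: "field K" and ab: "a < b"
  shows "\<exists>(P :: nat \<Rightarrow> ('k, real \<times> 'k \<times> 'k) persmod) d \<epsilon>.
    projective_resolution K (interval_module K {a..<b}) P d \<epsilon>"
proof -
  interpret K: field K by (rule K)
  define j :: "'k \<Rightarrow> real \<times> 'k \<times> 'k" where "j = (\<lambda>k. (0, k, k))"
  have j: "inj j" unfolding j_def by (rule injI) simp
  note [simp] = the_inv_f_f[OF j]
  let ?M = "interval_module K {a..<b}"
  define I where "I = (\<lambda>n::nat. if n = 0 then {a..} else if n = Suc 0 then {b..} else {})"
  define P where "P = (\<lambda>n. embed_pm j (interval_module K (I n)))"
  \<comment> \<open>All terms use the same \<open>j\<close>, so the inclusion is the identity on
    underlying elements; every later differential starts at the zero module.\<close>
  define d where "d = (\<lambda>n (x::real) u. if n = (0::nat) then u else j \<zero>\<^bsub>K\<^esub>)"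
  define \<epsilon> where "\<epsilon> = (\<lambda>x u. if x \<in> {a..<b} then the_inv j u else \<zero>\<^bsub>K\<^esub>)"
  have c: "elts (P n) x = j ` (if x \<in> I n then carrier K else {\<zero>\<^bsub>K\<^esub>})"
    and z: "\<zero>\<^bsub>sp (P n) x\<^esub> = j \<zero>\<^bsub>K\<^esub>" for n x
    by (simp_all add: P_def embed_pm_sel interval_sel)
  have "projective K (P n)" for n
    unfolding P_def I_def
    using projective_embed_unbounded_interval[OF K j] projective_embed_empty_interval[OF K j] by simp
  moreover have "d n \<in> nat_trans K (P (Suc n)) (P n)" for n
    using ab by (intro nat_transI linear_mapsI)
      (auto simp: d_def P_def I_def embed_pm_sel interval_sel split: if_splits)
  moreover have "\<epsilon> \<in> nat_trans K (P 0) ?M"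
    by (intro nat_transI linear_mapsI) (auto simp: \<epsilon>_def P_def I_def embed_pm_sel interval_sel)
  moreover have "\<epsilon> x ` elts (P 0) x = elts ?M x" for x
    by (force simp: \<epsilon>_def c I_def interval_sel image_image)
  moreover have "d 0 x ` elts (P 1) x = a_kernel (sp (P 0) x) (sp ?M x) (\<epsilon> x)" for x
    using ab by (auto simp: \<epsilon>_def d_def c I_def interval_sel a_kernel_eq)
  moreover have "d (Suc n) x ` elts (P (Suc (Suc n))) x =
      a_kernel (sp (P (Suc n)) x) (sp (P n) x) (d n x)" for n x
    by (auto simp: d_def c z I_def a_kernel_eq)
  ultimately show ?thesis
    unfolding projective_resolution_def using bounded_interval_pm[OF K, of a b] by blast
qed

section \<open>Derived functors of interval modules\<close>

locale interval_resolution =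
  fixes K :: "('k, 'm) ring_scheme" and a b :: real
    and P :: "nat \<Rightarrow> ('k, real \<times> 'k \<times> 'k) persmod" and \<delta> \<epsilon>
  assumes K: "field K" and ab: "a < b"
    and res: "projective_resolution K (interval_module K {a..<b}) P \<delta> \<epsilon>"
begin

sublocale K: field K by (rule K)

abbreviation "M \<equiv> interval_module K {a..<b}"
abbreviation "P0 \<equiv> P 0"
abbreviation "P1 \<equiv> P (Suc 0)"
abbreviation "P2 \<equiv> P (Suc (Suc 0))"
abbreviation "d0 \<equiv> \<delta> 0"
abbreviation "d1 \<equiv> \<delta> (Suc 0)"

lemma M: "persistence_module K M"
  and proj: "projective K (P n)"
  and P: "persistence_module K (P n)"
  and \<delta>: "\<delta> n \<in> nat_trans K (P (Suc n)) (P n)"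
  and \<epsilon>: "\<epsilon> \<in> nat_trans K P0 M"
  and im_\<epsilon>: "\<epsilon> x ` elts P0 x = elts M x"
  and im_d0: "d0 x ` elts P1 x = {p \<in> elts P0 x. \<epsilon> x p = \<zero>\<^bsub>K\<^esub>}"
  and im_d1: "d1 x ` elts P2 x = {z \<in> elts P1 x. d0 x z = \<zero>\<^bsub>sp P0 x\<^esub>}"
proof -
  note r = res[unfolded projective_resolution_def]
  show "persistence_module K M" by (rule r[THEN conjunct1])
  show "projective K (P n)" using r[THEN conjunct2, THEN conjunct1] ..
  then show "persistence_module K (P n)" by (rule projective_pm)
  note r = r[THEN conjunct2, THEN conjunct2]
  show "\<delta> n \<in> nat_trans K (P (Suc n)) (P n)" using r[THEN conjunct1] ..
  note r = r[THEN conjunct2]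
  show "\<epsilon> \<in> nat_trans K P0 M" by (rule r[THEN conjunct1])
  note r = r[THEN conjunct2]
  show "\<epsilon> x ` elts P0 x = elts M x" using r[THEN conjunct1] ..
  note r = r[THEN conjunct2, unfolded a_kernel_eq]
  show "d0 x ` elts P1 x = {p \<in> elts P0 x. \<epsilon> x p = \<zero>\<^bsub>K\<^esub>}"
    using r[THEN conjunct1, THEN spec, of x] by (simp add: interval_sel(2))
  show "d1 x ` elts P2 x = {z \<in> elts P1 x. d0 x z = \<zero>\<^bsub>sp P0 x\<^esub>}"
    using r[THEN conjunct2, THEN spec, THEN spec, of 0 x] .
qed

lemmas \<delta>_closed = nat_trans_closed[OF \<delta>] and \<epsilon>_closed = nat_trans_closed[OF \<epsilon>]

lemma \<epsilon>_surj: "m \<in> elts M x \<Longrightarrow> \<exists>p\<in>elts P0 x. \<epsilon> x p = m"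
  using im_\<epsilon>[of x] by (metis imageE)

lemma \<epsilon>_d0: "z \<in> elts P1 x \<Longrightarrow> \<epsilon> x (d0 x z) = \<zero>\<^bsub>K\<^esub>"
  using im_d0[of x] by blast

lemma d0_d1: "u \<in> elts P2 x \<Longrightarrow> d0 x (d1 x u) = \<zero>\<^bsub>sp P0 x\<^esub>"
  using im_d1[of x] by blast

lemma exact0:
  assumes "p \<in> elts P0 x" "\<epsilon> x p = \<zero>\<^bsub>K\<^esub>"
  shows "\<exists>z\<in>elts P1 x. d0 x z = p"
proof -
  have "p \<in> d0 x ` elts P1 x" unfolding im_d0 using assms by simp
  then show ?thesis by blast
qed

lemma exact1:
  assumes "z \<in> elts P1 x" "d0 x z = \<zero>\<^bsub>sp P0 x\<^esub>"
  shows "\<exists>u\<in>elts P2 x. d1 x u = z"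
proof -
  have "z \<in> d1 x ` elts P2 x" unfolding im_d1 using assms by simp
  then show ?thesis by blast
qed

subsection \<open>Tor\<close>

text \<open>Since \<open>P i \<otimes> k[c,e)\<close> is \<open>P i (r - c) / tr (P i (r - e))\<close> and the transition maps of \<open>P i\<close> are
  injective, the first homology is the kernel of \<open>M (r - e) \<rightarrow> M (r - c)\<close>. The isomorphism is the
  connecting map: a cycle is represented by \<open>z\<close> with \<open>d z = tr p\<close>, and corresponds to \<open>\<epsilon> p\<close>.\<close>

lemma homology_gtensor:
  assumes ce: "c < (e::real)"
  defines "N \<equiv> interval_module K {c..<e}"
  shows "pm_isomorphic K
    (homology (\<lambda>i. gtensor K (P i) N) (\<lambda>i. gtensor_map K (P (Suc i)) (P i) N (\<delta> i)) 1)
    (interval_module K {max (a + e) (b + c)..<b + e})"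
proof -
  let ?G = "\<lambda>i. gtensor K (P i) N"
  let ?\<sigma> = "\<lambda>i. shift_elem K (P i) c e"
  define D where "D = (\<lambda>i. gtensor_map K (P (Suc i)) (P i) N (\<delta> i))"
  let ?Z = "\<lambda>r. a_kernel (sp (?G (Suc 0)) r) (sp (?G 0) r) (D 0 r)"
  let ?B = "\<lambda>r. D (Suc 0) r ` elts (?G (Suc (Suc 0))) r"
  let ?J = "{max (a + e) (b + c)..<b + e}"
  note J = bounded_interval_pm[OF K, of "max (a + e) (b + c)" "b + e"]
  have N: "persistence_module K N" unfolding N_def by (rule bounded_interval_pm[OF K])
  note P' = pm_module[OF P]
  note G = gtensor_persistence_module[OF P N] and G' = gtensor_module[OF P N]
  have \<sigma>: "?\<sigma> i r \<in> linear_maps K (sp (P i) (r - c)) (sp (?G i) r)" for i r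
    unfolding N_def by (rule shift_elem_linear[OF P ce])
  note \<sigma>_closed = lin_closed[OF \<sigma>]
  have \<sigma>_surj: "X \<in> elts (?G i) r \<Longrightarrow> \<exists>m\<in>elts (P i) (r - c). X = ?\<sigma> i r m" for i r X
    unfolding N_def by (rule shift_elem_surj[OF P ce])
  have \<sigma>_tr: "r \<le> r' \<Longrightarrow> m \<in> elts (P i) (r - c) \<Longrightarrow>
      tr (?G i) r r' (?\<sigma> i r m) = ?\<sigma> i r' (tr (P i) (r - c) (r' - c) m)" for i r r' m
    unfolding N_def by (rule shift_elem_tr[OF P ce])
  have \<sigma>_0: "m \<in> elts (P i) (r - c) \<Longrightarrow> ?\<sigma> i r m = \<zero>\<^bsub>sp (?G i) r\<^esub> \<longleftrightarrow>
      m \<in> tr (P i) (r - e) (r - c) ` elts (P i) (r - e)" for i r m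
    unfolding N_def by (rule shift_elem_zero_iff[OF P ce])
  have D: "D i r \<in> linear_maps K (sp (?G (Suc i)) r) (sp (?G i) r)" for i r
    unfolding D_def by (rule gtensor_map_linear[OF P P N \<delta>])
  have D_\<sigma>: "m \<in> elts (P (Suc i)) (r - c) \<Longrightarrow> D i r (?\<sigma> (Suc i) r m) = ?\<sigma> i r (\<delta> i (r - c) m)" for i r m
    unfolding D_def N_def by (rule gtensor_map_shift_elem[OF P ce P \<delta>])
  \<comment> \<open>Every element has the form \<open>?\<sigma> (Suc i) r m\<close>, and on such
    elements both sides are computed by naturality of \<open>\<delta> i\<close>.\<close>
  have D_tr: "D i r' (tr (?G (Suc i)) r r' X) = tr (?G i) r r' (D i r X)"
    if le: "r \<le> r'" and X: "X \<in> elts (?G (Suc i)) r" for i r r' X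
  proof -
    obtain m where m: "m \<in> elts (P (Suc i)) (r - c)" "X = ?\<sigma> (Suc i) r m" using \<sigma>_surj[OF X] by blast
    have "r - c \<le> r' - c" using le by simp
    then show ?thesis
      using m le by (simp add: \<sigma>_tr D_\<sigma> \<delta>_closed pm_tr_closed[OF P] nat_trans_tr[OF \<delta>])
  qed
  interpret subquotient_data K "?G (Suc 0)" ?Z ?B
  proof (rule subquotient_data.intro)
    show "persistence_module K (?G (Suc 0))" by (rule G)
    show "submodule (?Z r) K (sp (?G (Suc 0)) r)" for r by (rule submodule_kernel[OF G' G' D])
    show "submodule (?B r) K (sp (?G (Suc 0)) r)" for r by (rule submodule_image[OF G' G' D])
    show "?B r \<subseteq> ?Z r" for r
    proof
      fix X assume "X \<in> ?B r"
      then obtain u where u: "u \<in> elts P2 (r - c)" "X = D (Suc 0) r (?\<sigma> (Suc (Suc 0)) r u)"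
        using \<sigma>_surj by blast
      then have "D 0 r X = ?\<sigma> 0 r \<zero>\<^bsub>sp P0 (r - c)\<^esub>"
        by (simp add: D_\<sigma> \<delta>_closed d0_d1)
      then show "X \<in> ?Z r"
        using u lin_zero[OF P' G' \<sigma>] lin_closed[OF D] \<sigma>_closed by (simp add: a_kernel_eq)
    qed
    show "tr (?G (Suc 0)) r r' X \<in> ?Z r'" if "r \<le> r'" "X \<in> ?Z r" for r r' X
      using that pm_tr_closed[OF G that(1), of X "Suc 0"] pm_tr_zero[OF G that(1), of 0]
      by (simp add: a_kernel_eq D_tr)
    show "tr (?G (Suc 0)) r r' X \<in> ?B r'" if "r \<le> r'" "X \<in> ?B r" for r r' X
      using that pm_tr_closed[OF G that(1)] by (auto simp: D_tr[OF that(1), symmetric])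
  qed
  \<comment> \<open>A nonzero element of the kernel needs \<open>a \<le> r - e < b\<close> and,
    because \<open>r - c > r - e \<ge> a\<close>, also \<open>r - c \<ge> b\<close>. This is where
    \<open>max (a + e) (b + c)\<close> and \<open>b + e\<close> come from.\<close>
  have J_iff: "n \<in> elts (interval_module K ?J) r \<longleftrightarrow>
      n \<in> elts M (r - e) \<and> tr M (r - e) (r - c) n = \<zero>\<^bsub>K\<^esub>" for n r
    using ce by (auto simp: interval_sel split: if_splits)
  have le: "r - e \<le> r - c" for r using ce by simp
  note tr_cl = pm_tr_closed[OF P le]
  define R where "R = (\<lambda>r X n. \<exists>z\<in>elts P1 (r - c). \<exists>p\<in>elts P0 (r - e).
    d0 (r - c) z = tr P0 (r - e) (r - c) p \<and> X = ?\<sigma> (Suc 0) r z \<and> n = \<epsilon> (r - e) p)"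
  have n_J: "n \<in> elts (interval_module K ?J) r" if Rn: "R r X n" for r X n
  proof -
    obtain z p where zp: "z \<in> elts P1 (r - c)" "p \<in> elts P0 (r - e)"
      "d0 (r - c) z = tr P0 (r - e) (r - c) p" "n = \<epsilon> (r - e) p"
      using Rn unfolding R_def by blast
    have "tr M (r - e) (r - c) n = \<epsilon> (r - c) (d0 (r - c) z)"
      using zp nat_trans_tr[OF \<epsilon> le] by simp
    then have "tr M (r - e) (r - c) n = \<zero>\<^bsub>K\<^esub>" using \<epsilon>_d0[OF zp(1)] by simp
    then show ?thesis using \<epsilon>_closed[OF zp(2)] zp(4) unfolding J_iff by simp
  qed
  have "pm_isomorphic K SQ (interval_module K ?J)"
  proof (rule subquotient_isomorphic_of_relation[OF J, where R = R], goal_cases)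
    case (1 r X n)
    then obtain z p where zp: "z \<in> elts P1 (r - c)" "p \<in> elts P0 (r - e)"
      "d0 (r - c) z = tr P0 (r - e) (r - c) p" "X = ?\<sigma> (Suc 0) r z"
      unfolding R_def by blast
    have "D 0 r X = \<zero>\<^bsub>sp (?G 0) r\<^esub>"
      using zp \<sigma>_0[of "tr P0 (r - e) (r - c) p" 0 r] by (simp add: D_\<sigma> tr_cl)
    then show ?case using n_J[OF 1] zp \<sigma>_closed by (simp add: a_kernel_eq)
  next
    case (2 r X)
    then have X: "X \<in> elts (?G (Suc 0)) r" "D 0 r X = \<zero>\<^bsub>sp (?G 0) r\<^esub>" by (simp_all add: a_kernel_eq)
    obtain z where z: "z \<in> elts P1 (r - c)" "X = ?\<sigma> (Suc 0) r z" using \<sigma>_surj[OF X(1)] by blast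
    have "d0 (r - c) z \<in> tr P0 (r - e) (r - c) ` elts P0 (r - e)"
      using \<sigma>_0[of "d0 (r - c) z" 0 r] X(2) z by (simp add: D_\<sigma> \<delta>_closed)
    then show ?case unfolding R_def using z by blast
  next
    case (3 r n)
    then have n: "n \<in> elts M (r - e)" "tr M (r - e) (r - c) n = \<zero>\<^bsub>K\<^esub>" using J_iff by auto
    \<comment> \<open>After lifting \<open>n\<close> to \<open>p\<close>, the transition of
      \<open>p\<close> is killed by \<open>\<epsilon>\<close>, so exactness at \<open>P 0\<close>
      supplies the required \<open>z\<close>.\<close>
    obtain p where p: "p \<in> elts P0 (r - e)" "\<epsilon> (r - e) p = n" using \<epsilon>_surj[OF n(1)] by blast
    have "\<epsilon> (r - c) (tr P0 (r - e) (r - c) p) = \<zero>\<^bsub>K\<^esub>" using nat_trans_tr[OF \<epsilon> le p(1)] p n(2) by simp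
    then obtain z where "z \<in> elts P1 (r - c)" "d0 (r - c) z = tr P0 (r - e) (r - c) p"
      using exact0[OF tr_cl[OF p(1)]] by blast
    then show ?case unfolding R_def using p by blast
  next
    case (4 r X n X' n')
    obtain z p where zp: "z \<in> elts P1 (r - c)" "p \<in> elts P0 (r - e)"
      "d0 (r - c) z = tr P0 (r - e) (r - c) p" "X = ?\<sigma> (Suc 0) r z" "n = \<epsilon> (r - e) p"
      using 4(1) unfolding R_def by blast
    obtain z' p' where zp': "z' \<in> elts P1 (r - c)" "p' \<in> elts P0 (r - e)"
      "d0 (r - c) z' = tr P0 (r - e) (r - c) p'" "X' = ?\<sigma> (Suc 0) r z'" "n' = \<epsilon> (r - e) p'"
      using 4(2) unfolding R_def by blast
    interpret V1: module K "sp P1 (r - c)" by (rule P')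
    interpret V0: module K "sp P0 (r - e)" by (rule P')
    show ?case
      unfolding R_def
    proof (intro bexI conjI)
      show "z \<oplus>\<^bsub>sp P1 (r - c)\<^esub> z' \<in> elts P1 (r - c)" using zp zp' by simp
      show "p \<oplus>\<^bsub>sp P0 (r - e)\<^esub> p' \<in> elts P0 (r - e)" using zp zp' by simp
    qed (use zp zp' in \<open>simp_all add: lin_add[OF \<sigma>] lin_add[OF nat_trans_linear[OF \<delta>]]
          lin_add[OF nat_trans_linear[OF \<epsilon>]] lin_add[OF pm_tr_linear[OF P le]] interval_sel(3)\<close>)
  next
    case (5 r k X n)
    obtain z p where zp: "z \<in> elts P1 (r - c)" "p \<in> elts P0 (r - e)"
      "d0 (r - c) z = tr P0 (r - e) (r - c) p" "X = ?\<sigma> (Suc 0) r z" "n = \<epsilon> (r - e) p"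
      using 5(2) unfolding R_def by blast
    interpret V1: module K "sp P1 (r - c)" by (rule P')
    interpret V0: module K "sp P0 (r - e)" by (rule P')
    show ?case
      unfolding R_def
    proof (intro bexI conjI)
      show "k \<odot>\<^bsub>sp P1 (r - c)\<^esub> z \<in> elts P1 (r - c)" using zp 5 by simp
      show "k \<odot>\<^bsub>sp P0 (r - e)\<^esub> p \<in> elts P0 (r - e)" using zp 5 by simp
    qed (use zp 5 in \<open>simp_all add: lin_smult[OF \<sigma>] lin_smult[OF nat_trans_linear[OF \<delta>]]
          lin_smult[OF nat_trans_linear[OF \<epsilon>]] lin_smult[OF pm_tr_linear[OF P le]] interval_sel(4)\<close>)
  next
    case (6 r r' X n)
    then obtain z p where zp: "z \<in> elts P1 (r - c)" "p \<in> elts P0 (r - e)"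
      "d0 (r - c) z = tr P0 (r - e) (r - c) p" "X = ?\<sigma> (Suc 0) r z" "n = \<epsilon> (r - e) p"
      unfolding R_def by blast
    have le': "r - c \<le> r' - c" "r - e \<le> r' - e" using 6(1) by auto
    have "n \<in> elts M (r - e)" using zp \<epsilon>_closed by simp
    then have "tr (interval_module K ?J) r r' n = tr M (r - e) (r' - e) n"
      using n_J[OF 6(2)] 6(1) by (auto simp: interval_sel split: if_splits)
    moreover have "d0 (r' - c) (tr P1 (r - c) (r' - c) z) = tr P0 (r' - e) (r' - c) (tr P0 (r - e) (r' - e) p)"
      using zp nat_trans_tr[OF \<delta> le'(1)] pm_tr_comp[OF P le le'(1)] pm_tr_comp[OF P le'(2) le] by simp
    ultimately show ?case
      unfolding R_def
      using zp \<sigma>_tr[OF 6(1)] nat_trans_tr[OF \<epsilon> le'(2)] pm_tr_closed[OF P le'(1)] pm_tr_closed[OF P le'(2)]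
      by (intro bexI[of _ "tr P1 (r - c) (r' - c) z"] bexI[of _ "tr P0 (r - e) (r' - e) p"]) auto
  next
    case (7 r X)
    then obtain z p where zp: "z \<in> elts P1 (r - c)" "p \<in> elts P0 (r - e)"
      "d0 (r - c) z = tr P0 (r - e) (r - c) p" "X = ?\<sigma> (Suc 0) r z" "\<epsilon> (r - e) p = \<zero>\<^bsub>K\<^esub>"
      unfolding R_def by (auto simp: interval_sel(2))
    \<comment> \<open>Replacing \<open>z\<close> by \<open>z - tr w\<close> leaves \<open>X\<close>
      unchanged, since \<open>?\<sigma>\<close> kills transitions from degree \<open>r - e\<close>,
      and produces a cycle of \<open>P\<close> itself, hence a boundary by exactness at
      \<open>P 1\<close>.\<close>
    obtain w where w: "w \<in> elts P1 (r - e)" "d0 (r - e) w = p" using exact0[OF zp(2,5)] by blast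
    let ?w = "tr P1 (r - e) (r - c) w"
    interpret V1: module K "sp P1 (r - c)" by (rule P')
    interpret V0: module K "sp P0 (r - c)" by (rule P')
    interpret G1: module K "sp (?G (Suc 0)) r" by (rule G')
    have wc: "?w \<in> elts P1 (r - c)" by (rule tr_cl[OF w(1)])
    have "d0 (r - c) ?w = d0 (r - c) z" using nat_trans_tr[OF \<delta> le w(1)] w(2) zp(3) by simp
    then have "d0 (r - c) (z \<ominus>\<^bsub>sp P1 (r - c)\<^esub> ?w) = \<zero>\<^bsub>sp P0 (r - c)\<^esub>"
      using lin_diff[OF P' P' nat_trans_linear[OF \<delta>] zp(1) wc] module_diff_eq_zero_iff[OF P'] \<delta>_closed[OF zp(1)]
      by simp
    then obtain u where u: "u \<in> elts P2 (r - c)" "d1 (r - c) u = z \<ominus>\<^bsub>sp P1 (r - c)\<^esub> ?w"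
      using exact1[OF V1.M.minus_closed[OF zp(1) wc]] by blast
    have "?\<sigma> (Suc 0) r ?w = \<zero>\<^bsub>sp (?G (Suc 0)) r\<^esub>" using \<sigma>_0[OF wc] w(1) by simp
    moreover have "?\<sigma> (Suc 0) r (d1 (r - c) u) = X \<ominus>\<^bsub>sp (?G (Suc 0)) r\<^esub> ?\<sigma> (Suc 0) r ?w"
      unfolding u(2) zp(4) by (rule lin_diff[OF P' G' \<sigma> zp(1) wc])
    moreover have "X \<in> elts (?G (Suc 0)) r" using \<sigma>_closed[OF zp(1)] zp(4) by simp
    ultimately have "X = D (Suc 0) r (?\<sigma> (Suc (Suc 0)) r u)"
      using D_\<sigma>[OF u(1)] by (simp add: a_minus_def G1.M.add.inv_one)
    then show ?case using \<sigma>_closed[OF u(1)] by blast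
  next
    case (8 r X n)
    then obtain z p where zp: "z \<in> elts P1 (r - c)" "p \<in> elts P0 (r - e)"
      "d0 (r - c) z = tr P0 (r - e) (r - c) p" "X = ?\<sigma> (Suc 0) r z" "n = \<epsilon> (r - e) p"
      unfolding R_def by blast
    obtain u where u: "u \<in> elts P2 (r - c)" "X = D (Suc 0) r (?\<sigma> (Suc (Suc 0)) r u)"
      using 8(1) \<sigma>_surj by blast
    let ?u = "d1 (r - c) u"
    interpret V1: module K "sp P1 (r - c)" by (rule P')
    interpret V0: module K "sp P0 (r - e)" by (rule P')
    have uc: "?u \<in> elts P1 (r - c)" by (rule \<delta>_closed[OF u(1)])
    \<comment> \<open>\<open>z\<close> and \<open>d1 u\<close> represent the same class, so they
      differ by a transition from degree \<open>r - e\<close>.\<close>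
    have "?\<sigma> (Suc 0) r (z \<ominus>\<^bsub>sp P1 (r - c)\<^esub> ?u) = \<zero>\<^bsub>sp (?G (Suc 0)) r\<^esub>"
      using lin_diff[OF P' G' \<sigma> zp(1) uc] module_diff_eq_zero_iff[OF G'] \<sigma>_closed[OF zp(1)]
        u(2) zp(4) D_\<sigma>[OF u(1)] by simp
    then obtain w where w: "w \<in> elts P1 (r - e)"
      "z \<ominus>\<^bsub>sp P1 (r - c)\<^esub> ?u = tr P1 (r - e) (r - c) w"
      using \<sigma>_0[OF V1.M.minus_closed[OF zp(1) uc]] by auto
    interpret V0c: module K "sp P0 (r - c)" by (rule P')
    have "tr P0 (r - e) (r - c) (d0 (r - e) w) = d0 (r - c) (z \<ominus>\<^bsub>sp P1 (r - c)\<^esub> ?u)"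
      using nat_trans_tr[OF \<delta> le w(1)] w(2) by simp
    also have "\<dots> = d0 (r - c) z"
      using lin_diff[OF P' P' nat_trans_linear[OF \<delta>] zp(1) uc] d0_d1[OF u(1)] \<delta>_closed[OF zp(1)]
      by (simp add: a_minus_def V0c.M.add.inv_one)
    finally have "tr P0 (r - e) (r - c) (p \<ominus>\<^bsub>sp P0 (r - e)\<^esub> d0 (r - e) w) = \<zero>\<^bsub>sp P0 (r - c)\<^esub>"
      using lin_diff[OF P' P' pm_tr_linear[OF P le] zp(2) \<delta>_closed[OF w(1)]]
        module_diff_eq_zero_iff[OF P'] zp(3) tr_cl[OF zp(2)] by simp
    \<comment> \<open>Injectivity of the transition maps of \<open>P 0\<close> turns
      \<open>tr p = tr (d0 w)\<close> into \<open>p = d0 w\<close>; exactness alone would not give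
      this.\<close>
    then have "p = d0 (r - e) w"
      using projective_tr_injective[OF proj le V0.M.minus_closed[OF zp(2) \<delta>_closed[OF w(1)]]]
        module_diff_eq_zero_iff[OF P' zp(2) \<delta>_closed[OF w(1)]] by simp
    then show ?case using zp(5) \<epsilon>_d0[OF w(1)] by (simp add: interval_sel(2))
  qed
  then show ?thesis by (simp add: homology_def D_def)
qed


text \<open>The comparison with the resolution \<open>k[b,\<infinity>) \<rightarrow> k[a,\<infinity>) \<rightarrow> k[a,b)\<close>: the generators go to \<open>e1\<close> and
  \<open>e0\<close>, the map \<open>g\<close> goes back in degree zero, and \<open>h\<close> is the chain homotopy.\<close>

lemma comparison:
  obtains g e0 e1 h where
    "g \<in> nat_trans K P0 (interval_module K {a..})" "e0 \<in> elts P0 a" "e1 \<in> elts P1 b"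
    "h \<in> nat_trans K P0 P1" "g a e0 = \<one>\<^bsub>K\<^esub>" "d0 b e1 = tr P0 a b e0"
    "\<And>x z. z \<in> elts P1 x \<Longrightarrow> x < b \<Longrightarrow> g x (d0 x z) = \<zero>\<^bsub>K\<^esub>"
    "\<And>x z. z \<in> elts P1 x \<Longrightarrow> \<exists>u\<in>elts P2 x. h x (d0 x z) =
      (z \<ominus>\<^bsub>sp P1 x\<^esub> (if b \<le> x then g x (d0 x z) \<odot>\<^bsub>sp P1 x\<^esub> tr P1 b x e1 else \<zero>\<^bsub>sp P1 x\<^esub>)) \<oplus>\<^bsub>sp P1 x\<^esub> d1 x u"
proof -
  let ?Q = "interval_module K {a..}"
  note Q = unbounded_interval_pm[OF K, of a]
  note P' = pm_module[OF P] and M' = pm_module[OF M] and Q' = pm_module[OF Q]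
  define \<pi> where "\<pi> = (\<lambda>x v. if x \<in> {a..<b} then v else \<zero>\<^bsub>K\<^esub>)"
  have \<pi>: "\<pi> \<in> nat_trans K ?Q M"
    by (intro nat_transI linear_mapsI) (auto simp: \<pi>_def interval_sel)
  have \<pi>_surj: "\<exists>v\<in>elts ?Q x. \<pi> x v = w" if "w \<in> elts M x" for x w
    using that by (intro bexI[of _ w]) (auto simp: \<pi>_def interval_sel split: if_splits)
  \<comment> \<open>The terms of \<open>P\<close> have type
    \<open>real \<times> 'k \<times> 'k\<close>, so their test type nests that triple in its last
    component; both \<open>'k\<close> and the triples embed there.\<close>
  have j: "inj (\<lambda>k::'k. (0::real, k, undefined :: real \<times> 'k \<times> 'k))"
    and j': "inj (\<lambda>v:: real \<times> 'k \<times> 'k. (0::real, undefined :: 'k, v))" by (auto intro!: injI)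
  obtain g where g: "g \<in> nat_trans K P0 ?Q" "\<And>x v. v \<in> elts P0 x \<Longrightarrow> \<pi> x (g x v) = \<epsilon> x v"
    using projective_lift[OF proj Q M j j \<pi> \<epsilon> \<pi>_surj] by metis
  have "\<one>\<^bsub>K\<^esub> \<in> elts M a" using ab by (simp add: interval_sel)
  then obtain e0 where e0: "e0 \<in> elts P0 a" "\<epsilon> a e0 = \<one>\<^bsub>K\<^esub>" using \<epsilon>_surj by blast
  have g_e0: "g a e0 = \<one>\<^bsub>K\<^esub>" using g(2)[OF e0(1)] e0(2) ab by (simp add: \<pi>_def)
  have le: "a \<le> b" using ab by simp
  have "\<epsilon> b (tr P0 a b e0) = \<zero>\<^bsub>K\<^esub>"
    using nat_trans_tr[OF \<epsilon> le e0(1)] by (simp add: interval_sel(5))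
  then obtain e1 where e1: "e1 \<in> elts P1 b" "d0 b e1 = tr P0 a b e0"
    using exact0[OF pm_tr_closed[OF P le e0(1)]] by blast
  \<comment> \<open>On \<open>{a..<b}\<close> the map \<open>\<pi>\<close> is the identity and
    \<open>\<pi> g d0 = \<epsilon> d0 = 0\<close>; below \<open>a\<close> the target is zero. So
    \<open>g d0\<close> lives in degrees from \<open>b\<close> on, which makes it the comparison map
    from \<open>P 1\<close> to \<open>k[b,\<infinity>)\<close>.\<close>
  have gd0: "g x (d0 x z) = \<zero>\<^bsub>K\<^esub>" if z: "z \<in> elts P1 x" and x: "x < b" for x z
  proof (cases "a \<le> x")
    case True
    then show ?thesis using g(2)[OF \<delta>_closed[OF z]] \<epsilon>_d0[OF z] x by (simp add: \<pi>_def)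
  next
    case False
    then show ?thesis using nat_trans_closed[OF g(1) \<delta>_closed[OF z]] by (simp add: interval_sel(1))
  qed
  let ?f = "interval_map {a..} a P0 e0"
  have f: "?f \<in> nat_trans K ?Q P0"
    by (rule interval_map_nat_trans[OF P _ _ e0(1)]) auto
  \<comment> \<open>The defect from the identity of the composite
    \<open>P 0 \<rightarrow> k[a,\<infinity>) \<rightarrow> P 0\<close>. That composite lies over
    the identity of \<open>k[a,b)\<close>, so \<open>\<epsilon>\<close> kills the defect.\<close>
  define D where "D = (\<lambda>x p. p \<ominus>\<^bsub>sp P0 x\<^esub> ?f x (g x p))"
  have id: "(\<lambda>x p. p) \<in> nat_trans K P0 P0" by (rule nat_transI[OF lin_id]) simp
  have D: "D \<in> nat_trans K P0 P0"
    unfolding D_def by (rule nat_trans_diff[OF P P id nat_trans_compose[OF g(1) f]])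
  have \<epsilon>_D: "\<epsilon> x (D x p) = \<zero>\<^bsub>K\<^esub>" if p: "p \<in> elts P0 x" for x p
  proof (cases "x \<in> {a..<b}")
    case False
    then show ?thesis using \<epsilon>_closed[OF nat_trans_closed[OF D p]] by (auto simp: interval_sel(1))
  next
    case x: True
    then have ax: "a \<le> x" by simp
    have gp: "g x p = \<epsilon> x p" using g(2)[OF p] x by (simp add: \<pi>_def)
    have \<epsilon>K: "\<epsilon> x p \<in> carrier K" using \<epsilon>_closed[OF p] x by (simp add: interval_sel(1))
    have "\<epsilon> x (?f x (g x p)) = \<epsilon> x p \<odot>\<^bsub>sp M x\<^esub> \<epsilon> x (tr P0 a x e0)"
      using lin_smult[OF nat_trans_linear[OF \<epsilon>] \<epsilon>K pm_tr_closed[OF P ax e0(1)]] ax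
      by (simp add: interval_map_def gp)
    also have "\<epsilon> x (tr P0 a x e0) = \<one>\<^bsub>K\<^esub>"
      using nat_trans_tr[OF \<epsilon> ax e0(1)] e0(2) x ab by (simp add: interval_sel(5))
    finally have "\<epsilon> x (?f x (g x p)) = \<epsilon> x p" using \<epsilon>K by (simp add: interval_sel(4))
    moreover have "?f x (g x p) \<in> elts P0 x" by (rule nat_trans_closed[OF f nat_trans_closed[OF g(1) p]])
    ultimately show ?thesis
      using lin_diff[OF P' M' nat_trans_linear[OF \<epsilon>] p, of "?f x (g x p)"]
        module_diff_eq_zero_iff[OF M' \<epsilon>_closed[OF p] \<epsilon>_closed[OF p]]
      by (simp add: D_def interval_sel(2))
  qed
  define Z where "Z = (\<lambda>x. a_kernel (sp P0 x) (sp M x) (\<epsilon> x))"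
  have Z_iff: "p \<in> Z x \<longleftrightarrow> p \<in> elts P0 x \<and> \<epsilon> x p = \<zero>\<^bsub>K\<^esub>" for x p
    by (simp add: Z_def a_kernel_eq interval_sel(2))
  \<comment> \<open>\<open>d0\<close> is surjective only onto the kernel of
    \<open>\<epsilon>\<close>, so the lifting property is applied with this submodule as target;
    lifting \<open>D\<close> along \<open>d0\<close> yields the homotopy \<open>h\<close>.\<close>
  define Ker where "Ker = \<lparr>sp = \<lambda>x. (sp P0 x)\<lparr>carrier := Z x\<rparr>, tr = tr P0\<rparr>"
  have Ker_sel: "sp Ker x = (sp P0 x)\<lparr>carrier := Z x\<rparr>" "tr Ker = tr P0" for x by (simp_all add: Ker_def)
  have Ker: "persistence_module K Ker"
    unfolding Ker_def
  proof (rule submodule_persistence_module[OF P])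
    show "submodule (Z x) K (sp P0 x)" for x
      unfolding Z_def by (rule submodule_kernel[OF P' M' nat_trans_linear[OF \<epsilon>]])
    show "tr P0 x y v \<in> Z y" if "x \<le> y" "v \<in> Z x" for x y v
      using that pm_tr_closed[OF P that(1)] by (simp add: Z_iff nat_trans_tr[OF \<epsilon>] interval_sel(5))
  qed
  have into_Ker: "\<phi> \<in> nat_trans K L Ker"
    if \<phi>: "\<phi> \<in> nat_trans K L P0" and "\<And>x v. v \<in> elts L x \<Longrightarrow> \<epsilon> x (\<phi> x v) = \<zero>\<^bsub>K\<^esub>"
    for \<phi> and L :: "('k, real \<times> 'k \<times> 'k) persmod"
    using that(2) nat_trans_closed[OF \<phi>]
    by (intro nat_transI linear_mapsI)
      (auto simp: Ker_sel Z_iff nat_trans_tr[OF \<phi>] lin_add[OF nat_trans_linear[OF \<phi>]]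
        lin_smult[OF nat_trans_linear[OF \<phi>]])
  have surj: "\<exists>z\<in>elts P1 x. d0 x z = p" if "p \<in> elts Ker x" for x p
    using that exact0 by (simp add: Ker_sel Z_iff)
  obtain h where h: "h \<in> nat_trans K P0 P1" "\<And>x p. p \<in> elts P0 x \<Longrightarrow> d0 x (h x p) = D x p"
    using projective_lift[OF proj P Ker j' j' into_Ker[OF \<delta> \<epsilon>_d0] into_Ker[OF D \<epsilon>_D] surj] by metis
  \<comment> \<open>The homotopy identity on \<open>P 1\<close> is asserted only up to a boundary
    \<open>d1 u\<close>, chosen separately for each \<open>z\<close>. This avoids a homotopy
    \<open>P 1 \<rightarrow> P 2\<close> and is enough, because cocycles vanish on
    \<open>d1 u\<close>.\<close>
  have "\<exists>u\<in>elts P2 x. h x (d0 x z) =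
      (z \<ominus>\<^bsub>sp P1 x\<^esub> (if b \<le> x then g x (d0 x z) \<odot>\<^bsub>sp P1 x\<^esub> tr P1 b x e1 else \<zero>\<^bsub>sp P1 x\<^esub>)) \<oplus>\<^bsub>sp P1 x\<^esub> d1 x u"
    if z: "z \<in> elts P1 x" for x z
  proof -
    interpret V1: module K "sp P1 x" by (rule P')
    interpret V0: module K "sp P0 x" by (rule P')
    let ?\<kappa> = "g x (d0 x z)"
    \<comment> \<open>The image of \<open>z\<close> under
      \<open>P 1 \<rightarrow> k[b,\<infinity>) \<rightarrow> P 1\<close>, where the generator goes
      to \<open>e1\<close>. Below \<open>b\<close> there is no transition from \<open>e1\<close>,
      and \<open>\<kappa>\<close> is zero anyway.\<close>
    define w where "w = (if b \<le> x then ?\<kappa> \<odot>\<^bsub>sp P1 x\<^esub> tr P1 b x e1 else \<zero>\<^bsub>sp P1 x\<^esub>)"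
    have w: "w \<in> elts P1 x \<and> d0 x w = ?f x ?\<kappa>"
    proof (cases "b \<le> x")
      case True
      then have \<kappa>: "?\<kappa> \<in> carrier K"
        using nat_trans_closed[OF g(1) \<delta>_closed[OF z]] ab by (simp add: interval_sel(1))
      have t: "tr P1 b x e1 \<in> elts P1 x" by (rule pm_tr_closed[OF P True e1(1)])
      have "d0 x (tr P1 b x e1) = tr P0 a x e0"
        using nat_trans_tr[OF \<delta> True e1(1)] e1(2) pm_tr_comp[OF P le True e0(1)] by simp
      then show ?thesis
        using True \<kappa> t lin_smult[OF nat_trans_linear[OF \<delta>] \<kappa> t] ab
        by (simp add: w_def interval_map_def)
    next
      case False
      then have "?\<kappa> = \<zero>\<^bsub>K\<^esub>" using gd0[OF z] by simp
      moreover have "d0 x \<zero>\<^bsub>sp P1 x\<^esub> = \<zero>\<^bsub>sp P0 x\<^esub>" by (rule lin_zero[OF P' P' nat_trans_linear[OF \<delta>]])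
      ultimately show ?thesis
        using False pm_tr_closed[OF P _ e0(1), of x] by (simp add: w_def interval_map_def)
    qed
    have hz: "h x (d0 x z) \<in> elts P1 x" by (rule nat_trans_closed[OF h(1) \<delta>_closed[OF z]])
    have zw: "z \<ominus>\<^bsub>sp P1 x\<^esub> w \<in> elts P1 x" using z w by simp
    have "d0 x (z \<ominus>\<^bsub>sp P1 x\<^esub> w) = d0 x (h x (d0 x z))"
      using lin_diff[OF P' P' nat_trans_linear[OF \<delta>] z, of w] w h(2)[OF \<delta>_closed[OF z]]
      by (simp add: D_def)
    \<comment> \<open>Both terms have image \<open>D x (d0 x z)\<close> under \<open>d0\<close>, so
      exactness at \<open>P 1\<close> applies to their difference.\<close>
    then have "d0 x (h x (d0 x z) \<ominus>\<^bsub>sp P1 x\<^esub> (z \<ominus>\<^bsub>sp P1 x\<^esub> w)) = \<zero>\<^bsub>sp P0 x\<^esub>"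
      using lin_diff[OF P' P' nat_trans_linear[OF \<delta>] hz zw]
        module_diff_eq_zero_iff[OF P' \<delta>_closed[OF zw] \<delta>_closed[OF zw]] by simp
    then obtain u where u: "u \<in> elts P2 x"
      "d1 x u = h x (d0 x z) \<ominus>\<^bsub>sp P1 x\<^esub> (z \<ominus>\<^bsub>sp P1 x\<^esub> w)"
      using exact1[OF V1.M.minus_closed[OF hz zw]] by blast
    have "h x (d0 x z) = (z \<ominus>\<^bsub>sp P1 x\<^esub> w) \<oplus>\<^bsub>sp P1 x\<^esub> d1 x u"
      unfolding u(2) a_minus_def[of _ "h x (d0 x z)"]
      using V1.M.r_neg2[of "z \<ominus>\<^bsub>sp P1 x\<^esub> w" "h x (d0 x z)"] hz zw by (simp add: V1.M.a_ac V1.M.r_neg)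
    then show ?thesis using u(1) unfolding w_def by blast
  qed
  then show thesis using that[OF g(1) e0(1) e1(1) h(1) g_e0 e1(2) gd0] by blast
qed

subsection \<open>Ext\<close>

text \<open>The isomorphism evaluates a cocycle \<open>\<phi> : P 1 \<rightarrow> N(s)\<close> at \<open>e1\<close>. In general it identifies the first
  cohomology with \<open>N (s + b) / tr (N (s + a))\<close>.\<close>

lemma cohomology_ghom:
  assumes ce: "c < (e::real)"
  defines "N \<equiv> interval_module K {c..<e}"
  shows "pm_isomorphic K
    (cohomology (\<lambda>i. ghom K (P i) N) (\<lambda>i. ghom_map (P (Suc i)) (\<delta> i)) 1)
    (interval_module K {c - b..<min (c - a) (e - b)})"
proof -
  obtain g e0 e1 h where
    g: "g \<in> nat_trans K P0 (interval_module K {a..})" and e0: "e0 \<in> elts P0 a"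
    and e1: "e1 \<in> elts P1 b" and h: "h \<in> nat_trans K P0 P1" and g_e0: "g a e0 = \<one>\<^bsub>K\<^esub>"
    and d0_e1: "d0 b e1 = tr P0 a b e0"
    and gd0: "\<And>x z. z \<in> elts P1 x \<Longrightarrow> x < b \<Longrightarrow> g x (d0 x z) = \<zero>\<^bsub>K\<^esub>"
    and hd0: "\<And>x z. z \<in> elts P1 x \<Longrightarrow> \<exists>u\<in>elts P2 x. h x (d0 x z) =
      (z \<ominus>\<^bsub>sp P1 x\<^esub> (if b \<le> x then g x (d0 x z) \<odot>\<^bsub>sp P1 x\<^esub> tr P1 b x e1 else \<zero>\<^bsub>sp P1 x\<^esub>)) \<oplus>\<^bsub>sp P1 x\<^esub> d1 x u"
    using comparison by blast
  let ?H = "\<lambda>i. ghom K (P i) N"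
  let ?D = "\<lambda>i. ghom_map (P (Suc i)) (\<delta> i)"
  let ?Z = "\<lambda>s. a_kernel (sp (?H (Suc 0)) s) (sp (?H (Suc (Suc 0))) s) (?D (Suc 0) s)"
  let ?B = "\<lambda>s. ?D 0 s ` elts (?H 0) s"
  let ?J = "{c - b..<min (c - a) (e - b)}"
  note J = bounded_interval_pm[OF K, of "c - b" "min (c - a) (e - b)"]
  have N: "persistence_module K N" unfolding N_def by (rule bounded_interval_pm[OF K])
  note P' = pm_module[OF P] and N' = pm_module[OF N] and T = translate_persistence_module[OF N]
  note T' = pm_module[OF T]
  note H = ghom_persistence_module[OF P N] and H' = ghom_module[OF P N]
  note D = ghom_map_linear[OF P P N \<delta>] and D_tr = ghom_map_tr[OF P P N \<delta>]
  have le: "a \<le> b" using ab by simp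
  have D_app: "?D i s \<phi> x v = \<phi> x (\<delta> i x v)" if "v \<in> elts (P (Suc i)) x" for i s \<phi> x v
    using that by (simp add: ghom_map_def)
  have zero_app: "\<zero>\<^bsub>sp (?H i) s\<^esub> x v = \<zero>\<^bsub>K\<^esub>" if "v \<in> elts (P i) x" for i s x v
    using that by (simp add: ghom_sel hom_space_sel translate_sel N_def interval_sel(2))
  have zc: "\<zero>\<^bsub>sp (?H i) s\<^esub> \<in> elts (?H i) s" for i s
    by (rule abelian_groupE(2)[OF module.axioms(2)[OF H']])
  have Z_iff: "\<phi> \<in> ?Z s \<longleftrightarrow> \<phi> \<in> elts (?H (Suc 0)) s \<and>
      (\<forall>x. \<forall>u\<in>elts P2 x. \<phi> x (d1 x u) = \<zero>\<^bsub>K\<^esub>)" for \<phi> s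
  proof -
    have "?D (Suc 0) s \<phi> = \<zero>\<^bsub>sp (?H (Suc (Suc 0))) s\<^esub> \<longleftrightarrow> (\<forall>x. \<forall>u\<in>elts P2 x. \<phi> x (d1 x u) = \<zero>\<^bsub>K\<^esub>)"
      (is "?L \<longleftrightarrow> ?R") if \<phi>: "\<phi> \<in> elts (?H (Suc 0)) s"
    proof
      assume L: ?L
      show ?R
      proof (intro allI ballI)
        fix x u assume u: "u \<in> elts P2 x"
        show "\<phi> x (d1 x u) = \<zero>\<^bsub>K\<^esub>" using D_app[OF u, of s \<phi>] zero_app[OF u, of s] L by simp
      qed
    next
      assume R: ?R
      show ?L
        by (rule ghom_eqI[OF lin_closed[OF D \<phi>] zc]) (use R in \<open>simp add: D_app zero_app\<close>)
    qed
    then show ?thesis unfolding a_kernel_eq by blast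
  qed
  interpret subquotient_data K "?H (Suc 0)" ?Z ?B
  proof (rule subquotient_data.intro)
    show "persistence_module K (?H (Suc 0))" by (rule H)
    show "submodule (?Z s) K (sp (?H (Suc 0)) s)" for s by (rule submodule_kernel[OF H' H' D])
    show "submodule (?B s) K (sp (?H (Suc 0)) s)" for s by (rule submodule_image[OF H' H' D])
    show "?B s \<subseteq> ?Z s" for s
    proof
      fix \<phi> assume "\<phi> \<in> ?B s"
      then obtain \<psi> where \<psi>: "\<psi> \<in> elts (?H 0) s" "\<phi> = ?D 0 s \<psi>" by blast
      have "\<phi> x (d1 x u) = \<zero>\<^bsub>K\<^esub>" if u: "u \<in> elts P2 x" for x u
        using lin_zero[OF P' N' ghom_linear[OF \<psi>(1)], of x] d0_d1[OF u]
        by (simp add: \<psi>(2) D_app \<delta>_closed[OF u] N_def interval_sel(2))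
      then show "\<phi> \<in> ?Z s" using lin_closed[OF D \<psi>(1)] \<psi>(2) by (simp add: Z_iff)
    qed
    show "tr (?H (Suc 0)) s t \<phi> \<in> ?Z t" if "s \<le> t" "\<phi> \<in> ?Z s" for s t \<phi>
      using that pm_tr_closed[OF H that(1)] pm_tr_zero[OF H that(1), of "Suc (Suc 0)"]
      by (simp add: a_kernel_eq D_tr)
    show "tr (?H (Suc 0)) s t \<phi> \<in> ?B t" if "s \<le> t" "\<phi> \<in> ?B s" for s t \<phi>
      using that pm_tr_closed[OF H that(1)] by (auto simp: D_tr[symmetric])
  qed
  \<comment> \<open>With \<open>f\<close> sending the generator of \<open>k[a,\<infinity>)\<close>
    to \<open>n\<close>, the cocycle \<open>\<phi>\<close> is the coboundary of
    \<open>\<phi> h + f g\<close>: on \<open>d0 z\<close> the homotopy contributes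
    \<open>\<phi> z - \<phi> w\<close>, and \<open>f g\<close> restores
    \<open>\<phi> w\<close>.\<close>
  have cobound: "\<phi> \<in> ?B s" if \<phi>: "\<phi> \<in> ?Z s" and n: "n \<in> elts N (s + a)"
    and eq: "\<phi> b e1 = tr N (s + a) (s + b) n" for \<phi> s n
  proof -
    have \<phi>H: "\<phi> \<in> elts (?H (Suc 0)) s" and \<phi>0: "\<And>x u. u \<in> elts P2 x \<Longrightarrow> \<phi> x (d1 x u) = \<zero>\<^bsub>K\<^esub>"
      using \<phi> Z_iff by blast+
    note \<phi>c = ghom_closed[OF \<phi>H] and \<phi>l = ghom_linear[OF \<phi>H]
    let ?f = "interval_map {a..} a (translate N s) n"
    have f: "?f \<in> nat_trans K (interval_module K {a..}) (translate N s)"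
      by (rule interval_map_nat_trans[OF T]) (use n in \<open>auto simp: translate_sel\<close>)
    define \<psi> where "\<psi> = (\<lambda>x p. \<phi> x (h x p) \<oplus>\<^bsub>sp (translate N s) x\<^esub> ?f x (g x p))"
    have \<psi>: "\<psi> \<in> nat_trans K P0 (translate N s)"
      unfolding \<psi>_def
      by (rule nat_trans_add[OF P T nat_trans_compose[OF h ghom_nat_trans[OF \<phi>H]] nat_trans_compose[OF g f]])
    let ?\<psi> = "\<lambda>x. \<lambda>v\<in>elts P0 x. \<psi> x v"
    have \<psi>H: "?\<psi> \<in> elts (?H 0) s"
      unfolding ghom_sel by (rule restrict_hom_space[OF P \<psi>]) simp
    have "\<psi> x (d0 x z) = \<phi> x z" if z: "z \<in> elts P1 x" for x z
    proof -
      interpret W: module K "sp N (s + x)" by (rule N')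
      interpret V1: module K "sp P1 x" by (rule P')
      let ?\<kappa> = "g x (d0 x z)"
      define w where "w = (if b \<le> x then ?\<kappa> \<odot>\<^bsub>sp P1 x\<^esub> tr P1 b x e1 else \<zero>\<^bsub>sp P1 x\<^esub>)"
      obtain u where u: "u \<in> elts P2 x" "h x (d0 x z) = (z \<ominus>\<^bsub>sp P1 x\<^esub> w) \<oplus>\<^bsub>sp P1 x\<^esub> d1 x u"
        using hd0[OF z] unfolding w_def by blast
      \<comment> \<open>\<open>w\<close> is a multiple of a transition of \<open>e1\<close>, so
        \<open>\<phi>\<close> at \<open>w\<close> is fixed by \<open>\<phi> b e1\<close>, and
        \<open>eq\<close> expresses that through \<open>n\<close>.\<close>
      have w: "w \<in> elts P1 x \<and> \<phi> x w = ?f x ?\<kappa>"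
      proof (cases "b \<le> x")
        case True
        then have \<kappa>: "?\<kappa> \<in> carrier K"
          using nat_trans_closed[OF g \<delta>_closed[OF z]] ab by (simp add: interval_sel(1))
        have t: "tr P1 b x e1 \<in> elts P1 x" by (rule pm_tr_closed[OF P True e1])
        have "\<phi> x (tr P1 b x e1) = tr N (s + a) (s + x) n"
          using ghom_tr[OF \<phi>H True e1] eq pm_tr_comp[OF N _ _ n, of "s + b" "s + x"] le True by simp
        then show ?thesis
          using True \<kappa> t lin_smult[OF \<phi>l \<kappa> t] ab
          by (simp add: w_def interval_map_def translate_sel)
      next
        case False
        then have "?\<kappa> = \<zero>\<^bsub>K\<^esub>" using gd0[OF z] by simp
        then show ?thesis
          using False lin_zero[OF P' N' \<phi>l] pm_tr_closed[OF N _ n, of "s + x"]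
          by (simp add: w_def interval_map_def translate_sel)
      qed
      have zw: "z \<ominus>\<^bsub>sp P1 x\<^esub> w \<in> elts P1 x" using z w by simp
      have fc: "?f x ?\<kappa> \<in> elts N (s + x)" using \<phi>c[of w x] w by simp
      have "\<phi> x (h x (d0 x z)) = \<phi> x (z \<ominus>\<^bsub>sp P1 x\<^esub> w) \<oplus>\<^bsub>sp N (s + x)\<^esub> \<phi> x (d1 x u)"
        unfolding u(2) by (rule lin_add[OF \<phi>l zw \<delta>_closed[OF u(1)]])
      also have "\<dots> = \<phi> x (z \<ominus>\<^bsub>sp P1 x\<^esub> w)"
        using \<phi>0[OF u(1)] W.M.r_zero[OF \<phi>c[OF zw]] by (simp add: N_def interval_sel(2))
      also have "\<dots> = \<phi> x z \<ominus>\<^bsub>sp N (s + x)\<^esub> ?f x ?\<kappa>"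
        using lin_diff[OF P' N' \<phi>l z, of w] w by simp
      finally show ?thesis
        using \<phi>c[OF z] fc
        by (simp add: \<psi>_def translate_sel a_minus_def W.M.a_assoc W.M.l_neg)
    qed
    then have "?D 0 s ?\<psi> = \<phi>"
      using lin_closed[OF D \<psi>H] \<phi>H \<delta>_closed
      by (intro ghom_eqI[of _ K P1 N s]) (auto simp: D_app)
    then show ?thesis using \<psi>H by blast
  qed
  \<comment> \<open>The cocycle is the composite
    \<open>P 1 \<rightarrow> k[b,\<infinity>) \<rightarrow> N(s)\<close> with generator going to
    \<open>n\<close>. It kills \<open>d1\<close> because its first map is \<open>g d0\<close>, and
    it takes the value \<open>n\<close> at \<open>e1\<close> because
    \<open>g d0 e1 = g (tr e0) = \<one>\<close>.\<close>
  have extend: "\<exists>\<phi>\<in>?Z s. \<phi> b e1 = n" if n: "n \<in> elts N (s + b)" for s n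
  proof -
    let ?f = "interval_map {b..} b (translate N s) n"
    let ?gd = "\<lambda>x z. g x (d0 x z)"
    have f: "?f \<in> nat_trans K (interval_module K {b..}) (translate N s)"
      by (rule interval_map_nat_trans[OF T]) (use n in \<open>auto simp: translate_sel\<close>)
    note gd = nat_trans_compose[OF \<delta> g]
    \<comment> \<open>The vanishing of \<open>g d0\<close> below \<open>b\<close> is what allows the
      smaller target \<open>k[b,\<infinity>)\<close> in place of
      \<open>k[a,\<infinity>)\<close>.\<close>
    have gd': "?gd \<in> nat_trans K P1 (interval_module K {b..})"
    proof (rule nat_transI)
      show "(\<lambda>z. g x (d0 x z)) \<in> linear_maps K (sp P1 x) (sp (interval_module K {b..}) x)" for x
        using nat_trans_closed[OF gd, of _ x] gd0[of _ x] ab lin_add[OF nat_trans_linear[OF gd, of x]]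
          lin_smult[OF nat_trans_linear[OF gd, of x]]
        by (intro linear_mapsI) (auto simp: interval_sel)
      show "g y (d0 y (tr P1 x y z)) = tr (interval_module K {b..}) x y (g x (d0 x z))"
        if "x \<le> y" "z \<in> elts P1 x" for x y z
        using nat_trans_tr[OF gd that] gd0[OF that(2)] that(1) ab by (auto simp: interval_sel)
    qed
    define \<phi> where "\<phi> = (\<lambda>x. \<lambda>z\<in>elts P1 x. ?f x (g x (d0 x z)))"
    have \<phi>H: "\<phi> \<in> elts (?H (Suc 0)) s"
      unfolding \<phi>_def ghom_sel by (rule restrict_hom_space[OF P nat_trans_compose[OF gd' f]]) simp
    have "\<phi> x (d1 x u) = \<zero>\<^bsub>K\<^esub>" if u: "u \<in> elts P2 x" for x u
    proof -
      have "g x (d0 x (d1 x u)) = \<zero>\<^bsub>sp (interval_module K {b..}) x\<^esub>"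
        using d0_d1[OF u] lin_zero[OF P' pm_module[OF unbounded_interval_pm[OF K]] nat_trans_linear[OF g], of x]
        by (simp add: interval_sel(2))
      then show ?thesis
        using lin_zero[OF pm_module[OF unbounded_interval_pm[OF K]] T' nat_trans_linear[OF f], of x] \<delta>_closed[OF u]
        by (simp add: \<phi>_def translate_sel N_def interval_sel(2))
    qed
    moreover have "\<phi> b e1 = n"
    proof -
      have "g b (d0 b e1) = \<one>\<^bsub>K\<^esub>"
        using nat_trans_tr[OF g le e0] d0_e1 g_e0 le by (simp add: interval_sel(5))
      then show ?thesis
        using e1 n pm_tr_id[OF N n] module.smult_one[OF N' n]
        by (simp add: \<phi>_def interval_map_def translate_sel)
    qed
    ultimately show ?thesis using \<phi>H Z_iff by blast
  qed
  have "pm_isomorphic K SQ (interval_module K ?J)"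
  \<comment> \<open>Outside \<open>?J\<close> every value at \<open>e1\<close> comes from degree
    \<open>s + a\<close>, so the class is trivial and zero is recorded.\<close>
  proof (rule subquotient_isomorphic_of_relation[OF J, where
        R = "\<lambda>s \<phi> n. \<phi> \<in> ?Z s \<and> n = (if s \<in> ?J then \<phi> b e1 else \<zero>\<^bsub>K\<^esub>)"], goal_cases)
    case (1 s \<phi> n)
    then have "\<phi> b e1 \<in> elts N (s + b)" using ghom_closed[OF Z_closed e1] by blast
    then show ?case using 1 by (auto simp: N_def interval_sel split: if_splits)
  next
    case (3 s n)
    show ?case
    proof (cases "s \<in> ?J")
      case True
      then have "n \<in> elts N (s + b)" using 3 by (auto simp: N_def interval_sel)
      then show ?thesis using extend True by metis
    next
      case False
      then have "n = \<zero>\<^bsub>K\<^esub>" using 3 by (auto simp: interval_sel(1) split: if_splits)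
      then show ?thesis using submodule_zero[OF H' Z] False by auto
    qed
  next
    case (4 s \<phi> n \<psi> n')
    then have "(\<phi> \<oplus>\<^bsub>sp (?H (Suc 0)) s\<^esub> \<psi>) b e1 = \<phi> b e1 \<oplus>\<^bsub>K\<^esub> \<psi> b e1"
      using e1 by (simp add: ghom_sel hom_space_sel translate_sel N_def interval_sel(3))
    then show ?case using 4 submodule_add[OF H' Z] by (simp add: interval_sel(3))
  next
    case (5 s k \<phi> n)
    then have "(k \<odot>\<^bsub>sp (?H (Suc 0)) s\<^esub> \<phi>) b e1 = k \<otimes>\<^bsub>K\<^esub> \<phi> b e1"
      using e1 by (simp add: ghom_sel hom_space_sel translate_sel N_def interval_sel(4))
    then show ?case using 5 submodule_smult[OF H' Z] by (simp add: interval_sel(4))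
  next
    case (6 s t \<phi> n)
    then have \<phi>: "\<phi> \<in> ?Z s" and n: "n = (if s \<in> ?J then \<phi> b e1 else \<zero>\<^bsub>K\<^esub>)" by auto
    have "(tr (?H (Suc 0)) s t \<phi>) b e1 = tr N (s + b) (t + b) (\<phi> b e1)"
      using e1 by (simp add: ghom_sel)
    moreover have "\<phi> b e1 \<in> elts N (s + b)" using ghom_closed[OF Z_closed[OF \<phi>] e1] .
    \<comment> \<open>If \<open>t\<close> lies in \<open>?J\<close> but \<open>s\<close> does not,
      then \<open>s < c - b\<close>, and the value of \<open>\<phi>\<close> in degree
      \<open>s + b\<close> is already zero.\<close>
    ultimately have "tr (interval_module K ?J) s t n = (if t \<in> ?J then (tr (?H (Suc 0)) s t \<phi>) b e1 else \<zero>\<^bsub>K\<^esub>)"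
      using 6(1) ab unfolding n by (auto simp: N_def interval_sel split: if_splits)
    then show ?case using tr_Z[OF 6(1) \<phi>] by simp
  next
    case (7 s \<phi>)
    then have \<phi>: "\<phi> \<in> ?Z s" and 0: "s \<in> ?J \<Longrightarrow> \<phi> b e1 = \<zero>\<^bsub>K\<^esub>" by (auto simp: interval_sel(2))
    have c: "\<phi> b e1 \<in> elts N (s + b)" using ghom_closed[OF Z_closed[OF \<phi>] e1] .
    show ?case
    proof (cases "\<phi> b e1 = \<zero>\<^bsub>K\<^esub>")
      case True
      show ?thesis
        by (rule cobound[OF \<phi>, of "\<zero>\<^bsub>K\<^esub>"]) (use True in \<open>auto simp: N_def interval_sel\<close>)
    next
      case False
      \<comment> \<open>A nonzero value outside \<open>?J\<close> means
        \<open>s \<ge> c - a\<close>, so \<open>N (s + a) \<rightarrow> N (s + b)\<close> is the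
        identity and the value itself serves as the preimage \<open>n\<close> in
        \<open>cobound\<close>.\<close>
      then have "s \<notin> ?J" "s + b \<in> {c..<e}" using 0 c by (auto simp: N_def interval_sel split: if_splits)
      then have "s + a \<in> {c..<e}" using ab by auto
      then show ?thesis
        by (intro cobound[OF \<phi>, of "\<phi> b e1"]) (use c \<open>s + b \<in> {c..<e}\<close> in \<open>auto simp: N_def interval_sel\<close>)
    qed
  next
    case (8 s \<phi> n)
    then obtain \<psi> where \<psi>: "\<psi> \<in> elts (?H 0) s" "\<phi> = ?D 0 s \<psi>" by blast
    \<comment> \<open>A coboundary takes at \<open>e1\<close> a value coming from degree
      \<open>s + a\<close>, and for \<open>s\<close> in \<open>?J\<close> one has
      \<open>s + a < c\<close>, where \<open>N\<close> is zero.\<close>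
    have "\<phi> b e1 = tr N (s + a) (s + b) (\<psi> a e0)"
      using ghom_tr[OF \<psi>(1) le e0] e1 d0_e1 by (simp add: \<psi>(2) D_app)
    moreover have "\<psi> a e0 \<in> elts N (s + a)" by (rule ghom_closed[OF \<psi>(1) e0])
    ultimately show ?case using 8(2) by (auto simp: N_def interval_sel split: if_splits)
  qed auto
  then show ?thesis by (simp add: cohomology_def)
qed

end

text \<open>A witness for the specification of \<open>resolution\<close> exists, so the chosen pair
  satisfies it; the results proved for an arbitrary resolution then apply to the one inside
  \<open>Tor_gr\<close> and \<open>Ext_gr\<close>.\<close>

lemma resolution_interval:
  fixes K :: "('k, 'm) ring_scheme"
  assumes "field K" "a < b"
  obtains P \<delta> \<epsilon> where "resolution K (interval_module K {a..<b}) = (P, \<delta>)" "interval_resolution K a b P \<delta> \<epsilon>"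
proof -
  let ?S = "\<lambda>(P :: nat \<Rightarrow> ('k, real \<times> 'k \<times> 'k) persmod, d). \<exists>\<epsilon>. projective_resolution K (interval_module K {a..<b}) P d \<epsilon>"
  obtain P \<delta> where r: "resolution K (interval_module K {a..<b}) = (P, \<delta>)" by fastforce
  have "\<exists>p. ?S p" using interval_resolution_exists[OF assms] by (simp only: split_paired_Ex prod.case)
  then have "?S (SOME p. ?S p)" by (rule someI_ex)
  then have "?S (P, \<delta>)" using r unfolding resolution_def by metis
  then obtain \<epsilon> where "projective_resolution K (interval_module K {a..<b}) P \<delta> \<epsilon>" by blast
  then show thesis using that[OF r] assms by (simp add: interval_resolution_def)
qed

theorem proposition1p1:
  fixes K :: "('k, 'm) ring_scheme" and a b c d :: real
  assumes "field K" and "a < b" and "c < d"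
  shows "pm_isomorphic K
           (gtensor K (interval_module K {a..<b}) (interval_module K {c..<d}))
           (interval_module K {a + c..<min (a + d) (b + c)}) \<and>
         pm_isomorphic K
           (ghom K (interval_module K {a..<b}) (interval_module K {c..<d}))
           (interval_module K {max (c - a) (d - b)..<d - a}) \<and>
         pm_isomorphic K
           (Tor_gr K 1 (interval_module K {a..<b}) (interval_module K {c..<d}))
           (interval_module K {max (a + d) (b + c)..<b + d}) \<and>
         pm_isomorphic K
           (Ext_gr K 1 (interval_module K {a..<b}) (interval_module K {c..<d}))
           (interval_module K {c - b..<min (c - a) (d - b)})"
proof -
  obtain P \<delta> \<epsilon> where r: "resolution K (interval_module K {a..<b}) = (P, \<delta>)"
    and R: "interval_resolution K a b P \<delta> \<epsilon>"
    using resolution_interval[OF assms(1,2)] .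
  show ?thesis
    using gtensor_interval[OF assms] ghom_interval[OF assms]
      interval_resolution.homology_gtensor[OF R assms(3)] interval_resolution.cohomology_ghom[OF R assms(3)]
    unfolding Tor_gr_def Ext_gr_def r prod.case by blast
qed

end
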